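(* Let $\lambda,\lambda_0\in\mathbb{C}^*$ and $a,b,b',b_0',a_i,b_i\in\mathbb{C}$ for $i=0,1,2$, with $0\le\mathrm{Re}\,a<1$, $0\le\mathrm{Re}\,a_i<1$ for $i=0,1,2$, and $b'b_0'b_1b_2\ne0$. Let $B\in\mathcal{O}_{\mathfrak{b}}$ and $W,W_0\in\mathcal{O}_{\mathfrak{W}}$ be nontrivial simple modules. (a) Suppose that $\mathcal{L}(W,\lambda,a,b)$ is simple. Then $\mathcal{L}(W,\lambda,a,b)\cong\mathcal{L}(W_0,\lambda_0,a_0,b_0)$ if and only if one of the following holds: (i) $W\cong W_0$, $\lambda=\lambda_0$, $a=a_0$ and $b=b_0$; or (ii) $W,W_0$ are highest weight modules with highest weights $b',b_0'$ respectively, and $\lambda_0=\lambda^{-1}$, $a=a_0$, $b=b_0'+1$, $b_0=b'+1$. (b) For $i=0,1$, we have $\mathcal{L}_i(a_1,b_1)\cong\mathcal{L}_i(a_2,b_2)$ if and only if $a_1=a_2$ and $b_1=b_2$. (c) The modules $\mathcal{L}(W,\lambda,a,b)$, $\mathcal{N}(B,a_0)$, $\mathcal{L}_0(a_1,b_1)$, $\mathcal{L}_1(a_2,b_2)$ are pairwise non-isomorphic.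
   Context: $\mathbb{Z}_+$ denotes the nonnegative integers. The Virasoro algebra $\mathfrak{V}$ has basis $\{d_n,z : n\in\mathbb{Z}\}$, $z$ central, $[d_n,d_m]=(m-n)d_{m+n}+\delta_{n,-m}\frac{n^3-n}{12}z$; isomorphisms and simplicity of the modules $\mathcal{L}(\cdot)$, $\mathcal{N}(\cdot)$, $\mathcal{L}_i(\cdot)$ are as $\mathfrak{V}$-modules. $\mathfrak{W}=\mathrm{Der}(\mathbb{C}[t])$ has basis $\{d_i=t^{i+1}\frac{d}{dt} : i\ge-1\}$ with $[d_n,d_m]=(m-n)d_{m+n}$, and $\mathfrak{b}=\mathrm{span}\{d_i : i\ge0\}$. $\mathcal{O}_{\mathfrak{W}}$ (resp. $\mathcal{O}_{\mathfrak{b}}$) is the category of all $\mathfrak{W}$-modules (resp. $\mathfrak{b}$-modules) $M$ such that for every $w\in M$ there is a nonnegative integer $n$ (depending on $w$) with $d_iw=0$ for all $i\ge n$. A module $V$ over a Lie algebra $L$ is trivial if $LV=0$, nontrivial otherwise. A highest weight $\mathfrak{W}$-module with highest weight vector $w_0$ of highest weight $b'$ is a $\mathfrak{W}$-module generated by a nonzero vector $w_0$ with $d_0w_0=b'w_0$ and $d_iw_0=0$ for all $i>0$; for $b'\ne0$ it is the Verma module with basis $\{d_{-1}^kw_0 : k\in\mathbb{Z}_+\}$, unique up to isomorphism. For $W\in\mathcal{O}_{\mathfrak{W}}$, $\lambda\in\mathbb{C}^*$, $a,b\in\mathbb{C}$, $\mathcal{L}(W,\lambda,a,b)=W\otimes\mathbb{C}[t,t^{-1}]$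 is the $\mathfrak{V}$-module with $z\cdot(w\otimes t^j)=0$ and $d_k\cdot(w\otimes t^j)=\big(((\lambda^ke^{kt}-1)\frac{d}{dt}+a+kb+j)w\big)\otimes t^{k+j}$ for $k,j\in\mathbb{Z}$, $w\in W$, where $\frac{d}{dt}$ acts as $d_{-1}$ and $e^{kt}\frac{d}{dt}$ acts as $\sum_{i\ge0}\frac{k^i}{i!}d_{i-1}$. For $B\in\mathcal{O}_{\mathfrak{b}}$ and $a\in\mathbb{C}$, $\mathcal{N}(B,a)=B\otimes\mathbb{C}[t,t^{-1}]$ is the $\mathfrak{V}$-module with $z$ acting as $0$ and $d_m\cdot(v\otimes t^n)=\big((a+n)v+\sum_{i\ge0}\frac{m^{i+1}}{(i+1)!}d_iv\big)\otimes t^{n+m}$. For $a\in\mathbb{C}$ and $c\in\mathbb{C}^*$, let $W'$ be the highest weight $\mathfrak{W}$-module with highest weight vector $w_0'$ of highest weight $c$; then $\mathcal{L}_0(a,c)=\mathrm{span}\{d_1^i\cdot(w_0'\otimes t^{2j}) : i\in\mathbb{Z}_+,j\in\mathbb{Z}\}$ and $\mathcal{L}_1(a,c)=\mathrm{span}\{d_1^i\cdot(w_0'\otimes t^{2j+1}) : i\in\mathbb{Z}_+,j\in\mathbb{Z}\}$, which are $\mathfrak{V}$-submodules of $\mathcal{L}(W',-1,a,c+1)$. *)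

theory Defs
  imports Complex_Main "HOL-Library.Product_Plus" "HOL-Library.Poly_Mapping" "HOL-Computational_Algebra.Polynomial"
begin

section \<open>Lie algebras and their modules\<close>

record 'g lie =
  lie_carrier :: "'g set"
  lie_scale :: "complex \<Rightarrow> 'g \<Rightarrow> 'g"
  lie_bracket :: "'g \<Rightarrow> 'g \<Rightarrow> 'g"

text \<open>
  The underlying vector space of a module is a subspace \<open>rep_carrier\<close> of an ambient complex
  vector space, whose addition comes from the type and whose scalar multiplication is
  \<open>rep_scale\<close>; in this way a submodule is again a module on the same type. The values of
  \<open>rep_act\<close> off the carrier are irrelevant.
\<close>

record ('g, 'v) rep =
  rep_carrier :: "'v set"
  rep_scale :: "complex \<Rightarrow> 'v \<Rightarrow> 'v"
  rep_act :: "'g \<Rightarrow> 'v \<Rightarrow> 'v"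

definition lie_module :: "('g::ab_group_add) lie \<Rightarrow> ('g, 'v::ab_group_add) rep \<Rightarrow> bool" where
  "lie_module L M \<longleftrightarrow>
     vector_space (rep_scale M) \<and>
     module.subspace (rep_scale M) (rep_carrier M) \<and>
     (\<forall>x\<in>lie_carrier L. \<forall>v\<in>rep_carrier M. rep_act M x v \<in> rep_carrier M) \<and>
     (\<forall>x\<in>lie_carrier L. \<forall>u\<in>rep_carrier M. \<forall>v\<in>rep_carrier M.
        rep_act M x (u + v) = rep_act M x u + rep_act M x v) \<and>
     (\<forall>x\<in>lie_carrier L. \<forall>c. \<forall>v\<in>rep_carrier M.
        rep_act M x (rep_scale M c v) = rep_scale M c (rep_act M x v)) \<and>
     (\<forall>x\<in>lie_carrier L. \<forall>y\<in>lie_carrier L. \<forall>v\<in>rep_carrier M.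
        rep_act M (x + y) v = rep_act M x v + rep_act M y v) \<and>
     (\<forall>x\<in>lie_carrier L. \<forall>c. \<forall>v\<in>rep_carrier M.
        rep_act M (lie_scale L c x) v = rep_scale M c (rep_act M x v)) \<and>
     (\<forall>x\<in>lie_carrier L. \<forall>y\<in>lie_carrier L. \<forall>v\<in>rep_carrier M.
        rep_act M (lie_bracket L x y) v =
          rep_act M x (rep_act M y v) - rep_act M y (rep_act M x v))"

definition submodule :: "'g lie \<Rightarrow> ('g, 'v::ab_group_add) rep \<Rightarrow> 'v set \<Rightarrow> bool" where
  "submodule L M S \<longleftrightarrow>
     module.subspace (rep_scale M) S \<and> S \<subseteq> rep_carrier M \<and>
     (\<forall>x\<in>lie_carrier L. \<forall>v\<in>S. rep_act M x v \<in> S)"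

definition simple_module :: "'g lie \<Rightarrow> ('g, 'v::ab_group_add) rep \<Rightarrow> bool" where
  "simple_module L M \<longleftrightarrow>
     rep_carrier M \<noteq> {0} \<and> (\<forall>S. submodule L M S \<longrightarrow> S = {0} \<or> S = rep_carrier M)"

definition trivial_module :: "'g lie \<Rightarrow> ('g, 'v::ab_group_add) rep \<Rightarrow> bool" where
  "trivial_module L M \<longleftrightarrow> (\<forall>x\<in>lie_carrier L. \<forall>v\<in>rep_carrier M. rep_act M x v = 0)"

definition module_iso ::
  "'g lie \<Rightarrow> ('g, 'v::ab_group_add) rep \<Rightarrow> ('g, 'u::ab_group_add) rep \<Rightarrow> bool" where
  "module_iso L M N \<longleftrightarrow>
     (\<exists>f. bij_betw f (rep_carrier M) (rep_carrier N) \<and>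
       (\<forall>u\<in>rep_carrier M. \<forall>v\<in>rep_carrier M. f (u + v) = f u + f v) \<and>
       (\<forall>c. \<forall>v\<in>rep_carrier M. f (rep_scale M c v) = rep_scale N c (f v)) \<and>
       (\<forall>x\<in>lie_carrier L. \<forall>v\<in>rep_carrier M. f (rep_act M x v) = rep_act N x (f v)))"


section \<open>Finitely supported functions as a complex vector space\<close>

text \<open>
  \<open>V \<otimes> \<complex>[t, t\<inverse>]\<close> is modelled by the finitely supported functions from the integers to \<open>V\<close>,
  the tensor \<open>v \<otimes> t^j\<close> being \<^term>\<open>Poly_Mapping.single j v\<close>.
\<close>

definition pm_scale ::
  "(complex \<Rightarrow> 'v \<Rightarrow> 'v) \<Rightarrow> complex \<Rightarrow> ('i \<Rightarrow>\<^sub>0 'v::ab_group_add) \<Rightarrow> ('i \<Rightarrow>\<^sub>0 'v)" where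
  "pm_scale s c = Poly_Mapping.map (s c)"

lemma lookup_pm_scale:
  assumes "vector_space s"
  shows "Poly_Mapping.lookup (pm_scale s c f) j = s c (Poly_Mapping.lookup f j)"
proof -
  interpret vector_space s by (fact assms)
  show ?thesis by (simp add: pm_scale_def map.rep_eq when_def)
qed

lemma vector_space_pm_scale:
  assumes "vector_space s"
  shows "vector_space (pm_scale s)"
proof -
  interpret vector_space s by (fact assms)
  show ?thesis
    by unfold_locales
      (auto intro!: poly_mapping_eqI
        simp: lookup_pm_scale[OF assms] lookup_add scale_right_distrib scale_left_distrib)
qed


section \<open>The Virasoro algebra\<close>

text \<open>The pair \<open>(f, \<alpha>)\<close> stands for \<open>(\<Sum>n. f n d\<^sub>n) + \<alpha> z\<close>.\<close>

type_synonym vir = "(int \<Rightarrow>\<^sub>0 complex) \<times> complex"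

definition virasoro :: "vir lie" where
  "virasoro = \<lparr>
     lie_carrier = UNIV,
     lie_scale = (\<lambda>c (f, \<alpha>). (pm_scale (*) c f, c * \<alpha>)),
     lie_bracket = (\<lambda>(f, \<alpha>) (g, \<beta>).
       (\<Sum>n\<in>Poly_Mapping.keys f. \<Sum>m\<in>Poly_Mapping.keys g.
          Poly_Mapping.single (m + n)
            (of_int (m - n) * Poly_Mapping.lookup f n * Poly_Mapping.lookup g m),
        \<Sum>n\<in>Poly_Mapping.keys f.
          of_int (n ^ 3 - n) / 12 * Poly_Mapping.lookup f n * Poly_Mapping.lookup g (- n)))\<rparr>"

definition vir_d :: "int \<Rightarrow> vir" where
  "vir_d n = (Poly_Mapping.single n 1, 0)"

definition vir_z :: vir where
  "vir_z = (0, 1)"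

lemma virasoro_bracket_d:
  "lie_bracket virasoro (vir_d n) (vir_d m) =
     lie_scale virasoro (of_int (m - n)) (vir_d (m + n)) +
     lie_scale virasoro (if n = - m then of_int (n ^ 3 - n) / 12 else 0) vir_z"
  by (auto simp: virasoro_def vir_d_def vir_z_def pm_scale_def lookup_single map.rep_eq when_def zero_prod_def
      intro!: poly_mapping_eqI)

lemma virasoro_bracket_z:
  "lie_bracket virasoro vir_z x = 0" "lie_bracket virasoro x vir_z = 0"
  by (auto simp: virasoro_def vir_z_def zero_prod_def split: prod.splits)


section \<open>Derivations of the polynomial ring\<close>

text \<open>The polynomial \<open>p\<close> stands for the derivation \<open>p d/dt\<close>.\<close>

definition witt :: "complex poly lie" where
  "witt = \<lparr>lie_carrier = UNIV, lie_scale = smult,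
     lie_bracket = (\<lambda>p q. p * pderiv q - q * pderiv p)\<rparr>"

text \<open>\<open>d\<^sub>i = t^(i+1) d/dt\<close>; only meaningful for \<open>i \<ge> -1\<close>.\<close>

definition witt_d :: "int \<Rightarrow> complex poly" where
  "witt_d i = monom 1 (nat (i + 1))"

definition borel :: "complex poly lie" where
  "borel = witt\<lparr>lie_carrier := module.span smult {witt_d i | i. i \<ge> 0}\<rparr>"

lemma witt_bracket_d:
  assumes "n \<ge> -1" "m \<ge> -1" "n \<noteq> -1 \<or> m \<noteq> -1"
  shows "lie_bracket witt (witt_d n) (witt_d m) = lie_scale witt (of_int (m - n)) (witt_d (m + n))"
proof -
  define k l where "k = nat (n + 1)" and "l = nat (m + 1)"
  then have k: "n = int k - 1" and l: "m = int l - 1"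
    using assms(1,2) by auto
  have "nat (m + n + 1) = k + l - 1" "k + (l - 1) = k + l - 1 \<or> l = 0" "l + (k - 1) = k + l - 1 \<or> k = 0"
    using k l by auto
  then show ?thesis
    using k l by (auto simp: witt_def witt_d_def pderiv_monom mult_monom smult_monom diff_monom minus_monom)
qed

text \<open>Used with \<open>L = witt\<close> and \<open>L = borel\<close>.\<close>

definition category_O :: "complex poly lie \<Rightarrow> (complex poly, 'v::ab_group_add) rep \<Rightarrow> bool" where
  "category_O L M \<longleftrightarrow> lie_module L M \<and>
     (\<forall>w\<in>rep_carrier M. \<exists>n::nat. \<forall>i\<ge>int n. rep_act M (witt_d i) w = 0)"

definition highest_weight_vector ::
  "(complex poly, 'v::ab_group_add) rep \<Rightarrow> 'v \<Rightarrow> complex \<Rightarrow> bool" where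
  "highest_weight_vector M w c \<longleftrightarrow> w \<in> rep_carrier M \<and> w \<noteq> 0 \<and>
     rep_act M (witt_d 0) w = rep_scale M c w \<and> (\<forall>i>0. rep_act M (witt_d i) w = 0)"

text \<open>\<open>M\<close> is a highest weight module with highest weight vector \<open>w\<close> of highest weight \<open>c\<close>.\<close>

definition highest_weight_module ::
  "(complex poly, 'v::ab_group_add) rep \<Rightarrow> 'v \<Rightarrow> complex \<Rightarrow> bool" where
  "highest_weight_module M w c \<longleftrightarrow> lie_module witt M \<and> highest_weight_vector M w c \<and>
     (\<forall>S. submodule witt M S \<and> w \<in> S \<longrightarrow> S = rep_carrier M)"


section \<open>The loop modules\<close>

text \<open>
  Given operators \<open>D k j\<close> on \<open>V\<close>, the Virasoro representation on \<open>V \<otimes> \<complex>[t, t\<inverse>]\<close> with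
  \<open>d\<^sub>k \<cdot> (v \<otimes> t^j) = D k j v \<otimes> t^(k+j)\<close> and with \<open>z\<close> acting as \<open>0\<close>.
\<close>

definition loop_rep ::
  "('g, 'v::ab_group_add) rep \<Rightarrow> (int \<Rightarrow> int \<Rightarrow> 'v \<Rightarrow> 'v) \<Rightarrow> (vir, int \<Rightarrow>\<^sub>0 'v) rep" where
  "loop_rep V D = \<lparr>
     rep_carrier = {f. \<forall>j. Poly_Mapping.lookup f j \<in> rep_carrier V},
     rep_scale = pm_scale (rep_scale V),
     rep_act = (\<lambda>x f. \<Sum>k\<in>Poly_Mapping.keys (fst x).
       pm_scale (rep_scale V) (Poly_Mapping.lookup (fst x) k)
         (\<Sum>j\<in>Poly_Mapping.keys f. Poly_Mapping.single (k + j) (D k j (Poly_Mapping.lookup f j))))\<rparr>"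

text \<open>
  The action of \<open>e^(kt) d/dt\<close>, a sum with finitely many nonzero terms for modules in
  \<open>category_O witt\<close>. Note that \<^term>\<open>Sum_any\<close> is the sum over the support of a function.
\<close>

definition exp_act :: "(complex poly, 'v::ab_group_add) rep \<Rightarrow> int \<Rightarrow> 'v \<Rightarrow> 'v" where
  "exp_act W k w =
     Sum_any (\<lambda>i::nat. rep_scale W (of_int k ^ i / fact i) (rep_act W (witt_d (int i - 1)) w))"

definition L_mod ::
  "(complex poly, 'v::ab_group_add) rep \<Rightarrow> complex \<Rightarrow> complex \<Rightarrow> complex \<Rightarrow> (vir, int \<Rightarrow>\<^sub>0 'v) rep" where
  "L_mod W lam a b = loop_rep W (\<lambda>k j w.
     rep_scale W (lam powi k) (exp_act W k w) - rep_act W (witt_d (-1)) w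
       + rep_scale W (a + of_int k * b + of_int j) w)"

definition N_mod ::
  "(complex poly, 'v::ab_group_add) rep \<Rightarrow> complex \<Rightarrow> (vir, int \<Rightarrow>\<^sub>0 'v) rep" where
  "N_mod B a = loop_rep B (\<lambda>m n v.
     rep_scale B (a + of_int n) v
       + Sum_any (\<lambda>i::nat. rep_scale B (of_int m ^ (i + 1) / fact (i + 1)) (rep_act B (witt_d (int i)) v)))"

text \<open>
  The Virasoro submodules of \<open>L_mod W (-1) a (c + 1)\<close> for a highest weight module \<open>W\<close> with highest
  weight vector \<open>w\<close> of highest weight \<open>c\<close>; the parity \<open>p\<close> is \<open>0\<close> or \<open>1\<close>.
\<close>

definition L_parity_mod ::
  "int \<Rightarrow> (complex poly, 'v::ab_group_add) rep \<Rightarrow> 'v \<Rightarrow> complex \<Rightarrow> complex \<Rightarrow> (vir, int \<Rightarrow>\<^sub>0 'v) rep" where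
  "L_parity_mod p W w a c = (let M = L_mod W (-1) a (c + 1) in
     M\<lparr>rep_carrier := module.span (rep_scale M)
         {(rep_act M (vir_d 1) ^^ i) (Poly_Mapping.single (2 * j + p) w) | (i::nat) (j::int). True}\<rparr>)"


section \<open>Existence of highest weight modules\<close>

text \<open>
  A model of the Verma module on \<open>\<complex>[x]\<close>: the derivation \<open>p d/dt\<close> acts as the differential operator
  \<open>x p(-D) + c p'(-D)\<close>, where \<open>D = d/dx\<close>.
\<close>

definition diff_op :: "complex poly \<Rightarrow> complex poly \<Rightarrow> complex poly" where
  "diff_op p v = (\<Sum>i\<le>degree p. smult (coeff p i) (((\<lambda>v. - pderiv v) ^^ i) v))"

definition verma :: "complex \<Rightarrow> (complex poly, complex poly) rep" where
  "verma c = \<lparr>rep_carrier = UNIV, rep_scale = smult,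
     rep_act = (\<lambda>p v. [:0, 1:] * diff_op p v + smult c (diff_op (pderiv p) v))\<rparr>"

lemma diff_op_0 [simp]: "diff_op 0 v = 0"
  by (simp add: diff_op_def)

lemma diff_op_pCons: "diff_op (pCons a p) v = smult a v + diff_op p (- pderiv v)"
proof (cases "p = 0")
  case True
  then show ?thesis by (simp add: diff_op_def)
next
  case False
  then have "diff_op (pCons a p) v =
      (\<Sum>i\<le>Suc (degree p). smult (coeff (pCons a p) i) (((\<lambda>v. - pderiv v) ^^ i) v))"
    by (simp add: diff_op_def)
  also have "\<dots> = smult a v + diff_op p (- pderiv v)"
    by (subst sum.atMost_Suc_shift) (simp add: diff_op_def funpow_Suc_right del: funpow.simps)
  finally show ?thesis .
qed

lemma diff_op_add_left: "diff_op (p + q) v = diff_op p v + diff_op q v"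
  by (induction p q arbitrary: v rule: poly_induct2) (simp_all add: diff_op_pCons smult_add_left)

lemma diff_op_add_right: "diff_op p (u + v) = diff_op p u + diff_op p v"
proof (induction p arbitrary: u v)
  case (pCons a p)
  have "- pderiv (u + v) = - pderiv u + - pderiv v"
    by (simp add: pderiv_add)
  with pCons show ?case
    by (simp only: diff_op_pCons smult_add_right) (simp add: algebra_simps)
qed simp

lemma diff_op_smult_left: "diff_op (smult e p) v = smult e (diff_op p v)"
  by (induction p arbitrary: v) (simp_all add: diff_op_pCons smult_add_right)

lemma diff_op_smult_right: "diff_op p (smult e v) = smult e (diff_op p v)"
proof (induction p arbitrary: v)
  case (pCons a p)
  show ?case
    using pCons.IH[of "- pderiv v"]
    by (simp add: diff_op_pCons pderiv_smult smult_add_right mult.commute)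
qed simp

lemma diff_op_minus_right: "diff_op p (- v) = - diff_op p v"
  using diff_op_smult_right[of p "-1" v] by simp

lemma diff_op_pderiv: "diff_op p (pderiv v) = pderiv (diff_op p v)"
proof (induction p arbitrary: v)
  case (pCons a p)
  show ?case
    using pCons.IH[of "- pderiv v"] pCons.IH[of "pderiv v"]
    by (simp add: diff_op_pCons pderiv_smult pderiv_add pderiv_minus pderiv_diff diff_op_minus_right)
qed simp

lemma diff_op_mult: "diff_op (p * q) v = diff_op p (diff_op q v)"
proof (induction p arbitrary: v)
  case (pCons a p)
  then show ?case
    by (simp add: diff_op_pCons diff_op_add_left diff_op_smult_left diff_op_minus_right diff_op_pderiv)
qed simp

lemma diff_op_X: "diff_op p ([:0, 1:] * v) = [:0, 1:] * diff_op p v - diff_op (pderiv p) v"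
proof (induction p arbitrary: v)
  case (pCons a p)
  have "- pderiv ([:0, 1:] * v) = [:0, 1:] * (- pderiv v) + - v"
    by (simp add: pderiv_mult pderiv_pCons algebra_simps)
  then have "diff_op p (- pderiv ([:0, 1:] * v)) =
      [:0, 1:] * diff_op p (- pderiv v) - diff_op (pderiv p) (- pderiv v) - diff_op p v"
    using pCons.IH[of "- pderiv v"] diff_op_add_right[of p "[:0, 1:] * (- pderiv v)" "- v"]
    by (simp add: diff_op_minus_right)
  then show ?case
    by (simp add: diff_op_pCons pderiv_pCons diff_op_add_left smult_add_right algebra_simps)
qed simp

lemma lie_module_verma: "lie_module witt (verma c)"
proof -
  interpret vector_space "smult :: complex \<Rightarrow> complex poly \<Rightarrow> complex poly"
    by unfold_locales (simp_all add: smult_add_right smult_add_left)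
  have sub: "diff_op (p - q) v = diff_op p v - diff_op q v" for p q v
    using diff_op_add_left[of "p - q" q v] by simp
  have comm: "diff_op p (diff_op q v) = diff_op q (diff_op p v)" for p q v
    by (metis diff_op_mult mult.commute)
  have smult_X: "smult e ([:0, 1:] * v) = [:0, 1:] * smult e v" for e and v :: "complex poly"
    by simp
  have br: "rep_act (verma c) (lie_bracket witt p q) v =
      rep_act (verma c) p (rep_act (verma c) q v) - rep_act (verma c) q (rep_act (verma c) p v)"
    for p q v
  proof -
    define X :: "complex poly" where "X = [:0, 1:]"
    have X: "diff_op p (X * v) = X * diff_op p v - diff_op (pderiv p) v" for p v
      unfolding X_def by (rule diff_op_X)
    show ?thesis
      unfolding verma_def witt_def rep.simps lie.simps X_def[symmetric]
      using comm[of p "pderiv q" v] comm[of q "pderiv p" v] comm[of p q v]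
        comm[of "pderiv p" "pderiv q" v] comm[of p "pderiv (pderiv q)" v]
        comm[of q "pderiv (pderiv p)" v]
      by (simp add: X diff_op_add_right diff_op_smult_right diff_op_add_left diff_op_mult sub
        pderiv_diff pderiv_mult smult_add_right smult_diff_right algebra_simps)
  qed
  show ?thesis
    unfolding lie_module_def
    using br
    by (auto simp: verma_def witt_def vector_space_axioms subspace_UNIV diff_op_add_left
      diff_op_add_right diff_op_smult_left diff_op_smult_right pderiv_add pderiv_smult
      smult_add_right algebra_simps)
qed

lemma highest_weight_module_verma: "highest_weight_module (verma c) 1 c"
proof -
  interpret vector_space "smult :: complex \<Rightarrow> complex poly \<Rightarrow> complex poly"
    by unfold_locales (simp_all add: smult_add_right smult_add_left)
  have monom: "diff_op (monom 1 (Suc n)) 1 = 0" for n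
    using diff_op_smult_right[of "monom 1 n" 0 0] by (simp add: monom_Suc diff_op_pCons)
  have one: "diff_op 1 v = v" for v
    by (simp add: diff_op_def)
  have "highest_weight_vector (verma c) 1 c"
    unfolding highest_weight_vector_def
  proof (intro conjI allI impI)
    show "rep_act (verma c) (witt_d 0) 1 = rep_scale (verma c) c 1"
      using monom[of 0] by (simp add: verma_def witt_d_def pderiv_monom one)
  next
    fix i :: int assume "i > 0"
    then obtain n where "nat (i + 1) = Suc (Suc n)"
      by (metis Suc_nat_eq_nat_zadd1 gr0_implies_Suc less_imp_le zero_less_nat_eq add.commute)
    then show "rep_act (verma c) (witt_d i) 1 = 0"
      using monom[of n]
        diff_op_smult_left[of "of_nat (Suc (Suc n))" "monom 1 (Suc n)" 1]
      by (simp add: verma_def witt_d_def pderiv_monom monom smult_monom)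
  qed (simp_all add: verma_def)
  moreover have "S = rep_carrier (verma c)" if S: "submodule witt (verma c) S" "1 \<in> S" for S
  proof -
    have sub: "subspace S" and act: "\<And>x v. v \<in> S \<Longrightarrow> rep_act (verma c) x v \<in> S"
      using S by (auto simp: submodule_def verma_def witt_def)
    have X: "[:0, 1:] * v \<in> S" if "v \<in> S" for v
      using act[OF that, of 1] by (simp add: verma_def one)
    have "v \<in> S" for v
    proof (induction v)
      case 0
      then show ?case using subspace_0[OF sub] by simp
    next
      case (pCons e v)
      have "smult e 1 + [:0, 1:] * v \<in> S"
        by (intro subspace_add[OF sub] subspace_scale[OF sub] X S pCons)
      then show ?case by simp
    qed
    then show ?thesis by (auto simp: verma_def)
  qed
  ultimately show ?thesis
    using lie_module_verma by (auto simp: highest_weight_module_def)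
qed

end

theory Submission
  imports Defs "HOL-Computational_Algebra.Fundamental_Theorem_Algebra"
begin

text \<open>
  The element \<open>d\<^sub>0\<close> acts on the component of \<open>t\<^sup>j\<close> of each of these modules as the scalar \<open>a + j\<close>.
  An isomorphism therefore respects the grading, the restrictions on the real parts make the
  values of \<open>a\<close> equal, and what is left is a family of linear bijections \<open>\<phi>\<^sub>j\<close> with
  \<open>\<phi>\<^sub>j\<^sub>+\<^sub>k d\<^sub>k = d\<^sub>k \<phi>\<^sub>j\<close> (lemma \<open>graded_iso_if_module_iso\<close>).

  No single relation of this kind can be exploited, because the target component depends on \<open>k\<close>.  The
  products \<open>d\<^sub>n\<^sub>-\<^sub>k d\<^sub>k\<close>, however, map a fixed component to a fixed component, and on a given vector
  they depend on \<open>k\<close> as a sum of terms \<open>\<mu>\<^sup>k F(k)\<close> with \<open>\<mu> \<in> {1, \<lambda>, \<lambda>\<inverse>}\<close> and \<open>F\<close> polynomial.  The terms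
  of an exponential polynomial are determined by its values, so \<open>\<phi>\<close> matches the terms one by one
  (lemma \<open>exp_transfer\<close>).  Write \<open>D\<close> for the action of \<open>d/dt\<close> and \<open>E k\<close> for that of \<open>e\<^sup>k\<^sup>t d/dt\<close>.  The term with
  \<open>\<mu> = \<lambda> \<noteq> 1\<close> cannot vanish on all components unless \<open>D = 0\<close>, and this gives \<open>\<lambda>\<^sub>0 \<in> {\<lambda>, \<lambda>\<inverse>}\<close> and
  the separation from \<open>\<N>(B, a)\<close>; for \<open>\<lambda> = 1\<close> that separation comes from the degree in \<open>k\<close>, which is
  bounded on \<open>\<N>(B, a)\<close> only.  The term with \<open>\<mu> = 1\<close> contains \<open>E (n - k) E k\<close> plus a quadratic
  polynomial in \<open>k\<close>; its third differences \<open>Xop\<close> are thus matched by \<open>\<phi>\<close> as well, and they split the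
  proof into two cases.

  If \<open>Xop\<close> is nonzero, further products with \<open>d\<^sub>k\<close> on both sides show that \<open>\<lambda>\<^sub>0 = \<lambda>\<close> and that every \<open>\<phi>\<^sub>m\<close>
  commutes with all words in the \<open>E k\<close> on a nonzero submodule of \<open>W\<close>, hence on \<open>W\<close>; then \<open>b = b\<^sub>0\<close> follows
  (lemma \<open>parameters_eq_if_Xop_nonzero\<close>).  Simplicity of \<open>\<L>(W, \<lambda>, a, b)\<close> enters through \<open>\<lambda> \<noteq> 1\<close>, \<open>b \<noteq> 1\<close> and \<open>b\<^sub>0 \<noteq> 1\<close>.

  If \<open>Xop\<close> vanishes, then \<open>W\<close> is a highest weight module, so \<open>W\<close> is the Verma module on \<open>\<complex>[x]\<close> in
  which \<open>E k\<close> maps \<open>v(x)\<close> to \<open>(x + c k) v(x - k)\<close>; the same holds for \<open>W\<^sub>0\<close>.  Reflection in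
  \<open>(a + j)/2\<close> exchanges the terms with \<open>\<mu> = 1\<close> and \<open>\<mu> = \<lambda>\<close> of \<open>d\<^sub>k\<close> itself, which is the second family of
  isomorphisms (lemma \<open>flip_Lop\<close>), and for \<open>\<lambda> = -1\<close> its eigenspaces are the submodules \<open>\<L>\<^sub>0\<close> and \<open>\<L>\<^sub>1\<close>.
  The \<open>\<lambda>\<close>-term of \<open>d\<^sub>-\<^sub>k d\<^sub>k\<close> is now an explicit operator whose degree in \<open>k\<close> singles out the constant
  polynomial \<open>1\<close> up to scalars (lemma \<open>phi_one\<close>).  This determines the weights, and since exactly one of two
  neighbouring components of \<open>\<L>\<^sub>0\<close> or \<open>\<L>\<^sub>1\<close> contains \<open>1\<close>, it separates these modules from each other and from
  \<open>\<L>(W, \<lambda>, a, b)\<close>.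
\<close>


section \<open>Difference calculus and exponential polynomials\<close>

definition dif :: "(int \<Rightarrow> 'v::ab_group_add) \<Rightarrow> int \<Rightarrow> 'v" where
  "dif F k = F (k + 1) - F k"

definition lin_on ::
  "(complex \<Rightarrow> 'v::ab_group_add \<Rightarrow> 'v) \<Rightarrow> 'v set \<Rightarrow> (complex \<Rightarrow> 'u::ab_group_add \<Rightarrow> 'u) \<Rightarrow> ('v \<Rightarrow> 'u) \<Rightarrow> bool"
  where "lin_on s V t f \<longleftrightarrow>
    (\<forall>u\<in>V. \<forall>v\<in>V. f (u + v) = f u + f v) \<and> (\<forall>c. \<forall>v\<in>V. f (s c v) = t c (f v))"

lemma lin_onI:
  assumes "\<And>u v. u \<in> V \<Longrightarrow> v \<in> V \<Longrightarrow> f (u + v) = f u + f v"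
    and "\<And>c v. v \<in> V \<Longrightarrow> f (s c v) = t c (f v)"
  shows "lin_on s V t f"
  using assms by (auto simp: lin_on_def)

lemma lin_on_add: "lin_on s V t f \<Longrightarrow> u \<in> V \<Longrightarrow> v \<in> V \<Longrightarrow> f (u + v) = f u + f v"
  and lin_on_scale: "lin_on s V t f \<Longrightarrow> v \<in> V \<Longrightarrow> f (s c v) = t c (f v)"
  by (auto simp: lin_on_def)

lemma lin_on_zero:
  assumes "lin_on s V t f" "0 \<in> V"
  shows "f 0 = 0"
  using lin_on_add[OF assms(1,2,2)] by simp

lemma lin_on_diff:
  assumes "lin_on s V t f" "u - v \<in> V" "v \<in> V"
  shows "f (u - v) = f u - f v"
  using lin_on_add[OF assms] by simp

lemma lin_on_sum:
  fixes s :: "complex \<Rightarrow> 'v::ab_group_add \<Rightarrow> 'v"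
  assumes "vector_space s" "module.subspace s V" "lin_on s V t f" "\<And>i. i \<in> I \<Longrightarrow> g i \<in> V"
  shows "f (\<Sum>i\<in>I. g i) = (\<Sum>i\<in>I. f (g i))"
proof -
  interpret vector_space s by fact
  have z: "f 0 = 0" using lin_on_zero[OF assms(3)] subspace_0[OF assms(2)] by simp
  show ?thesis
  proof (cases "finite I")
    case True
    then show ?thesis using assms(4)
    proof (induction I)
      case (insert x I)
      then have "(\<Sum>i\<in>I. g i) \<in> V" by (intro subspace_sum[OF assms(2)]) auto
      with insert show ?case by (simp add: lin_on_add[OF assms(3)])
    qed (simp add: z)
  qed (simp add: z)
qed

lemma dif_pow_Suc: "(dif ^^ Suc n) F k = (dif ^^ n) F (k + 1) - (dif ^^ n) F k"
  by (simp add: dif_def[of "(dif ^^ n) F"])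

lemma dif_pow_add: "(dif ^^ n) (\<lambda>k. F k + G k) = (\<lambda>k. (dif ^^ n) F k + (dif ^^ n) G k)"
  by (induction n) (auto simp: dif_def)

lemma dif_pow_zero: "(dif ^^ n) (\<lambda>k. 0) = (\<lambda>k. 0)"
  by (induction n) (auto simp: dif_def)

lemma dif_pow_shift: "(dif ^^ n) (\<lambda>k. F (k + l)) = (\<lambda>k. (dif ^^ n) F (k + l))"
  by (induction n) (auto simp: dif_def algebra_simps)

lemma dif_pow_mono: "(dif ^^ n) F = (\<lambda>k. 0) \<Longrightarrow> n \<le> m \<Longrightarrow> (dif ^^ m) F = (\<lambda>k. 0)"
proof -
  assume *: "(dif ^^ n) F = (\<lambda>k. 0)" "n \<le> m"
  have "(dif ^^ m) F = (dif ^^ (m - n)) ((dif ^^ n) F)"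
    using *(2) by (simp add: funpow_add[symmetric, THEN fun_cong, unfolded comp_def])
  then show ?thesis by (simp add: *(1) dif_pow_zero)
qed

lemma dif_pow_in:
  fixes s :: "complex \<Rightarrow> 'v::ab_group_add \<Rightarrow> 'v"
  assumes "vector_space s" "module.subspace s U" "\<And>k. F k \<in> U"
  shows "(dif ^^ n) F k \<in> U"
proof -
  interpret vector_space s by fact
  show ?thesis
    by (induction n arbitrary: k)
      (auto simp: dif_pow_Suc assms(3) simp del: funpow.simps intro!: subspace_diff[OF assms(2)])
qed

lemma dif_pow_lin:
  fixes s :: "complex \<Rightarrow> 'v::ab_group_add \<Rightarrow> 'v"
  assumes "vector_space s" "module.subspace s U" "lin_on s U t f" "\<And>k. F k \<in> U"
  shows "(dif ^^ n) (\<lambda>k. f (F k)) = (\<lambda>k. f ((dif ^^ n) F k))"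
proof -
  interpret vector_space s by fact
  have "(dif ^^ n) (\<lambda>k. f (F k)) k = f ((dif ^^ n) F k)" for k
  proof (induction n arbitrary: k)
    case (Suc n)
    have "(dif ^^ n) F k \<in> U" for k by (rule dif_pow_in[OF assms(1,2,4)])
    then show ?case unfolding dif_pow_Suc
      by (simp add: Suc.IH lin_on_diff[OF assms(3)] subspace_diff[OF assms(2)])
  qed simp
  then show ?thesis by auto
qed

definition dnil :: "(int \<Rightarrow> 'v::ab_group_add) \<Rightarrow> bool" where
  "dnil F \<longleftrightarrow> (\<exists>n. (dif ^^ n) F = (\<lambda>k. 0))"

lemma dnil_zero [simp]: "dnil (\<lambda>k. 0)"
  by (auto simp: dnil_def intro: exI[of _ 0])

lemma dnil_add:
  assumes "dnil F" "dnil G" shows "dnil (\<lambda>k. F k + G k)"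
proof -
  obtain n m where "(dif ^^ n) F = (\<lambda>k. 0)" "(dif ^^ m) G = (\<lambda>k. 0)"
    using assms by (auto simp: dnil_def)
  then have "(dif ^^ max n m) F = (\<lambda>k. 0)" "(dif ^^ max n m) G = (\<lambda>k. 0)"
    by (auto elim: dif_pow_mono)
  then show ?thesis unfolding dnil_def by (intro exI[of _ "max n m"]) (simp add: dif_pow_add)
qed

lemma dnil_lin:
  fixes s :: "complex \<Rightarrow> 'v::ab_group_add \<Rightarrow> 'v"
  assumes "vector_space s" "module.subspace s U" "lin_on s U t f" "\<And>k. F k \<in> U" "dnil F"
  shows "dnil (\<lambda>k. f (F k))"
proof -
  interpret vector_space s by fact
  obtain n where "(dif ^^ n) F = (\<lambda>k. 0)" using assms(5) by (auto simp: dnil_def)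
  then show ?thesis unfolding dnil_def
    using lin_on_zero[OF assms(3) subspace_0[OF assms(2)]]
    by (intro exI[of _ n]) (simp add: dif_pow_lin[OF assms(1-4)])
qed

locale cvec = vector_space s for s :: "complex \<Rightarrow> 'v::ab_group_add \<Rightarrow> 'v"
begin

lemma lin_on_scale_self: "lin_on s UNIV s (s c)"
  by (rule lin_onI) (simp_all add: scale_right_distrib mult.commute)

lemma dnil_scale: "dnil F \<Longrightarrow> dnil (\<lambda>k. s c (F k))"
  using dnil_lin[OF vector_space_axioms subspace_UNIV lin_on_scale_self] by auto

lemma dnil_uminus: "dnil F \<Longrightarrow> dnil (\<lambda>k. - F k)" for F :: "int \<Rightarrow> 'v"
  using dnil_scale[of F "-1"] by simp

lemma dnil_diff: "dnil F \<Longrightarrow> dnil G \<Longrightarrow> dnil (\<lambda>k. F k - G k)" for F :: "int \<Rightarrow> 'v"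
  using dnil_add[OF _ dnil_uminus, of F G] by simp

lemma dnil_shift: "dnil F \<Longrightarrow> dnil (\<lambda>k. F (k + l))"
  by (auto simp: dnil_def dif_pow_shift fun_eq_iff)

end

text \<open>Differences of a solution solve the same recurrence with smaller degree, so by induction they lie in
  \<open>U\<close>; modulo \<open>U\<close> the recurrence then reads \<open>(\<alpha> - \<beta>) F(k) = 0\<close>.\<close>

lemma dif_recurrence_in_subspace:
  fixes s :: "complex \<Rightarrow> 'v::ab_group_add \<Rightarrow> 'v"
  assumes "vector_space s" "module.subspace s U" "(dif ^^ n) F = (\<lambda>k. 0)" "\<alpha> \<noteq> \<beta>"
    and "\<And>k. s \<alpha> (F (k + 1)) - s \<beta> (F k) \<in> U"
  shows "F k \<in> U"
proof -
  interpret cvec s by (rule cvec.intro, fact)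
  note sub = subspace_add[OF assms(2)] subspace_diff[OF assms(2)] subspace_scale[OF assms(2)]
  show ?thesis using assms(3,5)
  proof (induction n arbitrary: F k)
    case 0
    then show ?case using subspace_0[OF assms(2)] by (metis funpow_0)
  next
    case (Suc n)
    have "(dif ^^ n) (dif F) = (\<lambda>k. 0)"
      using Suc.prems(1) by (simp add: funpow_Suc_right del: funpow.simps)
    moreover have "s \<alpha> (dif F (k + 1)) - s \<beta> (dif F k) \<in> U" for k
    proof -
      have "s \<alpha> (dif F (k + 1)) - s \<beta> (dif F k) =
          (s \<alpha> (F (k + 1 + 1)) - s \<beta> (F (k + 1))) - (s \<alpha> (F (k + 1)) - s \<beta> (F k))"
        by (simp add: dif_def scale_right_diff_distrib)
      then show ?thesis by (simp only:) (rule sub(2)[OF Suc.prems(2) Suc.prems(2)])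
    qed
    ultimately have "dif F k \<in> U" for k by (rule Suc.IH)
    then have "(s \<alpha> (F (k + 1)) - s \<beta> (F k)) - s \<alpha> (dif F k) \<in> U"
      by (intro sub(2,3) Suc.prems(2))
    moreover have "(s \<alpha> (F (k + 1)) - s \<beta> (F k)) - s \<alpha> (dif F k) = s (\<alpha> - \<beta>) (F k)"
      by (simp add: dif_def scale_right_diff_distrib scale_left_diff_distrib)
    ultimately have "s (inverse (\<alpha> - \<beta>)) (s (\<alpha> - \<beta>) (F k)) \<in> U"
      by (simp only:) (rule sub(3))
    then show ?case using assms(4) by simp
  qed
qed

text \<open>Uniqueness of the terms of an exponential polynomial, relative to a subspace.  The operator
  \<open>S - \<nu>\<close>, with \<open>S\<close> the shift, lowers the degree of the term with exponent \<open>\<nu>\<close> and replaces every other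
  coefficient \<open>F\<close> by \<open>\<mu> F(k + 1) - \<nu> F(k)\<close>, which determines \<open>F\<close> because \<open>\<mu> \<noteq> \<nu>\<close>.\<close>

lemma exp_sum_in_subspace:
  fixes s :: "complex \<Rightarrow> 'v::ab_group_add \<Rightarrow> 'v"
  assumes "vector_space s" "module.subspace s U" "finite A" "0 \<notin> A"
    and "\<And>\<mu>. \<mu> \<in> A \<Longrightarrow> dnil (F \<mu>)"
    and "\<And>k. (\<Sum>\<mu>\<in>A. s (\<mu> powi k) (F \<mu> k)) \<in> U"
    and "\<nu> \<in> A"
  shows "F \<nu> k \<in> U"
proof -
  interpret cvec s by (rule cvec.intro, fact)
  note sub = subspace_add[OF assms(2)] subspace_diff[OF assms(2)] subspace_scale[OF assms(2)]
  have "\<forall>F. (\<forall>\<mu>\<in>A. dnil (F \<mu>)) \<longrightarrow> (\<forall>k. (\<Sum>\<mu>\<in>A. s (\<mu> powi k) (F \<mu> k)) \<in> U) \<longrightarrow>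
      (\<forall>\<mu>\<in>A. \<forall>k. F \<mu> k \<in> U)"
    using assms(3,4)
  proof (induction A)
    case (insert \<nu> A)
    have claim: "\<forall>\<mu>\<in>insert \<nu> A. \<forall>k. F \<mu> k \<in> U"
      if "(dif ^^ n) (F \<nu>) = (\<lambda>k. 0)" "\<forall>\<mu>\<in>A. dnil (F \<mu>)"
        "\<And>k. s (\<nu> powi k) (F \<nu> k) + (\<Sum>\<mu>\<in>A. s (\<mu> powi k) (F \<mu> k)) \<in> U" for n F
      using that
    proof (induction n arbitrary: F)
      case 0
      then have "F \<nu> k = 0" for k by (metis funpow_0)
      then show ?case using 0 insert subspace_0[OF assms(2)] by auto
    next
      case (Suc n)
      define G where "G = (\<lambda>\<mu> k. s \<mu> (F \<mu> (k + 1)) - s \<nu> (F \<mu> k))"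
      have Gnu: "G \<nu> = (\<lambda>k. s \<nu> (dif (F \<nu>) k))"
        by (simp add: G_def dif_def scale_right_diff_distrib)
      have "(dif ^^ n) (G \<nu>) = (\<lambda>k. s \<nu> ((dif ^^ n) (dif (F \<nu>)) k))"
        unfolding Gnu by (rule dif_pow_lin[OF vector_space_axioms subspace_UNIV lin_on_scale_self]) simp
      also have "\<dots> = (\<lambda>k. 0)"
        using Suc.prems(1) by (simp add: funpow_Suc_right del: funpow.simps)
      finally have 1: "(dif ^^ n) (G \<nu>) = (\<lambda>k. 0)" .
      have 2: "\<forall>\<mu>\<in>A. dnil (G \<mu>)"
        unfolding G_def using Suc.prems(2) by (auto intro!: dnil_diff dnil_scale dnil_shift)
      have pw: "\<mu> powi (k + 1) = \<mu> powi k * \<mu>" if "\<mu> \<in> insert \<nu> A" for \<mu> :: complex and k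
        using that insert.prems by (intro power_int_add_1) auto
      have 3: "s (\<nu> powi k) (G \<nu> k) + (\<Sum>\<mu>\<in>A. s (\<mu> powi k) (G \<mu> k)) \<in> U" for k
      proof -
        have *: "s (\<mu> powi k) (G \<mu> k) = s (\<mu> powi (k + 1)) (F \<mu> (k + 1)) - s \<nu> (s (\<mu> powi k) (F \<mu> k))"
          if "\<mu> \<in> insert \<nu> A" for \<mu>
          using that by (simp add: pw G_def scale_right_diff_distrib mult.commute)
        have "s (\<nu> powi k) (G \<nu> k) + (\<Sum>\<mu>\<in>A. s (\<mu> powi k) (G \<mu> k)) =
          (s (\<nu> powi (k + 1)) (F \<nu> (k + 1)) + (\<Sum>\<mu>\<in>A. s (\<mu> powi (k + 1)) (F \<mu> (k + 1)))) -
          s \<nu> (s (\<nu> powi k) (F \<nu> k) + (\<Sum>\<mu>\<in>A. s (\<mu> powi k) (F \<mu> k)))"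
          by (simp add: * sum_subtractf scale_right_distrib scale_sum_right)
        then show ?thesis by (simp only:) (rule sub(2)[OF Suc.prems(3) sub(3)[OF Suc.prems(3)]])
      qed
      have G: "\<forall>\<mu>\<in>insert \<nu> A. \<forall>k. G \<mu> k \<in> U"
        by (rule Suc.IH[OF 1 2 3])
      have FA: "F \<mu> k \<in> U" if mu: "\<mu> \<in> A" for \<mu> k
      proof -
        have "\<mu> \<noteq> \<nu>" using that insert by auto
        moreover obtain m where "(dif ^^ m) (F \<mu>) = (\<lambda>k. 0)"
          using mu Suc.prems(2) by (auto simp: dnil_def)
        ultimately show ?thesis using G mu
          by (intro dif_recurrence_in_subspace[OF vector_space_axioms assms(2), of m "F \<mu>" \<mu> \<nu>])
            (auto simp: G_def)
      qed
      have "F \<nu> k \<in> U" for k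
      proof -
        have "(s (\<nu> powi k) (F \<nu> k) + (\<Sum>\<mu>\<in>A. s (\<mu> powi k) (F \<mu> k))) -
            (\<Sum>\<mu>\<in>A. s (\<mu> powi k) (F \<mu> k)) \<in> U"
          by (intro sub(2) Suc.prems subspace_sum[OF assms(2)] sub(3) FA)
        then have "s (\<nu> powi k) (F \<nu> k) \<in> U" by simp
        then have "s (inverse (\<nu> powi k)) (s (\<nu> powi k) (F \<nu> k)) \<in> U" by (rule sub(3))
        moreover have "s (inverse (\<nu> powi k)) (s (\<nu> powi k) (F \<nu> k)) = F \<nu> k"
          using insert.prems by simp
        ultimately show ?thesis by (simp only:)
      qed
      with FA show ?case by auto
    qed
    show ?case
    proof (intro allI impI)
      fix F assume F: "\<forall>\<mu>\<in>insert \<nu> A. dnil (F \<mu>)" "\<forall>k. (\<Sum>\<mu>\<in>insert \<nu> A. s (\<mu> powi k) (F \<mu> k)) \<in> U"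
      then obtain n where "(dif ^^ n) (F \<nu>) = (\<lambda>k. 0)" by (auto simp: dnil_def)
      then show "\<forall>\<mu>\<in>insert \<nu> A. \<forall>k. F \<mu> k \<in> U"
        by (rule claim) (use F insert in auto)
    qed
  qed auto
  then show ?thesis using assms by blast
qed

text \<open>An exponential polynomial \<open>k \<mapsto> \<Sum>\<^sub>i \<mu>\<^sub>i\<^sup>k F\<^sub>i(k)\<close> is given by the list of the pairs \<open>(\<mu>\<^sub>i, F\<^sub>i)\<close>,
  in which an exponent may occur several times; this keeps the coincidences among
  \<open>1\<close>, \<open>\<lambda>\<close> and \<open>\<lambda>\<inverse>\<close> out of the calculations.\<close>

definition exp_sum :: "(complex \<Rightarrow> 'v \<Rightarrow> 'v::ab_group_add) \<Rightarrow> (complex \<times> (int \<Rightarrow> 'v)) list \<Rightarrow> int \<Rightarrow> 'v" where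
  "exp_sum s xs k = (\<Sum>(\<mu>, F)\<leftarrow>xs. s (\<mu> powi k) (F k))"

definition exp_part :: "complex \<Rightarrow> (complex \<times> (int \<Rightarrow> 'v::ab_group_add)) list \<Rightarrow> int \<Rightarrow> 'v" where
  "exp_part \<nu> xs k = (\<Sum>(\<mu>, F)\<leftarrow>xs. if \<mu> = \<nu> then F k else 0)"

definition exp_list :: "(complex \<times> (int \<Rightarrow> 'v::ab_group_add)) list \<Rightarrow> bool" where
  "exp_list xs \<longleftrightarrow> (\<forall>(\<mu>, F)\<in>set xs. \<mu> \<noteq> 0 \<and> dnil F)"

lemma exp_sum_simps [simp]:
  "exp_sum s [] k = 0" "exp_sum s ((\<mu>, F) # xs) k = s (\<mu> powi k) (F k) + exp_sum s xs k"
  by (simp_all add: exp_sum_def)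

lemma exp_part_simps [simp]:
  "exp_part \<nu> [] k = 0" "exp_part \<nu> ((\<mu>, F) # xs) k = (if \<mu> = \<nu> then F k else 0) + exp_part \<nu> xs k"
  by (simp_all add: exp_part_def)

lemma exp_list_simps [simp]:
  "exp_list []" "exp_list ((\<mu>, F) # xs) \<longleftrightarrow> \<mu> \<noteq> 0 \<and> dnil F \<and> exp_list xs"
  by (auto simp: exp_list_def)

lemma dnil_exp_part: "exp_list xs \<Longrightarrow> dnil (exp_part \<nu> xs)"
proof (induction xs)
  case Nil
  have "exp_part \<nu> [] = (\<lambda>k. 0 :: 'a)" by (simp add: fun_eq_iff)
  then show ?case by simp
next
  case (Cons x xs)
  obtain \<mu> F where x: "x = (\<mu>, F)" by force
  have "exp_part \<nu> (x # xs) = (\<lambda>k. (if \<mu> = \<nu> then F k else 0) + exp_part \<nu> xs k)"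
    by (simp add: x fun_eq_iff)
  moreover have "dnil (\<lambda>k. (if \<mu> = \<nu> then F k else 0) + exp_part \<nu> xs k)"
    using Cons x by (intro dnil_add) (cases "\<mu> = \<nu>", auto)
  ultimately show ?case by simp
qed

lemma exp_part_notin: "\<nu> \<notin> fst ` set xs \<Longrightarrow> exp_part \<nu> xs k = 0"
  by (induction xs) auto

lemma exp_sum_parts:
  fixes s :: "complex \<Rightarrow> 'v::ab_group_add \<Rightarrow> 'v"
  assumes "vector_space s" "finite A" "fst ` set xs \<subseteq> A"
  shows "exp_sum s xs k = (\<Sum>\<nu>\<in>A. s (\<nu> powi k) (exp_part \<nu> xs k))"
proof -
  interpret cvec s by (rule cvec.intro, fact)
  show ?thesis using assms(3)
  proof (induction xs)
    case (Cons x xs)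
    obtain \<mu> F where x: "x = (\<mu>, F)" by force
    have "(\<Sum>\<nu>\<in>A. s (\<nu> powi k) (exp_part \<nu> (x # xs) k)) =
        (\<Sum>\<nu>\<in>A. if \<mu> = \<nu> then s (\<nu> powi k) (F k) else 0) + (\<Sum>\<nu>\<in>A. s (\<nu> powi k) (exp_part \<nu> xs k))"
      unfolding sum.distrib[symmetric] by (intro sum.cong) (auto simp: x scale_right_distrib split: if_splits)
    also have "(\<Sum>\<nu>\<in>A. if \<mu> = \<nu> then s (\<nu> powi k) (F k) else 0) = s (\<mu> powi k) (F k)"
      using Cons.prems x assms(2) by (simp add: sum.delta')
    finally show ?case using Cons x by simp
  qed simp
qed

lemma exp_part_in_subspace:
  fixes s :: "complex \<Rightarrow> 'v::ab_group_add \<Rightarrow> 'v"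
  assumes "vector_space s" "module.subspace s U" "exp_list xs" "\<And>k. exp_sum s xs k \<in> U"
  shows "exp_part \<nu> xs k \<in> U"
proof -
  interpret cvec s by (rule cvec.intro, fact)
  show ?thesis
  proof (cases "\<nu> \<in> fst ` set xs")
    case True
    show ?thesis
    proof (rule exp_sum_in_subspace[OF assms(1,2), of "fst ` set xs"])
      show "(\<Sum>\<mu>\<in>fst ` set xs. s (\<mu> powi k) (exp_part \<mu> xs k)) \<in> U" for k
        using exp_sum_parts[OF assms(1), of "fst ` set xs" xs k] assms(4)[of k] by simp
    qed (use True assms(3) dnil_exp_part in \<open>auto simp: exp_list_def\<close>)
  qed (simp add: exp_part_notin subspace_0[OF assms(2)])
qed

text \<open>The form in which uniqueness is used: a linear map between the values of two exponential polynomials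
  maps term to term.  The map is only assumed on a subspace, since the components of a submodule
  of a loop module are proper subspaces.\<close>

lemma exp_transfer:
  fixes s :: "complex \<Rightarrow> 'v::ab_group_add \<Rightarrow> 'v"
  assumes s: "vector_space s" "module.subspace s U" and t: "vector_space t"
    and lin: "lin_on s U t f"
    and xs: "exp_list xs" "\<And>k. exp_sum s xs k \<in> U" and ys: "exp_list ys"
    and eq: "\<And>k. f (exp_sum s xs k) = exp_sum t ys k"
  shows "exp_part \<nu> xs k \<in> U" "f (exp_part \<nu> xs k) = exp_part \<nu> ys k"
proof -
  interpret s: cvec s by (rule cvec.intro, fact)
  interpret t: cvec t by (rule cvec.intro, fact)
  have U: "exp_part \<mu> xs k \<in> U" for \<mu> k by (rule exp_part_in_subspace[OF s xs])
  then show "exp_part \<nu> xs k \<in> U" .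
  define A where "A = insert \<nu> (fst ` set xs \<union> fst ` set ys) - {0}"
  define F where "F = (\<lambda>\<mu> k. f (exp_part \<mu> xs k) - exp_part \<mu> ys k)"
  have A: "finite A" "0 \<notin> A" by (auto simp: A_def)
  have sub: "fst ` set xs \<subseteq> A" "fst ` set ys \<subseteq> A"
    using xs(1) ys by (auto simp: A_def exp_list_def)
  have nil: "dnil (F \<mu>)" for \<mu>
    unfolding F_def
    by (intro t.dnil_diff dnil_lin[OF s lin U] dnil_exp_part xs ys)
  have "(\<Sum>\<mu>\<in>A. t (\<mu> powi k) (F \<mu> k)) \<in> {0}" for k
  proof -
    have "f (exp_sum s xs k) = (\<Sum>\<mu>\<in>A. t (\<mu> powi k) (f (exp_part \<mu> xs k)))"
      unfolding exp_sum_parts[OF s(1) A(1) sub(1)]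
      by (subst lin_on_sum[OF s lin]) (auto intro!: s.subspace_scale[OF s(2)] U simp: lin_on_scale[OF lin U])
    then show ?thesis using eq[of k]
      by (simp add: F_def t.scale_right_diff_distrib sum_subtractf exp_sum_parts[OF t A(1) sub(2)])
  qed
  then have *: "F \<mu> k \<in> {0}" if "\<mu> \<in> A" for \<mu> k
    using exp_sum_in_subspace[OF t t.subspace_single_0 A, of F] nil that by blast
  show "f (exp_part \<nu> xs k) = exp_part \<nu> ys k"
  proof (cases "\<nu> = 0")
    case True
    then have "exp_part \<nu> xs k = 0" "exp_part \<nu> ys k = 0"
      using xs(1) ys by (auto intro!: exp_part_notin simp: exp_list_def)
    then show ?thesis using lin_on_zero[OF lin s.subspace_0[OF s(2)]] by simp
  next
    case False
    then show ?thesis using *[of \<nu> k] by (simp add: A_def F_def)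
  qed
qed

text \<open>Polynomial functions on the integers with coefficients in \<open>V\<close>, the index bounding the degree.  The
  inductive form makes closure under operators that depend polynomially on \<open>k\<close> a rule induction.\<close>

inductive pdeg :: "(complex \<Rightarrow> 'v \<Rightarrow> 'v) \<Rightarrow> 'v set \<Rightarrow> nat \<Rightarrow> (int \<Rightarrow> 'v::ab_group_add) \<Rightarrow> bool"
  for s V where
  pdeg_const: "c \<in> V \<Longrightarrow> pdeg s V 0 (\<lambda>k. c)"
| pdeg_add: "pdeg s V n F \<Longrightarrow> pdeg s V n G \<Longrightarrow> pdeg s V n (\<lambda>k. F k + G k)"
| pdeg_mult: "pdeg s V n F \<Longrightarrow> pdeg s V (Suc n) (\<lambda>k. s (of_int k) (F k))"
| pdeg_Suc: "pdeg s V n F \<Longrightarrow> pdeg s V (Suc n) F"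

definition pfun where "pfun s V F \<longleftrightarrow> (\<exists>n. pdeg s V n F)"

lemma pdeg_mono: "pdeg s V n F \<Longrightarrow> n \<le> m \<Longrightarrow> pdeg s V m F"
  by (induction m) (auto simp: le_Suc_eq intro: pdeg_Suc)

lemma pfun_const: "c \<in> V \<Longrightarrow> pfun s V (\<lambda>k. c)"
  unfolding pfun_def by (auto intro: pdeg_const)

lemma pfun_mult: "pfun s V F \<Longrightarrow> pfun s V (\<lambda>k. s (of_int k) (F k))"
  unfolding pfun_def by (auto intro: pdeg_mult)

lemma pfun_add: "pfun s V F \<Longrightarrow> pfun s V G \<Longrightarrow> pfun s V (\<lambda>k. F k + G k)"
  unfolding pfun_def using pdeg_add pdeg_mono max.cobounded1 max.cobounded2 by metis

lemma pfun_sum: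
  assumes "0 \<in> V" "\<And>i. i \<in> I \<Longrightarrow> pfun s V (F i)" shows "pfun s V (\<lambda>k. \<Sum>i\<in>I. F i k)"
  using assms(2) by (induction I rule: infinite_finite_induct) (auto intro: pfun_add pfun_const assms(1))

lemma pdeg_sum:
  assumes "0 \<in> V" "\<And>i. i \<in> I \<Longrightarrow> pdeg s V n (F i)" shows "pdeg s V n (\<lambda>k. \<Sum>i\<in>I. F i k)"
  using assms(2)
proof (induction I rule: infinite_finite_induct)
qed (auto intro: pdeg_add pdeg_mono[OF pdeg_const] assms(1))

lemma pfun_induct [consumes 1, case_names const add mult]:
  assumes "pfun s V F" "\<And>c. c \<in> V \<Longrightarrow> P (\<lambda>k. c)"
    "\<And>F G. pfun s V F \<Longrightarrow> P F \<Longrightarrow> pfun s V G \<Longrightarrow> P G \<Longrightarrow> P (\<lambda>k. F k + G k)"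
    "\<And>F. pfun s V F \<Longrightarrow> P F \<Longrightarrow> P (\<lambda>k. s (of_int k) (F k))"
  shows "P F"
proof -
  have "P F" if "pdeg s V n F" for n
    using that
    by (induction rule: pdeg.induct) (use assms(2) in blast, blast intro: assms(3) pfun_def[THEN iffD2],
      rule assms(4), auto simp: pfun_def)
  then show ?thesis using assms(1) by (auto simp: pfun_def)
qed

lemma pfun_in:
  fixes s :: "complex \<Rightarrow> 'v::ab_group_add \<Rightarrow> 'v"
  assumes "vector_space s" "module.subspace s V" "pfun s V F" shows "F k \<in> V"
proof -
  interpret cvec s by (rule cvec.intro, fact)
  show ?thesis using assms(3)
    by (induction rule: pfun_induct) (auto intro: subspace_add[OF assms(2)] subspace_scale[OF assms(2)])
qed

lemma pfun_lin:
  fixes s :: "complex \<Rightarrow> 'v::ab_group_add \<Rightarrow> 'v"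
  assumes "vector_space s" "module.subspace s V" "lin_on s V t f" "\<And>v. v \<in> V \<Longrightarrow> f v \<in> V'" "pfun s V F"
  shows "pfun t V' (\<lambda>k. f (F k))"
  using assms(5)
proof (induction rule: pfun_induct)
  case (add F G)
  then show ?case using pfun_in[OF assms(1,2)]
    by (simp add: lin_on_add[OF assms(3)]) (rule pfun_add)
next
  case (mult F)
  then show ?case using pfun_in[OF assms(1,2)]
    by (simp add: lin_on_scale[OF assms(3)]) (rule pfun_mult)
qed (auto intro: pfun_const assms(4))

lemma pfun_scale:
  fixes s :: "complex \<Rightarrow> 'v::ab_group_add \<Rightarrow> 'v"
  assumes "vector_space s" "module.subspace s V" "pfun s V F"
  shows "pfun s V (\<lambda>k. s c (F k))"
proof -
  interpret cvec s by (rule cvec.intro, fact)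
  show ?thesis
    by (rule pfun_lin[OF assms(1,2) _ _ assms(3)])
      (auto intro!: lin_onI subspace_scale[OF assms(2)] simp: scale_right_distrib mult.commute)
qed

lemma pfun_diff:
  fixes s :: "complex \<Rightarrow> 'v::ab_group_add \<Rightarrow> 'v"
  assumes "vector_space s" "module.subspace s V" "pfun s V F" "pfun s V G"
  shows "pfun s V (\<lambda>k. F k - G k)"
proof -
  interpret cvec s by (rule cvec.intro, fact)
  show ?thesis using pfun_add[OF assms(3) pfun_scale[OF assms(1,2,4), of "-1"]] by simp
qed

text \<open>The degree of the family may grow with the vector; a polynomial function involves only finitely many vectors.\<close>

lemma pfun_apply:
  fixes s :: "complex \<Rightarrow> 'v::ab_group_add \<Rightarrow> 'v"
  assumes s: "vector_space s" "module.subspace s V" and V': "0 \<in> V'"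
    and lin: "\<And>k. lin_on s V t (T k)"
    and T: "\<And>v. v \<in> V \<Longrightarrow> pfun t V' (\<lambda>k. T k v)" and F: "pfun s V F"
  shows "pfun t V' (\<lambda>k. T k (F k))"
  using F
proof (induction rule: pfun_induct)
  case (add F G)
  then show ?case using pfun_in[OF s] by (simp add: lin_on_add[OF lin]) (rule pfun_add)
next
  case (mult F)
  then show ?case using pfun_in[OF s] by (simp add: lin_on_scale[OF lin]) (rule pfun_mult)
qed (auto intro: T)

lemma pdeg_in:
  fixes s :: "complex \<Rightarrow> 'v::ab_group_add \<Rightarrow> 'v"
  assumes "vector_space s" "module.subspace s V" "pdeg s V n F" shows "F k \<in> V"
  using pfun_in[OF assms(1,2)] assms(3) by (auto simp: pfun_def)

lemma pdeg_apply:
  fixes s :: "complex \<Rightarrow> 'v::ab_group_add \<Rightarrow> 'v"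
  assumes s: "vector_space s" "module.subspace s V"
    and lin: "\<And>k. lin_on s V t (T k)"
    and T: "\<And>v. v \<in> V \<Longrightarrow> pdeg t V' m (\<lambda>k. T k v)" and F: "pdeg s V n F"
  shows "pdeg t V' (m + n) (\<lambda>k. T k (F k))"
  using F
proof (induction rule: pdeg.induct)
  case (pdeg_const c)
  then show ?case using T by simp
next
  case (pdeg_add n F G)
  then show ?case using pdeg_in[OF s] by (simp add: lin_on_add[OF lin]) (rule pdeg.pdeg_add)
next
  case (pdeg_mult n F)
  then show ?case using pdeg_in[OF s] by (simp add: lin_on_scale[OF lin]) (rule pdeg.pdeg_mult)
next
  case (pdeg_Suc n F)
  then show ?case by (simp add: pdeg.pdeg_Suc)
qed

lemma pdeg_reflect:
  fixes s :: "complex \<Rightarrow> 'v::ab_group_add \<Rightarrow> 'v"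
  assumes s: "vector_space s" "module.subspace s V" and F: "pdeg s V n F"
  shows "pdeg s V n (\<lambda>k. F (l - k))"
  using F
proof (induction rule: pdeg.induct)
  case (pdeg_mult n F)
  interpret cvec s by (rule cvec.intro, fact s)
  have neg: "pdeg s V (Suc n) (\<lambda>k. s (- 1) (s (of_int k) (F (l - k))))"
    using pdeg_apply[OF s _ _ pdeg.pdeg_mult[OF pdeg_mult.IH], of s "\<lambda>k. s (-1)" V 0]
    by (simp add: lin_on_def scale_right_distrib pdeg_const subspace_neg[OF s(2)])
  have const: "pdeg s V n (\<lambda>k. s (of_int l) (F (l - k)))"
    using pdeg_apply[OF s _ _ pdeg_mult.IH, of s "\<lambda>k. s (of_int l)" V 0]
    by (simp add: lin_on_def scale_right_distrib pdeg_const subspace_scale[OF s(2)] mult.commute)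
  have "(\<lambda>k. s (of_int (l - k)) (F (l - k))) =
      (\<lambda>k. s (of_int l) (F (l - k)) + s (- 1) (s (of_int k) (F (l - k))))"
    by (simp add: scale_left_diff_distrib fun_eq_iff)
  with pdeg.pdeg_add[OF pdeg_Suc[OF const] neg] show ?case by simp
qed (auto intro: pdeg.intros)

lemma pfun_reflect:
  "vector_space s \<Longrightarrow> module.subspace s V \<Longrightarrow> pfun s V F \<Longrightarrow> pfun s V (\<lambda>k. F (l - k))"
  unfolding pfun_def using pdeg_reflect by blast

lemma dif_pow_mult:
  fixes s :: "complex \<Rightarrow> 'v::ab_group_add \<Rightarrow> 'v"
  assumes "vector_space s"
  shows "(dif ^^ n) (\<lambda>k. s (of_int k) (F k)) =
    (\<lambda>k. s (of_int k) ((dif ^^ n) F k) + s (of_nat n) ((dif ^^ (n - 1)) F (k + 1)))"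
proof -
  interpret cvec s by (rule cvec.intro, fact)
  have "(dif ^^ n) (\<lambda>k. s (of_int k) (F k)) k =
    s (of_int k) ((dif ^^ n) F k) + s (of_nat n) ((dif ^^ (n - 1)) F (k + 1))" for k
  proof (induction n arbitrary: k)
    case (Suc n)
    show ?case
    proof (cases n)
      case 0
      then show ?thesis by (simp add: dif_def scale_left_distrib scale_right_diff_distrib)
    next
      case (Suc m)
      have "(dif ^^ Suc n) (\<lambda>k. s (of_int k) (F k)) k =
          (s (of_int (k + 1)) ((dif ^^ n) F (k + 1)) + s (of_nat n) ((dif ^^ (n - 1)) F (k + 1 + 1))) -
          (s (of_int k) ((dif ^^ n) F k) + s (of_nat n) ((dif ^^ (n - 1)) F (k + 1)))"
        by (simp only: dif_pow_Suc Suc.IH)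
      also have "\<dots> = s (of_int k) ((dif ^^ Suc n) F k) + s (of_nat (Suc n)) ((dif ^^ n) F (k + 1))"
        unfolding Suc diff_Suc_1 dif_pow_Suc
        using scale_left_distrib[of 1 1]
        by (simp add: scale_left_distrib scale_right_diff_distrib algebra_simps del: funpow.simps)
      finally show ?thesis by simp
    qed
  qed simp
  then show ?thesis by auto
qed

lemma dif_pow_pdeg:
  fixes s :: "complex \<Rightarrow> 'v::ab_group_add \<Rightarrow> 'v"
  assumes "vector_space s" "pdeg s V n F"
  shows "(dif ^^ Suc n) F = (\<lambda>k. 0)"
proof -
  interpret cvec s by (rule cvec.intro, fact)
  show ?thesis using assms(2)
  proof (induction rule: pdeg.induct)
    case (pdeg_add n F G)
    then show ?case by (simp only: dif_pow_add) simp
  next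
    case (pdeg_mult n F)
    have "(dif ^^ Suc (Suc n)) F = (\<lambda>k. 0)"
      by (rule dif_pow_mono[OF pdeg_mult.IH]) simp
    then show ?case using pdeg_mult.IH by (simp only: dif_pow_mult[OF assms(1)]) simp
  next
    case (pdeg_Suc n F)
    show ?case by (rule dif_pow_mono[OF pdeg_Suc.IH]) simp
  qed (simp add: dif_def)
qed

lemma pfun_dnil: "vector_space s \<Longrightarrow> pfun s V F \<Longrightarrow> dnil F"
  unfolding pfun_def dnil_def using dif_pow_pdeg by blast

lemma pdeg_power:
  fixes s :: "complex \<Rightarrow> 'v::ab_group_add \<Rightarrow> 'v"
  assumes "v \<in> V" "vector_space s" shows "pdeg s V i (\<lambda>k. s (of_int k ^ i) v)"
proof -
  interpret cvec s by (rule cvec.intro, fact)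
  show ?thesis
  proof (induction i)
    case 0 then show ?case using pdeg_const[OF assms(1)] by simp
  next
    case (Suc i) then show ?case using pdeg_mult[OF Suc] by simp
  qed
qed

lemma dif_pow_power:
  fixes s :: "complex \<Rightarrow> 'v::ab_group_add \<Rightarrow> 'v"
  assumes "vector_space s"
  shows "(dif ^^ i) (\<lambda>k. s (of_int k ^ i) v) = (\<lambda>k. s (fact i) v)"
proof -
  interpret cvec s by (rule cvec.intro, fact)
  show ?thesis
  proof (induction i)
    case (Suc i)
    have "(dif ^^ Suc i) (\<lambda>k. s (of_int k ^ i) v) = (\<lambda>k. 0)"
      by (rule dif_pow_pdeg[OF assms pdeg_power[of v UNIV]]) (auto simp: assms)
    moreover have "(\<lambda>k. s (of_int k ^ Suc i) v) = (\<lambda>k. s (of_int k) (s (of_int k ^ i) v))" by simp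
    ultimately show ?case using Suc
      by (simp only: dif_pow_mult[OF assms]) (simp add: mult.commute)
  qed simp
qed

lemma dif_pow_sum: "(dif ^^ n) (\<lambda>k. \<Sum>i\<in>I. F i k) = (\<lambda>k. \<Sum>i\<in>I. (dif ^^ n) (F i) k)"
  by (induction I rule: infinite_finite_induct) (simp_all add: dif_pow_zero dif_pow_add)

text \<open>The \<open>(N - 1)\<close>-st difference isolates the leading coefficient.  With \<open>M = 0\<close> the values determine all
  coefficients; with \<open>M > 0\<close> a bound on the degree kills the coefficients above it.\<close>

lemma poly_coeff_in_subspace:
  fixes s :: "complex \<Rightarrow> 'v::ab_group_add \<Rightarrow> 'v"
  assumes s: "vector_space s" "module.subspace s U"
    and F: "\<And>k. F k = (\<Sum>i<N. s (of_int k ^ i) (v i))"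
    and U: "\<And>k. (dif ^^ M) F k \<in> U" and i: "M \<le> i" "i < N"
  shows "v i \<in> U"
proof -
  interpret cvec s by (rule cvec.intro, fact)
  show ?thesis using F U i
  proof (induction N arbitrary: F)
    case (Suc N)
    have F: "F = (\<lambda>k. \<Sum>i<Suc N. s (of_int k ^ i) (v i))" by (auto simp: Suc.prems)
    show ?case
    proof (cases "N < M")
      case True then show ?thesis using Suc.prems by simp
    next
      case False
      have low: "(dif ^^ N) (\<lambda>k. s (of_int k ^ i) (v i)) = (\<lambda>k. 0)" if "i < N" for i
        using that by (intro dif_pow_mono[OF dif_pow_pdeg[OF s(1) pdeg_power[of _ UNIV]]]) (auto simp: s)
      have "(dif ^^ N) F 0 = s (fact N) (v N)"
        unfolding F dif_pow_sum using low by (simp add: dif_pow_power[OF s(1)])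
      moreover have "(dif ^^ N) F = (dif ^^ (N - M)) ((dif ^^ M) F)"
        using False by (simp add: funpow_add[symmetric, THEN fun_cong, unfolded comp_def])
      ultimately have "s (fact N) (v N) \<in> U"
        using dif_pow_in[OF s, of "(dif ^^ M) F" "N - M" 0] Suc.prems(2) by simp
      then have "s (inverse (fact N)) (s (fact N) (v N)) \<in> U" by (rule subspace_scale[OF s(2)])
      then have vN: "v N \<in> U" by simp
      show ?thesis
      proof (cases "i = N")
        case False
        define G where "G = (\<lambda>k. \<Sum>i<N. s (of_int k ^ i) (v i))"
        have FG: "F = (\<lambda>k. G k + s (of_int k ^ N) (v N))" by (simp add: F G_def)
        have "(dif ^^ M) G k \<in> U" for k
        proof -
          have "(dif ^^ M) F k - (dif ^^ M) (\<lambda>k. s (of_int k ^ N) (v N)) k \<in> U"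
            by (intro subspace_diff[OF s(2)] Suc.prems dif_pow_in[OF s] subspace_scale[OF s(2)] vN)
          then show ?thesis by (simp add: FG dif_pow_add)
        qed
        then show ?thesis using Suc.prems False by (intro Suc.IH[of G]) (auto simp: G_def)
      qed (use vN in simp)
    qed
  qed simp
qed

lemma quadratic_eq_zero:
  fixes s :: "complex \<Rightarrow> 'v::ab_group_add \<Rightarrow> 'v"
  assumes "vector_space s" "\<And>l::int. u + s (of_int l) v + s (of_int l ^ 2) w = 0"
  shows "u = 0" "v = 0" "w = 0"
proof -
  interpret cvec s by (rule cvec.intro, fact)
  let ?c = "\<lambda>i::nat. if i = 0 then u else if i = 1 then v else w"
  have "?c i \<in> {0}" if "i < 3" for i
    by (rule poly_coeff_in_subspace[OF assms(1) subspace_single_0, where F = "\<lambda>k. 0" and N = 3 and v = ?c and M = 0])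
      (use that assms(2) in \<open>auto simp: eval_nat_numeral lessThan_Suc dif_pow_zero algebra_simps\<close>)
  from this[of 0] this[of 1] this[of 2] show "u = 0" "v = 0" "w = 0" by auto
qed

section \<open>Representations of the derivations of the polynomial ring\<close>

text \<open>Here \<open>d i\<close> is the action of \<open>t\<^sup>i d/dt\<close>, so that the index is a natural number and is larger by one than
  the index of \<open>d\<^sub>i\<close>; in particular \<open>d 0\<close> is the action of \<open>d/dt\<close> and \<open>d 1\<close> measures the weight.\<close>

locale witt_pre = cvec s for s :: "complex \<Rightarrow> 'v::ab_group_add \<Rightarrow> 'v" +
  fixes V :: "'v set" and d :: "nat \<Rightarrow> 'v \<Rightarrow> 'v"
  assumes sub: "subspace V"
    and d_in [simp]: "w \<in> V \<Longrightarrow> d i w \<in> V"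
    and d_lin: "lin_on s V s (d i)"
    and d_comm: "w \<in> V \<Longrightarrow> d i (d j w) - d j (d i w) = s (of_int (int j - int i)) (d (i + j - 1) w)"
begin

lemma V_0 [simp]: "0 \<in> V" and V_add [simp]: "u \<in> V \<Longrightarrow> v \<in> V \<Longrightarrow> u + v \<in> V"
  and V_diff [simp]: "u \<in> V \<Longrightarrow> v \<in> V \<Longrightarrow> u - v \<in> V" and V_scale [simp]: "u \<in> V \<Longrightarrow> s c u \<in> V"
  and V_uminus [simp]: "u \<in> V \<Longrightarrow> - u \<in> V"
  by (auto intro: subspace_0 subspace_add subspace_diff subspace_scale subspace_neg sub)

lemma V_sum [simp]: "(\<And>i. i \<in> I \<Longrightarrow> g i \<in> V) \<Longrightarrow> (\<Sum>i\<in>I. g i) \<in> V"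
  by (rule subspace_sum[OF sub])

lemma d_add [simp]: "u \<in> V \<Longrightarrow> v \<in> V \<Longrightarrow> d i (u + v) = d i u + d i v"
  and d_scale [simp]: "v \<in> V \<Longrightarrow> d i (s c v) = s c (d i v)"
  and d_diff [simp]: "u \<in> V \<Longrightarrow> v \<in> V \<Longrightarrow> d i (u - v) = d i u - d i v"
  and d_0 [simp]: "d i 0 = 0"
  using lin_on_add[OF d_lin] lin_on_scale[OF d_lin] lin_on_diff[OF d_lin] lin_on_zero[OF d_lin] by auto

lemma d_D: "w \<in> V \<Longrightarrow> d i (d 0 w) = d 0 (d i w) - s (of_nat i) (d (i - 1) w)"
  using d_comm[of w i 0] by (simp add: algebra_simps)

definition stable :: "'v set \<Rightarrow> bool" where
  "stable U \<longleftrightarrow> subspace U \<and> U \<subseteq> V \<and> (\<forall>i. \<forall>w\<in>U. d i w \<in> U)"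

end

locale witt_rep = witt_pre s V d
  for s :: "complex \<Rightarrow> 'v::ab_group_add \<Rightarrow> 'v" and V d +
  assumes d_fin: "w \<in> V \<Longrightarrow> \<exists>n. \<forall>i\<ge>n. d i w = 0"
begin

lemma d_top:
  assumes "w \<in> V" "d i w \<noteq> 0"
  obtains r where "r \<ge> i" "d r w \<noteq> 0" "\<And>j. j > r \<Longrightarrow> d j w = 0"
proof -
  obtain n where n: "\<forall>i\<ge>n. d i w = 0" using d_fin assms by blast
  define r where "r = (GREATEST r. d r w \<noteq> 0)"
  have b: "\<forall>y. d y w \<noteq> 0 \<longrightarrow> y \<le> n" using n by (metis nat_le_linear)
  have "d r w \<noteq> 0" "i \<le> r"
    unfolding r_def using GreatestI_nat[of "\<lambda>r. d r w \<noteq> 0", OF assms(2)] b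
      Greatest_le_nat[of "\<lambda>r. d r w \<noteq> 0", OF assms(2)] by auto
  moreover have "d j w = 0" if "j > r" for j
    using Greatest_le_nat[of "\<lambda>r. d r w \<noteq> 0" j] b that unfolding r_def by (meson not_le)
  ultimately show ?thesis using that by blast
qed

definition E :: "int \<Rightarrow> 'v \<Rightarrow> 'v" where
  "E k w = Sum_any (\<lambda>i. s (of_int k ^ i / fact i) (d i w))"

lemma E_eq:
  assumes "\<And>i. i \<ge> n \<Longrightarrow> d i w = 0"
  shows "E k w = (\<Sum>i<n. s (of_int k ^ i) (s (1 / fact i) (d i w)))"
proof -
  have "E k w = (\<Sum>i<n. s (of_int k ^ i / fact i) (d i w))"
    unfolding E_def by (rule Sum_any.expand_superset) (use assms leI in auto)
  then show ?thesis by simp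
qed

lemma E_expand:
  assumes "w \<in> V"
  obtains n where "\<And>i. i \<ge> n \<Longrightarrow> d i w = 0"
    "\<And>k. E k w = (\<Sum>i<n. s (of_int k ^ i) (s (1 / fact i) (d i w)))"
proof -
  obtain n where "\<forall>i\<ge>n. d i w = 0" using d_fin[OF assms] by blast
  then show ?thesis using that[of n] E_eq[of n w] by blast
qed

lemma E_in [simp]: "w \<in> V \<Longrightarrow> E k w \<in> V"
  by (rule E_expand[of w]) auto

lemma E_lin: "lin_on s V s (E k)"
proof (rule lin_onI)
  fix u v assume uv: "u \<in> V" "v \<in> V"
  obtain n m where "\<forall>i\<ge>n. d i u = 0" "\<forall>i\<ge>m. d i v = 0" using d_fin uv by blast
  then show "E k (u + v) = E k u + E k v" using uv
    by (simp add: E_eq[of "max n m"] scale_right_distrib sum.distrib)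
next
  fix c v assume v: "v \<in> V"
  obtain n where "\<forall>i\<ge>n. d i v = 0" using d_fin v by blast
  then show "E k (s c v) = s c (E k v)" using v
    by (simp add: E_eq[of n] scale_sum_right mult.commute)
qed

lemma E_add [simp]: "u \<in> V \<Longrightarrow> v \<in> V \<Longrightarrow> E i (u + v) = E i u + E i v"
  and E_scale [simp]: "v \<in> V \<Longrightarrow> E i (s c v) = s c (E i v)"
  and E_diff [simp]: "u \<in> V \<Longrightarrow> v \<in> V \<Longrightarrow> E i (u - v) = E i u - E i v"
  and E_0 [simp]: "E i 0 = 0"
  using lin_on_add[OF E_lin] lin_on_scale[OF E_lin] lin_on_diff[OF E_lin] lin_on_zero[OF E_lin] by auto

lemma E_at_0 [simp]: "w \<in> V \<Longrightarrow> E 0 w = d 0 w"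
proof -
  assume "w \<in> V"
  then obtain n where n: "\<forall>i\<ge>n. d i w = 0" using d_fin by blast
  have "E 0 w = (\<Sum>i<Suc n. s (of_int 0 ^ i) (s (1 / fact i) (d i w)))"
    by (rule E_eq) (use n in auto)
  then show ?thesis by (subst (asm) sum.lessThan_Suc_shift) simp
qed

lemma E_pfun: "w \<in> V \<Longrightarrow> pfun s V (\<lambda>k. E k w)"
proof -
  assume w: "w \<in> V"
  obtain n where n: "\<And>k. E k w = (\<Sum>i<n. s (of_int k ^ i) (s (1 / fact i) (d i w)))"
    by (rule E_expand[OF w]) (rule that)
  show ?thesis unfolding n
    unfolding pfun_def using pdeg_power[OF _ vector_space_axioms, of _ V] w
    by (intro pfun_sum[unfolded pfun_def]) (simp, metis d_in V_scale)
qed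

lemma E_D: "w \<in> V \<Longrightarrow> E k (d 0 w) = d 0 (E k w) - s (of_int k) (E k w)"
proof -
  assume w: "w \<in> V"
  obtain n where n: "\<forall>i\<ge>n. d i w = 0" using d_fin w by blast
  have a: "E k (d 0 w) = (\<Sum>i<Suc n. s (of_int k ^ i) (s (1 / fact i) (d i (d 0 w))))"
    by (rule E_eq) (use n w in \<open>auto simp: d_D\<close>)
  have b: "E k w = (\<Sum>i<Suc n. s (of_int k ^ i) (s (1 / fact i) (d i w)))"
    by (rule E_eq) (use n w in auto)
  have c: "E k w = (\<Sum>i<n. s (of_int k ^ i) (s (1 / fact i) (d i w)))"
    by (rule E_eq) (use n w in auto)
  have "d 0 (E k w) = (\<Sum>i<Suc n. s (of_int k ^ i) (s (1 / fact i) (d 0 (d i w))))"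
    unfolding b by (subst lin_on_sum[OF vector_space_axioms sub d_lin]) (auto simp: w)
  then have "E k (d 0 w) = d 0 (E k w) -
      (\<Sum>i<Suc n. s (of_int k ^ i) (s (1 / fact i) (s (of_nat i) (d (i - 1) w))))"
    unfolding a by (simp add: w d_D scale_right_diff_distrib sum_subtractf del: sum.lessThan_Suc)
  also have "(\<Sum>i<Suc n. s (of_int k ^ i) (s (1 / fact i) (s (of_nat i) (d (i - 1) w)))) =
      (\<Sum>i<n. s (of_int k ^ Suc i) (s (1 / fact (Suc i)) (s (of_nat (Suc i)) (d i w))))"
    by (subst sum.lessThan_Suc_shift) simp
  also have "\<dots> = s (of_int k) (E k w)"
    unfolding c scale_sum_right by (intro sum.cong) (simp_all add: divide_simps del: of_nat_Suc)
  finally show ?thesis .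
qed

text \<open>The operators \<open>E k\<close> generate the same submodules as the \<open>d i\<close>, which are their coefficients up to factorials.\<close>

lemma d_in_of_E:
  assumes "w \<in> V" "subspace U" "\<And>k. E k w \<in> U" shows "d i w \<in> U"
proof -
  obtain n where n: "\<And>i. i \<ge> n \<Longrightarrow> d i w = 0"
    "\<And>k. E k w = (\<Sum>i<n. s (of_int k ^ i) (s (1 / fact i) (d i w)))"
    by (rule E_expand[OF assms(1)]) (rule that)
  show ?thesis
  proof (cases "i < n")
    case True
    have "s (1 / fact i) (d i w) \<in> U"
      by (rule poly_coeff_in_subspace[OF vector_space_axioms assms(2) n(2), where M = 0])
        (use assms(3) True in auto)
    then have "s (fact i) (s (1 / fact i) (d i w)) \<in> U" by (rule subspace_scale[OF assms(2)])
    then show ?thesis by simp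
  qed (use n subspace_0[OF assms(2)] in auto)
qed

text \<open>The operator \<open>c - d/dt\<close>, which carries the part of the loop action that is free of \<open>\<lambda>\<close>.\<close>

definition Aff :: "complex \<Rightarrow> 'v \<Rightarrow> 'v" where
  "Aff c w = s c w - d 0 w"

lemma Aff_in [simp]: "w \<in> V \<Longrightarrow> Aff c w \<in> V"
  by (simp add: Aff_def)

lemma Aff_lin: "lin_on s V s (Aff c)"
  by (rule lin_onI) (simp_all add: Aff_def scale_right_distrib scale_right_diff_distrib mult.commute)

lemma Aff_add [simp]: "u \<in> V \<Longrightarrow> v \<in> V \<Longrightarrow> Aff i (u + v) = Aff i u + Aff i v"
  and Aff_scale [simp]: "v \<in> V \<Longrightarrow> Aff i (s c v) = s c (Aff i v)"
  and Aff_diff [simp]: "u \<in> V \<Longrightarrow> v \<in> V \<Longrightarrow> Aff i (u - v) = Aff i u - Aff i v"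
  and Aff_0 [simp]: "Aff i 0 = 0"
  using lin_on_add[OF Aff_lin] lin_on_scale[OF Aff_lin] lin_on_diff[OF Aff_lin] lin_on_zero[OF Aff_lin]
  by auto

lemma Aff_shift: "Aff (c + e) w = Aff c w + s e w"
  by (simp add: Aff_def scale_left_distrib)

lemma E_Aff: "w \<in> V \<Longrightarrow> E k (Aff c w) = Aff (c + of_int k) (E k w)"
  by (simp add: Aff_def E_D scale_left_distrib)


lemma all_zero_if_D_zero:
  assumes "\<And>w. w \<in> V \<Longrightarrow> d 0 w = 0" "w \<in> V" shows "d i w = 0"
proof -
  have "s (of_nat (Suc i)) (d i w) = 0"
    using d_D[OF assms(2), of "Suc i"] assms by simp
  then show ?thesis by (simp del: of_nat_Suc)
qed

text \<open>Commutators with \<open>d 0\<close> lower the index one by one.\<close>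

lemma all_zero_if_high_zero:
  assumes "\<And>i w. i \<ge> n \<Longrightarrow> w \<in> V \<Longrightarrow> d i w = 0" "w \<in> V" shows "d i w = 0"
  using assms
proof (induction n arbitrary: w i)
  case (Suc n)
  have "d n w = 0" if w: "w \<in> V" for w
  proof -
    have "s (of_nat (Suc n)) (d n w) = 0"
      using d_D[OF w, of "Suc n"] Suc.prems w by simp
    then show ?thesis by (simp del: of_nat_Suc)
  qed
  then show ?case using Suc by (metis not_less_eq_eq le_antisym)
qed auto

lemma lin_on_span_in:
  assumes "S \<subseteq> V" "subspace U" "lin_on s V s f" "\<And>x. x \<in> S \<Longrightarrow> f x \<in> U" "v \<in> span S"
  shows "f v \<in> U"
proof -
  have "subspace {v \<in> V. f v \<in> U}"
    using lin_on_zero[OF assms(3)]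
    by (intro subspaceI)
      (auto simp: lin_on_add[OF assms(3)] lin_on_scale[OF assms(3)]
        intro: subspace_0 subspace_add subspace_scale assms(2))
  then have "span S \<subseteq> {v \<in> V. f v \<in> U}" by (rule span_minimal[rotated]) (use assms in auto)
  then show "f v \<in> U" using assms(5) by auto
qed

lemma D_pow_in [simp]: "w \<in> V \<Longrightarrow> (d 0 ^^ k) w \<in> V"
  by (induction k) auto

text \<open>Moving \<open>d i\<close> to the right past a power of \<open>d 0\<close> produces only terms with a power of \<open>d 0\<close> on the left of
  some \<open>d j\<close>, \<open>j \<le> i\<close>.\<close>

lemma stable_span_D_pow:
  assumes U: "subspace U" "U \<subseteq> V" "\<And>u. u \<in> U \<Longrightarrow> d 1 u \<in> U" "\<And>u i. u \<in> U \<Longrightarrow> i \<ge> 2 \<Longrightarrow> d i u = 0"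
  shows "stable (span {(d 0 ^^ k) u | k u. u \<in> U})" (is "stable (span ?S)")
proof -
  have SV: "?S \<subseteq> V" using U(2) by auto
  have D: "d 0 v \<in> span ?S" if "v \<in> span ?S" for v
  proof (rule lin_on_span_in[OF SV subspace_span d_lin _ that])
    fix x assume "x \<in> ?S"
    then obtain k u where "x = (d 0 ^^ k) u" "u \<in> U" by auto
    then have "d 0 x \<in> ?S" by (auto intro!: exI[of _ "Suc k"])
    then show "d 0 x \<in> span ?S" by (rule span_base)
  qed
  have gen: "d i ((d 0 ^^ k) u) \<in> span ?S" if "u \<in> U" for i k u
    using that
  proof (induction k arbitrary: i)
    case 0
    show ?case
    proof (cases "i \<ge> 2")
      case True then show ?thesis using U(4)[OF 0 True] by (simp add: span_zero)
    next
      case False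
      then consider "i = 0" | "i = 1" by linarith
      then show ?thesis
      proof cases
        case 1
        then show ?thesis using 0 by (intro span_base) (auto intro!: exI[of _ "Suc 0"])
      next
        case 2
        have "(d 0 ^^ 0) (d 1 u) \<in> ?S" using U(3)[OF 0] by blast
        then show ?thesis using 2 by (auto intro: span_base)
      qed
    qed
  next
    case (Suc k)
    have "(d 0 ^^ k) u \<in> V" using Suc.prems U(2) by auto
    then have "d i ((d 0 ^^ Suc k) u) =
        d 0 (d i ((d 0 ^^ k) u)) - s (of_nat i) (d (i - 1) ((d 0 ^^ k) u))"
      by (simp add: d_D)
    then show ?case using Suc D by (auto intro!: span_diff span_scale)
  qed
  show ?thesis unfolding stable_def
  proof (intro conjI allI ballI subsetI)
    fix v i assume v: "v \<in> span ?S"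
    show "v \<in> V" using v span_minimal[OF SV sub] by auto
    show "d i v \<in> span ?S" by (rule lin_on_span_in[OF SV subspace_span d_lin _ v]) (auto intro: gen)
  qed simp
qed

end

locale simple_witt_rep = witt_rep +
  assumes simple: "stable U \<Longrightarrow> U = {0} \<or> U = V"
    and nontrivial: "\<exists>i. \<exists>w\<in>V. d i w \<noteq> 0"
begin

lemma V_nonzero: "\<exists>w\<in>V. w \<noteq> 0"
  using nontrivial d_0 by metis

lemma stable_eq_V: "stable U \<Longrightarrow> u \<in> U \<Longrightarrow> u \<noteq> 0 \<Longrightarrow> U = V"
  using simple by blast

text \<open>A vector killed by \<open>t\<complex>[t] d/dt\<close> would be the highest weight vector of weight \<open>0\<close>, and
  \<open>d/dt\<close> would map the module onto a proper submodule.\<close>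

lemma zero_if_highest_weight_zero:
  assumes w: "w \<in> V" "\<And>i. i \<ge> 1 \<Longrightarrow> d i w = 0"
  shows "w = 0"
proof (rule ccontr)
  assume w0: "w \<noteq> 0"
  define U where "U = range (\<lambda>c. s c w)"
  define S where "S = {(d 0 ^^ k) u | k u. u \<in> U}"
  have sU: "subspace U" unfolding U_def
  proof (rule subspaceI)
    show "0 \<in> range (\<lambda>c. s c w)" using scale_zero_left[of w] by (metis rangeI)
    show "x + y \<in> range (\<lambda>c. s c w)" if "x \<in> range (\<lambda>c. s c w)" "y \<in> range (\<lambda>c. s c w)" for x y
      using that by (auto simp: scale_left_distrib[symmetric])
    show "s e x \<in> range (\<lambda>c. s c w)" if "x \<in> range (\<lambda>c. s c w)" for e x
      using that by auto
  qed
  have UV: "U \<subseteq> V" using w by (auto simp: U_def)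
  have Uz: "d i u = 0" if "u \<in> U" "i \<ge> 1" for i u using that w by (auto simp: U_def)
  have "stable (span S)" unfolding S_def
    by (rule stable_span_D_pow[OF sU UV]) (use Uz subspace_0[OF sU] in auto)
  moreover have "w \<in> U" unfolding U_def by (intro image_eqI[of _ _ 1]) auto
  then have "(d 0 ^^ 0) w \<in> S" unfolding S_def by blast
  then have "w \<in> span S" by (auto intro: span_base)
  ultimately have SV: "span S = V" using w0 by (blast dest: stable_eq_V)
  define DV where "DV = d 0 ` V"
  have sDV: "subspace DV" unfolding DV_def
  proof (rule subspaceI)
    show "0 \<in> d 0 ` V" using d_0[of 0] V_0 by (metis image_eqI)
    show "x + y \<in> d 0 ` V" if "x \<in> d 0 ` V" "y \<in> d 0 ` V" for x y
      using that by (auto simp: d_add[symmetric] simp del: d_add)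
    show "s e x \<in> d 0 ` V" if "x \<in> d 0 ` V" for e x
      using that by (auto simp: d_scale[symmetric] simp del: d_scale)
  qed
  have gen: "d i ((d 0 ^^ k) u) \<in> DV" if "u \<in> U" "i \<ge> 1" for i k u
    using that
  proof (induction k arbitrary: i)
    case 0 then show ?case using Uz subspace_0[OF sDV] by simp
  next
    case (Suc k)
    let ?v = "(d 0 ^^ k) u"
    have v: "?v \<in> V" using Suc.prems UV by auto
    have "d (i - 1) ?v \<in> DV"
    proof (cases "i = 1")
      case True then show ?thesis using v by (auto simp: DV_def)
    next
      case False then show ?thesis using Suc by simp
    qed
    moreover have "d 0 (d i ?v) \<in> DV" using v by (auto simp: DV_def)
    ultimately show ?case
      using d_D[OF v, of i] subspace_diff[OF sDV] subspace_scale[OF sDV] by simp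
  qed
  have "d i v \<in> DV" if "v \<in> V" for i v
  proof (cases "i = 0")
    case True then show ?thesis using that by (auto simp: DV_def)
  next
    case False
    have "S \<subseteq> V" using UV by (auto simp: S_def)
    moreover have "d i x \<in> DV" if "x \<in> S" for x using that False gen by (auto simp: S_def)
    moreover have "v \<in> span S" using that SV by simp
    ultimately show ?thesis by (rule lin_on_span_in[OF _ sDV d_lin])
  qed
  moreover have DVV: "DV \<subseteq> V" unfolding DV_def by (rule image_subsetI) simp
  ultimately have "stable DV" unfolding stable_def by (intro conjI allI ballI sDV) (metis subsetD)+
  show False
  proof (cases "DV = {0}")
    case True
    then have "d 0 v = 0" if "v \<in> V" for v using that by (auto simp: DV_def)
    then show False using nontrivial all_zero_if_D_zero by blast
  next
    case False
    then have "DV = V" using \<open>stable DV\<close> simple by blast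
    then obtain u where u: "u \<in> V" "w = d 0 u" using w by (auto simp: DV_def)
    have uz: "d i u = 0" if "i \<ge> 1" for i
    proof (rule ccontr)
      assume "d i u \<noteq> 0"
      then obtain r where r: "r \<ge> i" "d r u \<noteq> 0" "\<And>j. j > r \<Longrightarrow> d j u = 0"
        using d_top[OF u(1)] by blast
      have "d (Suc r) w = - s (of_nat (Suc r)) (d r u)"
        using d_D[OF u(1), of "Suc r"] r(3)[of "Suc r"] u(2) by simp
      moreover have "d (Suc r) w = 0" by (rule w) simp
      ultimately show False using r(2) by (simp del: of_nat_Suc)
    qed
    have "d 1 w = - w" using d_D[OF u(1), of 1] uz[of 1] u(2) by simp
    then show False using w(2)[of 1] w0 by simp
  qed
qed

lemma level:
  assumes "w \<in> V" "w \<noteq> 0"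
  obtains r where "r \<ge> 1" "d r w \<noteq> 0" "\<And>j. j > r \<Longrightarrow> d j w = 0"
proof -
  obtain i where "i \<ge> 1" "d i w \<noteq> 0"
    using zero_if_highest_weight_zero[OF assms(1)] assms(2) by blast
  then show ?thesis using d_top[OF assms(1)] that by (metis order_trans)
qed

text \<open>The operator \<open>c - d/dt\<close> raises the largest index of a derivation that does not kill a vector,
  so a vector for which this index is minimal is not in its image.\<close>

lemma level_Aff:
  assumes "u \<in> V" "r \<ge> 1" "d r u \<noteq> 0" "\<And>j. j > r \<Longrightarrow> d j u = 0"
  shows "d (Suc r) (Aff c u) \<noteq> 0"
proof -
  have "d (Suc r) (Aff c u) = s (of_nat (Suc r)) (d r u)"
    using assms(1) assms(4)[of "Suc r"] by (simp add: Aff_def d_D)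
  then show ?thesis using assms(3) by (simp del: of_nat_Suc)
qed

lemma Aff_not_surj: "Aff c ` V \<noteq> V"
proof
  assume surj: "Aff c ` V = V"
  have "w = 0" if "w \<in> V" "\<forall>i>r. d i w = 0" for r w
    using that
  proof (induction r arbitrary: w)
    case 0
    then show ?case using zero_if_highest_weight_zero[of w] by simp
  next
    case (Suc r)
    then obtain u where u: "u \<in> V" "w = Aff c u" using surj by (metis imageE)
    have "u = 0"
    proof (rule ccontr)
      assume "u \<noteq> 0"
      then obtain r' where r': "r' \<ge> 1" "d r' u \<noteq> 0" "\<And>j. j > r' \<Longrightarrow> d j u = 0"
        using level u(1) by metis
      then have "d (Suc r') w \<noteq> 0" using level_Aff u by blast
      then have "r' \<le> r" using Suc.prems(2) by (metis Suc_less_eq not_le)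
      then have "\<forall>i>r. d i u = 0" using r'(3) by auto
      then show False using Suc.IH u(1) \<open>u \<noteq> 0\<close> by blast
    qed
    then show ?case using u by simp
  qed
  moreover obtain w where w: "w \<in> V" "w \<noteq> 0" using V_nonzero by blast
  moreover obtain r where "\<forall>i>r. d i w = 0" using level[OF w] by metis
  ultimately show False by blast
qed

text \<open>Let \<open>r\<close> be the smallest number such that some \<open>w \<noteq> 0\<close> is killed by all \<open>d i\<close> with \<open>i > r\<close>.  Such vectors
  are preserved by \<open>d r\<close>, which is injective on them by minimality.  If \<open>r \<ge> 2\<close>, then \<open>E (-k) (E k w)\<close> has
  degree \<open>2 r\<close> in \<open>k\<close> with leading term a multiple of \<open>d r (d r w) \<noteq> 0\<close>, and \<open>2 r > 2\<close>.\<close>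

lemma low_level_vector_if_cubic_differences_vanish:
  assumes "\<And>w. w \<in> V \<Longrightarrow> (dif ^^ 3) (\<lambda>k. E (- k) (E k w)) = (\<lambda>k. 0)"
  shows "\<exists>w\<in>V. w \<noteq> 0 \<and> (\<forall>i\<ge>2. d i w = 0)"
proof -
  let ?P = "\<lambda>r. \<exists>w\<in>V. w \<noteq> 0 \<and> (\<forall>i>r. d i w = 0)"
  define r where "r = (LEAST r. ?P r)"
  obtain v where v: "v \<in> V" "v \<noteq> 0" using V_nonzero by blast
  have "\<exists>r. ?P r" using level[OF v] v by metis
  then have "?P r" unfolding r_def by (rule LeastI_ex)
  then obtain w where w: "w \<in> V" "w \<noteq> 0" "\<And>i. i > r \<Longrightarrow> d i w = 0" by blast
  have min: "u = 0" if "u \<in> V" "\<And>i. i \<ge> r \<Longrightarrow> d i u = 0" for u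
  proof (cases "r = 0")
    case True then show ?thesis using that zero_if_highest_weight_zero[of u] by simp
  next
    case False
    then have "\<not> ?P (r - 1)" unfolding r_def by (intro not_less_Least) auto
    moreover have "\<forall>i>r - 1. d i u = 0" using that(2) by auto
    ultimately show ?thesis using that by blast
  qed
  show ?thesis
  proof (cases "r \<ge> 2")
    case False
    then have "\<forall>i\<ge>2. d i w = 0" using w(3) by auto
    then show ?thesis using w by blast
  next
    case True
    \<comment> \<open>for \<open>i = 0\<close> this fails at \<open>j = r + 1\<close>, which is why \<open>j\<close> ranges up to \<open>r + 1\<close> below\<close>
    have dd: "d j (d i w) = 0" if "j > r" "i \<ge> 1" for i j
      using d_comm[OF w(1), of j i] w(3)[of j] w(3)[of "j + i - 1"] that by simp
    have "d r w \<noteq> 0" using min[OF w(1)] w(2,3) by (metis le_eq_less_or_eq)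
    then have top: "d r (d r w) \<noteq> 0"
      using min[of "d r w"] dd[of _ r] w(1) True by (metis d_in le_eq_less_or_eq One_nat_def Suc_leI
        less_le_trans pos2)
    define c where "c = (\<lambda>(i, j). s ((-1) ^ j / (fact i * fact j)) (d j (d i w)))"
    define P where "P = {..r} \<times> {..Suc r}"
    have cV: "c p \<in> V" for p using w by (auto simp: c_def split: prod.splits)
    have F: "E (- k) (E k w) = (\<Sum>p\<in>P. s (of_int k ^ (fst p + snd p)) (c p))" for k
    proof -
      have 1: "E k w = (\<Sum>i<Suc r. s (of_int k ^ i) (s (1 / fact i) (d i w)))"
        by (rule E_eq) (use w in auto)
      have 2: "E (- k) (d i w) = (\<Sum>j<Suc (Suc r). s (of_int (- k) ^ j) (s (1 / fact j) (d j (d i w))))" for i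
      proof (rule E_eq)
        fix j assume j: "j \<ge> Suc (Suc r)"
        show "d j (d i w) = 0"
        proof (cases "i = 0")
          case True then show ?thesis using j w(3)[of j] w(3)[of "j - 1"] w(1) by (simp add: d_D)
        next
          case False then show ?thesis using j by (intro dd) auto
        qed
      qed
      have "E (- k) (E k w) = (\<Sum>i<Suc r. s (of_int k ^ i) (s (1 / fact i) (E (- k) (d i w))))"
        unfolding 1 by (subst lin_on_sum[OF vector_space_axioms sub E_lin]) (auto simp: w)
      also have "\<dots> = (\<Sum>i<Suc r. \<Sum>j<Suc (Suc r). s (of_int k ^ (i + j)) (c (i, j)))"
        unfolding 2 scale_sum_right c_def
        by (intro sum.cong) (auto simp: power_add power_minus[of "of_int k"] mult.commute)
      finally show ?thesis
        by (simp add: P_def sum.cartesian_product lessThan_Suc_atMost split_def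
            del: sum.lessThan_Suc sum.atMost_Suc)
    qed
    define G where "G = (\<lambda>k. \<Sum>p\<in>P - {(r, r)}. s (of_int k ^ (fst p + snd p)) (c p))"
    have "pdeg s V (2 * r - 1) (\<lambda>k. s (of_int k ^ (fst p + snd p)) (c p))" if p: "p \<in> P - {(r, r)}" for p
    proof (cases "fst p + snd p < 2 * r")
      case True
      then show ?thesis
        by (intro pdeg_mono[OF pdeg_power[OF cV vector_space_axioms]]) auto
    next
      case False
      then have "fst p \<ge> 1" "snd p > r" using p \<open>r \<ge> 2\<close> by (cases p; auto simp: P_def)+
      then have "c p = 0" using dd by (auto simp: c_def split: prod.splits)
      then show ?thesis using pdeg_mono[OF pdeg_const[OF V_0]] by simp
    qed
    then have "pdeg s V (2 * r - 1) G" unfolding G_def by (intro pdeg_sum) auto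
    then have G: "(dif ^^ (2 * r)) G = (\<lambda>k. 0)"
      using dif_pow_pdeg[OF vector_space_axioms, of V "2 * r - 1" G] True by simp
    have "(\<lambda>k. E (- k) (E k w)) = (\<lambda>k. s (of_int k ^ (2 * r)) (c (r, r)) + G k)"
      unfolding F G_def
      by (subst sum.remove[of _ "(r, r)"]) (auto simp: P_def mult_2)
    then have "(dif ^^ (2 * r)) (\<lambda>k. E (- k) (E k w)) = (\<lambda>k. s (fact (2 * r)) (c (r, r)))"
      using G by (simp add: dif_pow_add dif_pow_power[OF vector_space_axioms])
    moreover have "(dif ^^ (2 * r)) (\<lambda>k. E (- k) (E k w)) = (\<lambda>k. 0)"
      by (rule dif_pow_mono[OF assms[OF w(1)]]) (use True in simp)
    ultimately have "s (fact (2 * r)) (c (r, r)) = 0" by metis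
    then have "d r (d r w) = 0" by (simp add: c_def)
    with top show ?thesis by simp
  qed
qed

end

subsection \<open>Polynomials in an operator\<close>

context cvec
begin

definition pact :: "('v \<Rightarrow> 'v) \<Rightarrow> 'v \<Rightarrow> complex poly \<Rightarrow> 'v" where
  "pact T w p = fold_coeffs (\<lambda>a u. s a w + T u) p 0"

context
  fixes V T
  assumes V: "subspace V" and T: "lin_on s V s T" "T ` V \<subseteq> V"
begin

lemma T_in: "v \<in> V \<Longrightarrow> T v \<in> V"
  using T(2) by auto

lemma T_0: "T 0 = 0"
  by (rule lin_on_zero[OF T(1) subspace_0[OF V]])

lemma pact_0 [simp]: "pact T w 0 = 0"
  by (simp add: pact_def)

lemma pact_pCons: "pact T w (pCons a p) = s a w + T (pact T w p)"
  by (cases "a = 0 \<and> p = 0") (auto simp: pact_def fold_coeffs_pCons_eq T_0)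

lemma pact_in: "w \<in> V \<Longrightarrow> pact T w p \<in> V"
  by (induction p) (auto simp: pact_pCons intro!: subspace_0 subspace_add subspace_scale V T_in)

lemma pact_add: "w \<in> V \<Longrightarrow> pact T w (p + q) = pact T w p + pact T w q"
  by (induction p q rule: poly_induct2)
    (auto simp: pact_pCons T_0 lin_on_add[OF T(1)] pact_in scale_left_distrib algebra_simps)

lemma pact_smult: "w \<in> V \<Longrightarrow> pact T w (smult c p) = s c (pact T w p)"
  by (induction p) (auto simp: pact_pCons lin_on_scale[OF T(1)] pact_in scale_right_distrib)

lemma pact_shift: "w \<in> V \<Longrightarrow> pact T (T w) p = T (pact T w p)"
  by (induction p) (auto simp: pact_pCons T_0 lin_on_scale[OF T(1)] lin_on_add[OF T(1)] pact_in T_in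
      subspace_scale[OF V])

text \<open>Split off a root \<open>z\<close> of the annihilating polynomial: either the cofactor already annihilates \<open>w\<close>, or
  it maps \<open>w\<close> to an eigenvector for \<open>z\<close>.\<close>

lemma eigenvector_of_annihilator:
  assumes w: "w \<in> V" "w \<noteq> 0" and q: "q \<noteq> 0" "pact T w q = 0"
  shows "\<exists>z p. pact T w p \<noteq> 0 \<and> T (pact T w p) = s z (pact T w p)"
  using q
proof (induction "degree q" arbitrary: q)
  case 0
  then obtain c where "q = [:c:]" by (metis degree_eq_zeroE)
  then show ?case using 0 w by (simp add: pact_pCons T_0)
next
  case (Suc n)
  then have "\<not> constant (poly q)" by (simp add: constant_degree)
  then obtain z where "poly q z = 0" using fundamental_theorem_of_algebra by blast
  then obtain p where p: "q = [:- z, 1:] * p" by (auto simp: poly_eq_0_iff_dvd)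
  have "p \<noteq> 0" using p Suc.prems by auto
  have "0 = pact T w (smult (- z) p + pCons 0 p)" using Suc.prems p by simp
  also have "\<dots> = T (pact T w p) - s z (pact T w p)"
    by (subst pact_add[OF w(1)]) (simp add: pact_smult[OF w(1)] pact_pCons del: smult_minus_left)
  finally have e: "T (pact T w p) = s z (pact T w p)" by simp
  show ?case
  proof (cases "pact T w p = 0")
    case True
    have "degree q = Suc (degree p)"
      unfolding p using \<open>p \<noteq> 0\<close> by (subst degree_mult_eq) auto
    then show ?thesis using Suc True \<open>p \<noteq> 0\<close> by auto
  qed (use e in blast)
qed

end
end

section \<open>The loop action\<close>

text \<open>The \<open>\<complex>[d 1]\<close>-module \<open>U\<close> generated by \<open>d 1 w0\<close> generates \<open>V = U + d 0 ` V\<close>.  Comparing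
  levels shows \<open>w0 \<in> U\<close>, that is, \<open>w0\<close> is annihilated by a nonzero polynomial in \<open>d 1\<close>.\<close>

lemma (in simple_witt_rep) highest_weight_vector_exists:
  assumes w0: "w0 \<in> V" "w0 \<noteq> 0" "\<And>i. i \<ge> 2 \<Longrightarrow> d i w0 = 0"
  shows "\<exists>w h. w \<in> V \<and> w \<noteq> 0 \<and> h \<noteq> 0 \<and> d 1 w = s h w \<and> (\<forall>i\<ge>2. d i w = 0)"
proof -
  define T1 where "T1 = d 1"
  have d1: "lin_on s V s T1" "T1 ` V \<subseteq> V" by (auto intro: d_lin simp: T1_def)
  note pact = pact_pCons[OF sub d1] pact_in[OF sub d1] pact_add[OF sub d1] pact_smult[OF sub d1]
    pact_shift[OF sub d1] pact_0[OF sub d1]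
  have T1_0: "T1 0 = 0" by (simp add: T1_def)
  have T1_neg: "T1 (- v) = - T1 v" if "v \<in> V" for v
    using d_scale[OF that, of 1 "-1"] by (simp add: T1_def)
  have killed: "d i (pact T1 w p) = 0" if "w \<in> V" "\<And>i. i \<ge> 2 \<Longrightarrow> d i w = 0" "i \<ge> 2" for w i p
    using that(3)
  proof (induction p arbitrary: i)
    case (pCons a p)
    have "d i (T1 (pact T1 w p)) = 0"
      using d_comm[of "pact T1 w p" i 1] pCons pact(2)[OF that(1)] by (simp add: T1_def)
    moreover have "T1 (pact T1 w p) \<in> V" using pact(2)[OF that(1)] by (simp add: T1_def)
    ultimately show ?case using pCons.prems that(1,2) by (simp add: pact)
  qed (simp add: pact)
  define u where "u = T1 w0"
  define U where "U = range (pact T1 u)"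
  have u: "u \<in> V" "\<And>i. i \<ge> 2 \<Longrightarrow> d i u = 0"
  proof -
    show "u \<in> V" by (simp add: u_def T1_def w0)
    show "d i u = 0" if "i \<ge> 2" for i
      using killed[OF w0(1,3) that, of "[:0, 1:]"] by (simp add: u_def pact T1_0)
  qed
  have u0: "u \<noteq> 0"
  proof
    assume "u = 0"
    then have "d i w0 = 0" if "i \<ge> 1" for i
      using that w0(3)[of i] by (cases "i = 1") (auto simp: u_def T1_def)
    then show False using zero_if_highest_weight_zero w0 by blast
  qed
  have sU: "subspace U" unfolding U_def
  proof (rule subspaceI)
    show "0 \<in> range (pact T1 u)" by (rule image_eqI[of _ _ 0]) (simp_all add: pact)
    show "x + y \<in> range (pact T1 u)" if "x \<in> range (pact T1 u)" "y \<in> range (pact T1 u)" for x y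
      using that by (auto simp: pact(3)[OF u(1), symmetric])
    show "s c x \<in> range (pact T1 u)" if "x \<in> range (pact T1 u)" for c x
      using that by (auto simp: pact(4)[OF u(1), symmetric])
  qed
  have UV: "U \<subseteq> V" unfolding U_def using pact(2)[OF u(1)] by auto
  define S where "S = {(d 0 ^^ k) u | k u. u \<in> U}"
  have "stable (span S)" unfolding S_def
  proof (rule stable_span_D_pow[OF sU UV])
    have "T1 v \<in> U" if v: "v \<in> U" for v
    proof -
      obtain p where "v = pact T1 u p" using v by (auto simp: U_def)
      then have "T1 v = pact T1 u (pCons 0 p)" by (simp add: pact)
      then show ?thesis by (simp add: U_def)
    qed
    then show "d 1 v \<in> U" if v: "v \<in> U" for v using that by (simp add: T1_def)
    show "d i v = 0" if "v \<in> U" "2 \<le> i" for v i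
      using that killed[OF u] by (auto simp: U_def)
  qed
  moreover have "u \<in> span S"
  proof -
    have "u = pact T1 u [:1:]" by (simp add: pact T1_0)
    then have "u \<in> U" unfolding U_def by blast
    then have "(d 0 ^^ 0) u \<in> S" unfolding S_def by blast
    then show ?thesis by (auto intro: span_base)
  qed
  ultimately have SV: "span S = V" using u0 by (blast dest: stable_eq_V)
  define T where "T = {x + d 0 v | x v. x \<in> U \<and> v \<in> V}"
  have "subspace T"
  proof (rule subspaceI)
    have "0 + d 0 0 \<in> T" unfolding T_def using subspace_0[OF sU] V_0 by blast
    then show "0 \<in> T" by simp
    show "x + y \<in> T" if xy: "x \<in> T" "y \<in> T" for x y
    proof -
      obtain x1 x2 y1 y2 where "x = x1 + d 0 x2" "y = y1 + d 0 y2" "x1 \<in> U" "y1 \<in> U" "x2 \<in> V" "y2 \<in> V"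
        using xy unfolding T_def by auto
      moreover from this have "x + y = (x1 + y1) + d 0 (x2 + y2)" by simp
      ultimately show ?thesis unfolding T_def using subspace_add[OF sU] V_add by blast
    qed
    show "s c x \<in> T" if x: "x \<in> T" for c x
    proof -
      obtain x1 x2 where "x = x1 + d 0 x2" "x1 \<in> U" "x2 \<in> V" using x unfolding T_def by auto
      moreover from this have "s c x = s c x1 + d 0 (s c x2)" by (simp add: scale_right_distrib)
      ultimately show ?thesis unfolding T_def using subspace_scale[OF sU] V_scale by blast
    qed
  qed
  moreover have "S \<subseteq> T"
  proof
    fix x assume "x \<in> S"
    then obtain k y where x: "x = (d 0 ^^ k) y" "y \<in> U" by (auto simp: S_def)
    show "x \<in> T"
    proof (cases k)
      case 0
      then have "x = y + d 0 0" using x by simp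
      then show ?thesis unfolding T_def using x V_0 by blast
    next
      case (Suc l)
      then have "x = 0 + d 0 ((d 0 ^^ l) y)" using x by simp
      moreover have "(d 0 ^^ l) y \<in> V" using x UV by auto
      ultimately show ?thesis unfolding T_def using subspace_0[OF sU] by blast
    qed
  qed
  ultimately have "V \<subseteq> T" using span_minimal SV by blast
  then obtain x v where xv: "w0 = x + d 0 v" "x \<in> U" "v \<in> V" using w0 unfolding T_def by auto
  have "v = 0"
  proof (rule ccontr)
    assume "v \<noteq> 0"
    then obtain r where r: "r \<ge> 1" "d r v \<noteq> 0" "\<And>j. j > r \<Longrightarrow> d j v = 0"
      using level[OF xv(3)] by metis
    have "d (Suc r) (d 0 v) = - s (of_nat (Suc r)) (d r v)"
      using d_D[OF xv(3), of "Suc r"] r(3)[of "Suc r"] by simp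
    moreover have "d (Suc r) (d 0 v) = 0"
    proof -
      have "d (Suc r) w0 = 0" using r(1) by (intro w0) auto
      moreover have "d (Suc r) x = 0" using xv(2) killed[OF u] r(1) by (auto simp: U_def)
      moreover have "x \<in> V" using xv(2) UV by auto
      ultimately show ?thesis using xv by simp
    qed
    ultimately show False using r(2) by (simp del: of_nat_Suc)
  qed
  then obtain p where p: "w0 = pact T1 u p" using xv by (auto simp: U_def)
  define q where "q = pCons 1 (- p)"
  have "pact T1 w0 q = w0 + T1 (pact T1 w0 (smult (-1) p))"
    by (simp add: q_def pact)
  also have "\<dots> = w0 - pact T1 u p"
    by (subst pact(4)[OF w0(1)]) (simp add: pact(2)[OF w0(1)] u_def pact(5)[OF w0(1)] T1_neg)
  finally have "pact T1 w0 q = 0" using p by simp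
  moreover have "q \<noteq> 0" by (simp add: q_def)
  ultimately obtain h p' where h: "pact T1 w0 p' \<noteq> 0" "T1 (pact T1 w0 p') = s h (pact T1 w0 p')"
    using eigenvector_of_annihilator[OF sub d1 w0(1,2)] by blast
  let ?w = "pact T1 w0 p'"
  have w: "?w \<in> V" "\<And>i. i \<ge> 2 \<Longrightarrow> d i ?w = 0"
    using pact(2)[OF w0(1)] killed[OF w0(1,3)] by auto
  have "h \<noteq> 0"
  proof
    assume "h = 0"
    then have "d i ?w = 0" if "i \<ge> 1" for i using that w(2)[of i] h(2)
      by (cases "i = 1") (auto simp: T1_def)
    then show False using zero_if_highest_weight_zero w h(1) by blast
  qed
  then show ?thesis using w h unfolding T1_def by blast
qed

context witt_rep
begin

text \<open>The operator by which \<open>d\<^sub>k\<close> maps \<open>W \<otimes> t\<^sup>j\<close> to \<open>W \<otimes> t\<^sup>k\<^sup>+\<^sup>j\<close> in \<open>\<L>(W, \<lambda>, a, b)\<close>.\<close>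

definition Lop :: "complex \<Rightarrow> complex \<Rightarrow> complex \<Rightarrow> int \<Rightarrow> int \<Rightarrow> 'v \<Rightarrow> 'v" where
  "Lop lam a b k j w = s (lam powi k) (E k w) + Aff (a + of_int k * b + of_int j) w"

lemma Lop_in [simp]: "w \<in> V \<Longrightarrow> Lop lam a b k j w \<in> V"
  by (simp add: Lop_def)

lemma Lop_lin: "lin_on s V s (Lop lam a b k j)"
  by (rule lin_onI) (auto simp: Lop_def scale_right_distrib mult.commute)

text \<open>The operator of \<open>d\<^sub>n\<^sub>-\<^sub>k d\<^sub>k\<close> on \<open>w \<otimes> t\<^sup>j\<close> as an exponential polynomial in \<open>k\<close>; in the \<open>\<lambda>\<close>-term the operator
  \<open>c - d/dt\<close> has been moved to the right of \<open>E k\<close>.\<close>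

definition two_step :: "complex \<Rightarrow> complex \<Rightarrow> complex \<Rightarrow> int \<Rightarrow> int \<Rightarrow> 'v \<Rightarrow> (complex \<times> (int \<Rightarrow> 'v)) list" where
  "two_step lam a b n j w =
    [(1, \<lambda>k. s (lam powi n) (E (n - k) (E k w)) +
        Aff (a + of_int (n - k) * b + of_int (k + j)) (Aff (a + of_int k * b + of_int j) w)),
     (lam, \<lambda>k. E k (Aff (a + of_int (n - k) * b + of_int j) w)),
     (inverse lam, \<lambda>k. s (lam powi n) (E (n - k) (Aff (a + of_int k * b + of_int j) w)))]"

lemma two_step_sum:
  assumes "w \<in> V" "lam \<noteq> 0"
  shows "Lop lam a b (n - k) (k + j) (Lop lam a b k j w) = exp_sum s (two_step lam a b n j w) k"
proof -
  have 1: "lam powi (n - k) * lam powi k = lam powi n"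
    using assms(2) by (simp add: power_int_diff)
  have 2: "lam powi (n - k) = inverse lam powi k * lam powi n"
    using assms(2) by (simp add: power_int_diff power_int_inverse field_simps)
  have "E k (Aff (a + of_int (n - k) * b + of_int j) w) =
      Aff (a + of_int (n - k) * b + of_int (k + j)) (E k w)"
    using E_Aff[OF assms(1)] by (simp add: algebra_simps)
  then show ?thesis using assms(1)
    by (simp add: Lop_def[of _ _ _ "n - k"] two_step_def Lop_def[of _ _ _ k] scale_right_distrib 1 2[symmetric])
qed

lemma pfun_E: "pfun s V F \<Longrightarrow> pfun s V (\<lambda>k. E k (F k))"
  by (rule pfun_apply[OF vector_space_axioms sub V_0 E_lin E_pfun])

lemma pfun_E_reflect: "pfun s V F \<Longrightarrow> pfun s V (\<lambda>k. E (n - k) (F k))"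
  by (rule pfun_apply[OF vector_space_axioms sub V_0 E_lin])
    (auto intro: pfun_reflect[OF vector_space_axioms sub E_pfun])


lemma pfun_E_shift: "w \<in> V \<Longrightarrow> pfun s V (\<lambda>k. E (k - n) w)"
proof -
  assume "w \<in> V"
  then have "pfun s V (\<lambda>k. E (0 - k) w)" by (intro pfun_reflect[OF vector_space_axioms sub E_pfun])
  from pfun_reflect[OF vector_space_axioms sub this, of n] show ?thesis by simp
qed

lemma pfun_Aff:
  assumes "\<And>k. f k = f 0 + of_int k * (f 1 - f 0)" "pfun s V F"
  shows "pfun s V (\<lambda>k. Aff (f k) (F k))"
proof -
  have "(\<lambda>k. Aff (f k) (F k)) = (\<lambda>k. Aff (f 0) (F k) + s (of_int k) (s (f 1 - f 0) (F k)))"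
    by (rule ext, subst assms(1)) (simp add: Aff_shift)
  moreover have "pfun s V (\<lambda>k. Aff (f 0) (F k) + s (of_int k) (s (f 1 - f 0) (F k)))"
    by (intro pfun_add pfun_mult pfun_scale[OF vector_space_axioms sub] assms
        pfun_lin[OF vector_space_axioms sub Aff_lin]) auto
  ultimately show ?thesis by (simp only:)
qed

lemma pdeg_Aff:
  assumes "\<And>k. f k = f 0 + of_int k * (f 1 - f 0)" "pdeg s V n F"
  shows "pdeg s V (Suc n) (\<lambda>k. Aff (f k) (F k))"
proof -
  have "pdeg s V 1 (\<lambda>k. Aff (f k) v)" if v: "v \<in> V" for v
  proof -
    have "(\<lambda>k. Aff (f k) v) = (\<lambda>k. Aff (f 0) v + s (of_int k) (s (f 1 - f 0) v))"
      by (rule ext, subst assms(1)) (simp add: Aff_shift)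
    moreover have "pdeg s V 1 (\<lambda>k. Aff (f 0) v + s (of_int k) (s (f 1 - f 0) v))"
      unfolding One_nat_def
      by (rule pdeg_add[OF pdeg_Suc[OF pdeg_const] pdeg_mult[OF pdeg_const]]) (use v in auto)
    ultimately show ?thesis by (simp only:)
  qed
  from pdeg_apply[OF vector_space_axioms sub Aff_lin this assms(2)] show ?thesis by simp
qed

lemma two_step_exp_list:
  assumes "w \<in> V" "lam \<noteq> 0" shows "exp_list (two_step lam a b n j w)"
  unfolding two_step_def exp_list_simps
  by (intro conjI pfun_dnil[OF vector_space_axioms, of V] pfun_add pfun_scale[OF vector_space_axioms sub]
      pfun_E pfun_E_reflect pfun_Aff pfun_const)
    (auto simp: assms algebra_simps)

lemma two_step_in: "w \<in> V \<Longrightarrow> lam \<noteq> 0 \<Longrightarrow> exp_sum s (two_step lam a b n j w) k \<in> V"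
  by (simp add: two_step_sum[symmetric])

text \<open>At \<open>k = 0\<close> the \<open>\<lambda>\<close>-part of \<open>d\<^sub>-\<^sub>k d\<^sub>k\<close> is a multiple of \<open>D(c - D)\<close>, with \<open>c\<close> depending on the weight;
  if it vanishes on all weight spaces, then so does \<open>D\<close>.\<close>

lemma all_zero_if_exp_part_zero:
  assumes "lam \<noteq> 0" "lam \<noteq> 1" "w \<in> V"
    and "\<And>j w. w \<in> V \<Longrightarrow> exp_part lam (two_step lam a b 0 j w) 0 = 0"
  shows "d i w = 0"
proof (rule all_zero_if_D_zero[OF _ assms(3)])
  fix w assume w: "w \<in> V"
  have z: "d 0 (Aff (a + of_int j) w) = 0" for j
  proof (cases "inverse lam = lam")
    case True
    then have "d 0 (Aff (a + of_int j) w) + d 0 (Aff (a + of_int j) w) = 0"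
      using assms(4)[OF w, of j] assms(2) w by (simp add: two_step_def)
    then have "s 2 (d 0 (Aff (a + of_int j) w)) = 0" using scale_left_distrib[of 1 1] by simp
    then show ?thesis by simp
  next
    case False
    then show ?thesis using assms(4)[OF w, of j] assms(2) w by (simp add: two_step_def)
  qed
  have "d 0 (Aff (a + 1) w) = d 0 (Aff a w) + d 0 w" using w by (simp add: Aff_shift)
  then show "d 0 w = 0" using z[of 0] z[of 1] by simp
qed

text \<open>The third difference removes the quadratic polynomial that accompanies \<open>E (p - k) (E k w)\<close> in the
  term of \<open>d\<^sub>p\<^sub>-\<^sub>k d\<^sub>k\<close> with exponent \<open>1\<close>.\<close>

definition Xop :: "int \<Rightarrow> int \<Rightarrow> 'v \<Rightarrow> 'v" where
  "Xop k p w = (dif ^^ 3) (\<lambda>k. E (p - k) (E k w)) k"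

lemma dif_pow_3: "(dif ^^ 3) F k = F (k + 3) - F (k + 2) - F (k + 2) - F (k + 2) + F (k + 1) + F (k + 1) + F (k + 1) - F k"
  by (simp add: eval_nat_numeral dif_def algebra_simps)

lemma Xop_in [simp]: "w \<in> V \<Longrightarrow> Xop k p w \<in> V"
  unfolding Xop_def by (rule dif_pow_in[OF vector_space_axioms sub]) auto

lemma Xop_lin: "lin_on s V s (Xop k p)"
  by (rule lin_onI)
    (simp_all add: Xop_def dif_pow_3 scale_right_distrib scale_right_diff_distrib algebra_simps)

lemma Xop_pfun:
  assumes "w \<in> V" shows "pfun s V (\<lambda>p. Xop k p w)"
  unfolding Xop_def dif_pow_3
  by (intro pfun_add pfun_diff[OF vector_space_axioms sub] pfun_E_shift) (auto simp: assms)

lemma two_step_cubic: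
  assumes "w \<in> V" "lam \<noteq> 0" "lam \<noteq> 1"
  shows "(dif ^^ 3) (exp_part 1 (two_step lam a b n j w)) k = s (lam powi n) (Xop k n w)"
proof -
  let ?Q = "\<lambda>k. Aff (a + of_int (n - k) * b + of_int (k + j)) (Aff (a + of_int k * b + of_int j) w)"
  have "inverse lam \<noteq> 1" using assms by (metis inverse_inverse_eq inverse_1)
  then have e: "exp_part 1 (two_step lam a b n j w) =
      (\<lambda>k. s (lam powi n) (E (n - k) (E k w)) + ?Q k)"
    using assms by (simp add: two_step_def fun_eq_iff)
  have "pdeg s V (Suc (Suc 0)) ?Q"
    by (intro pdeg_Aff pdeg_const) (auto simp: assms algebra_simps)
  then have "(dif ^^ Suc (Suc (Suc 0))) ?Q = (\<lambda>k. 0)" by (rule dif_pow_pdeg[OF vector_space_axioms])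
  then have "(dif ^^ 3) ?Q = (\<lambda>k. 0)" by (simp only: numeral_3_eq_3)
  moreover have "(dif ^^ 3) (\<lambda>k. s (lam powi n) (E (n - k) (E k w))) =
      (\<lambda>k. s (lam powi n) (Xop k n w))"
    unfolding Xop_def by (rule dif_pow_lin[OF vector_space_axioms subspace_UNIV lin_on_scale_self]) simp
  ultimately show ?thesis unfolding e by (simp add: dif_pow_add)
qed

text \<open>Only graded submodules are tested, because these are carried along by graded isomorphisms.\<close>

definition loop_simple :: "complex \<Rightarrow> complex \<Rightarrow> complex \<Rightarrow> bool" where
  "loop_simple lam a b \<longleftrightarrow> (\<forall>U. (\<forall>j. subspace (U j) \<and> U j \<subseteq> V) \<longrightarrow>
     (\<forall>k j. \<forall>w\<in>U j. Lop lam a b k j w \<in> U (k + j)) \<longrightarrow> (\<forall>j. U j = {0}) \<or> (\<forall>j. U j = V))"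

lemma loop_simpleD:
  assumes "loop_simple lam a b" "\<And>j. subspace (U j)" "\<And>j. U j \<subseteq> V"
    "\<And>k j w. w \<in> U j \<Longrightarrow> Lop lam a b k j w \<in> U (k + j)"
  shows "(\<forall>j. U j = {0}) \<or> (\<forall>j. U j = V)"
  using assms unfolding loop_simple_def by blast

end

context simple_witt_rep
begin

text \<open>For \<open>\<lambda> = 1\<close> the operator \<open>d/dt\<close> cancels from the action, so the vectors killed by all \<open>d i\<close> with
  \<open>i > r\<close> span a submodule.\<close>

lemma not_loop_simple_if_lam_1:
  assumes "loop_simple lam a b" shows "lam \<noteq> 1"
proof
  assume lam: "lam = 1"
  obtain v where v: "v \<in> V" "v \<noteq> 0" using V_nonzero by blast
  then obtain r where r: "r \<ge> 1" "\<And>j. j > r \<Longrightarrow> d j v = 0" using level by metis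
  define U where "U = {w \<in> V. \<forall>i>r. d i w = 0}"
  have sU: "subspace U" unfolding U_def by (intro subspaceI) auto
  have "(\<forall>j::int. U = {0}) \<or> (\<forall>j::int. U = V)"
  proof (rule loop_simpleD[OF assms])
    fix k j w assume w: "w \<in> U"
    then have wV: "w \<in> V" by (simp add: U_def)
    obtain n where n: "\<forall>i\<ge>n. d i w = 0" using d_fin[OF wV] by blast
    have "E k w = (\<Sum>i<Suc n. s (of_int k ^ i) (s (1 / fact i) (d i w)))"
      by (rule E_eq) (use n in auto)
    also have "\<dots> = d 0 w + (\<Sum>i<n. s (of_int k ^ Suc i) (s (1 / fact (Suc i)) (d (Suc i) w)))"
      by (subst sum.lessThan_Suc_shift) simp
    finally have E: "E k w = d 0 w + (\<Sum>i<n. s (of_int k ^ Suc i) (s (1 / fact (Suc i)) (d (Suc i) w)))" .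
    have "d (Suc i) w \<in> U" for i
    proof -
      have "d l (d (Suc i) w) = 0" if "l > r" for l
        using w d_comm[OF wV, of l "Suc i"] that by (simp add: U_def)
      then show ?thesis using wV by (simp add: U_def)
    qed
    then have "(\<Sum>i<n. s (of_int k ^ Suc i) (s (1 / fact (Suc i)) (d (Suc i) w))) \<in> U"
      by (intro subspace_sum[OF sU] subspace_scale[OF sU])
    moreover have "Lop lam a b k j w = (\<Sum>i<n. s (of_int k ^ Suc i) (s (1 / fact (Suc i)) (d (Suc i) w)))
        + s (a + of_int k * b + of_int j) w"
      unfolding Lop_def lam E Aff_def by simp
    ultimately show "Lop lam a b k j w \<in> U"
      using w by (simp only:) (intro subspace_add[OF sU] subspace_scale[OF sU])
  qed (use sU in \<open>auto simp: U_def\<close>)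
  then consider "U = {0}" | "U = V" by blast
  then show False
  proof cases
    case 1 then show ?thesis using v r by (auto simp: U_def)
  next
    case 2
    then have "d i w = 0" if "i \<ge> Suc r" "w \<in> V" for i w
      using that unfolding U_def by (metis (mono_tags, lifting) Suc_le_eq mem_Collect_eq)
    then show ?thesis using all_zero_if_high_zero nontrivial by blast
  qed
qed

text \<open>The relation \<open>E k (c - D) = (c + k - D) E k\<close> shows that the images of \<open>a + j - D\<close> form a submodule
  for \<open>b = 1\<close>.\<close>

lemma not_loop_simple_if_b_1:
  assumes "loop_simple lam a b" shows "b \<noteq> 1"
proof
  assume b: "b = 1"
  define U where "U = (\<lambda>j::int. Aff (a + of_int j) ` V)"
  have "(\<forall>j. U j = {0}) \<or> (\<forall>j. U j = V)"
  proof (rule loop_simpleD[OF assms])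
    show "subspace (U j)" for j unfolding U_def
    proof (rule subspaceI)
      show "0 \<in> Aff (a + of_int j) ` V" using Aff_0 V_0 by (metis image_eqI)
      show "x + y \<in> Aff (a + of_int j) ` V" if "x \<in> Aff (a + of_int j) ` V" "y \<in> Aff (a + of_int j) ` V" for x y
        using that by (auto simp: Aff_add[symmetric] simp del: Aff_add)
      show "s c x \<in> Aff (a + of_int j) ` V" if "x \<in> Aff (a + of_int j) ` V" for c x
        using that by (auto simp: Aff_scale[symmetric] simp del: Aff_scale)
    qed
    show "U j \<subseteq> V" for j by (auto simp: U_def)
    fix k j w assume "w \<in> U j"
    then obtain v where v: "v \<in> V" "w = Aff (a + of_int j) v" by (auto simp: U_def)
    have "Lop lam a b k j w = Aff (a + of_int (k + j)) (s (lam powi k) (E k v) + Aff (a + of_int j) v)"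
      using v by (simp add: Lop_def b E_Aff algebra_simps)
    then show "Lop lam a b k j w \<in> U (k + j)"
      unfolding U_def by (rule image_eqI) (use v in auto)
  qed
  then consider "\<forall>j. U j = {0}" | "U 0 = V" by blast
  then show False
  proof cases
    case 1
    obtain v where v: "v \<in> V" "v \<noteq> 0" using V_nonzero by blast
    have "Aff (a + of_int j) v = 0" for j using 1 v unfolding U_def by blast
    from this[of 0] this[of 1] v show False by (simp add: Aff_shift)
  next
    case 2 then show ?thesis using Aff_not_surj by (auto simp: U_def)
  qed
qed

end

section \<open>Isomorphisms between loop modules\<close>

text \<open>A graded isomorphism \<open>\<phi>\<close> between graded subspaces \<open>U\<close> and \<open>U0\<close> of two loop modules.\<close>

locale graded_map = W: witt_rep s V d + W0: witt_rep t V0 e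
  for s :: "complex \<Rightarrow> 'v::ab_group_add \<Rightarrow> 'v" and V d
    and t :: "complex \<Rightarrow> 'u::ab_group_add \<Rightarrow> 'u" and V0 e +
  fixes lam lam0 a b b0 :: complex and \<phi> :: "int \<Rightarrow> 'v \<Rightarrow> 'u"
    and U :: "int \<Rightarrow> 'v set" and U0 :: "int \<Rightarrow> 'u set"
  assumes lam_nz: "lam \<noteq> 0" and lam0_nz: "lam0 \<noteq> 0"
    and U: "W.subspace (U j)" "U j \<subseteq> V" and U0: "U0 j \<subseteq> V0"
    and Lop_U: "w \<in> U j \<Longrightarrow> W.Lop lam a b k j w \<in> U (k + j)"
    and bij: "bij_betw (\<phi> j) (U j) (U0 j)" and lin: "lin_on s (U j) t (\<phi> j)"
    and inter: "w \<in> U j \<Longrightarrow> \<phi> (k + j) (W.Lop lam a b k j w) = W0.Lop lam0 a b0 k j (\<phi> j w)"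
begin

lemma U_V: "w \<in> U j \<Longrightarrow> w \<in> V"
  using U by blast

lemma phi_in_U0: "w \<in> U j \<Longrightarrow> \<phi> j w \<in> U0 j"
  by (rule bij_betw_apply[OF bij])

lemma phi_in_V0: "w \<in> U j \<Longrightarrow> \<phi> j w \<in> V0"
  using phi_in_U0 U0 by blast

lemma phi_eq_0: "w \<in> U j \<Longrightarrow> \<phi> j w = 0 \<longleftrightarrow> w = 0"
  using lin_on_zero[OF lin W.subspace_0[OF U(1)]]
    inj_on_eq_iff[OF bij_betw_imp_inj_on[OF bij], of w j 0] W.subspace_0[OF U(1)] by simp

lemma phi_surj: "v \<in> U0 j \<Longrightarrow> \<exists>w\<in>U j. v = \<phi> j w"
  using bij[of j] by (auto simp: bij_betw_def)

lemmas phi_add = lin_on_add[OF lin] and phi_scale = lin_on_scale[OF lin]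

lemmas transfer = exp_transfer[OF W.vector_space_axioms U(1) W0.vector_space_axioms lin]

lemma two_step_in_U:
  assumes "w \<in> U j" shows "exp_sum s (W.two_step lam a b n j w) k \<in> U (n + j)"
proof -
  have "W.Lop lam a b (n - k) (k + j) (W.Lop lam a b k j w) \<in> U (n - k + (k + j))"
    by (intro Lop_U assms)
  then show ?thesis using assms lam_nz by (simp add: W.two_step_sum[symmetric] U_V)
qed

lemma two_step_part:
  assumes "w \<in> U j"
  shows "exp_part \<nu> (W.two_step lam a b n j w) k \<in> U (n + j)"
    and "\<phi> (n + j) (exp_part \<nu> (W.two_step lam a b n j w) k) =
    exp_part \<nu> (W0.two_step lam0 a b0 n j (\<phi> j w)) k"
proof -
  have wV: "w \<in> V" and pV: "\<phi> j w \<in> V0" using assms U_V phi_in_V0 by auto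
  have *: "\<phi> (n + j) (exp_sum s (W.two_step lam a b n j w) k) =
      exp_sum t (W0.two_step lam0 a b0 n j (\<phi> j w)) k" for k
  proof -
    have "\<phi> (n + j) (W.Lop lam a b (n - k) (k + j) (W.Lop lam a b k j w)) =
        W0.Lop lam0 a b0 (n - k) (k + j) (W0.Lop lam0 a b0 k j (\<phi> j w))"
      using inter[OF Lop_U[OF assms], of "n - k" k] inter[OF assms, of k]
      by (simp add: algebra_simps)
    then show ?thesis
      using wV pV lam_nz lam0_nz by (simp add: W.two_step_sum[symmetric] W0.two_step_sum[symmetric])
  qed
  note tr = transfer[OF W.two_step_exp_list[OF wV lam_nz] two_step_in_U[OF assms]
    W0.two_step_exp_list[OF pV lam0_nz] *]
  show "exp_part \<nu> (W.two_step lam a b n j w) k \<in> U (n + j)" by (rule tr(1))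
  show "\<phi> (n + j) (exp_part \<nu> (W.two_step lam a b n j w) k) =
    exp_part \<nu> (W0.two_step lam0 a b0 n j (\<phi> j w)) k" by (rule tr(2))
qed

lemma Xop_rel_graded:
  assumes "w \<in> U j" "lam \<noteq> 1" "lam0 \<noteq> 1"
  shows "\<phi> (n + j) (s (lam powi n) (W.Xop k n w)) = t (lam0 powi n) (W0.Xop k n (\<phi> j w))"
proof -
  let ?F = "exp_part 1 (W.two_step lam a b n j w)"
  have "\<phi> (n + j) ((dif ^^ 3) ?F k) = (dif ^^ 3) (\<lambda>k. \<phi> (n + j) (?F k)) k"
    by (simp add: dif_pow_lin[OF W.vector_space_axioms U(1) lin two_step_part(1)[OF assms(1)]])
  also have "(\<lambda>k. \<phi> (n + j) (?F k)) = exp_part 1 (W0.two_step lam0 a b0 n j (\<phi> j w))"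
    by (rule ext) (rule two_step_part(2)[OF assms(1)])
  finally show ?thesis
    using assms lam_nz lam0_nz by (simp add: W.two_step_cubic W0.two_step_cubic U_V phi_in_V0)
qed

end

text \<open>The target may be a proper submodule; this covers the comparison with \<open>\<L>\<^sub>0\<close> and \<open>\<L>\<^sub>1\<close>.\<close>

locale full_source_map = graded_map s V d t V0 e lam lam0 a b b0 \<phi> "\<lambda>_. V" U0 + W: simple_witt_rep s V d
  for s :: "complex \<Rightarrow> 'v::ab_group_add \<Rightarrow> 'v" and V d
    and t :: "complex \<Rightarrow> 'u::ab_group_add \<Rightarrow> 'u" and V0 e lam lam0 a b b0 \<phi> U0 +
  assumes lam_ne_1: "lam \<noteq> 1"
begin

lemmas lam = lam_nz lam_ne_1 and lam0 = lam0_nz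

text \<open>Otherwise the target has no term with exponent \<open>\<lambda>\<close>, so that of the source vanishes.\<close>

lemma lam0_cases: "lam0 = lam \<or> lam0 = inverse lam"
proof (rule ccontr)
  assume *: "\<not> ?thesis"
  then have "inverse lam0 \<noteq> lam" by auto
  then have "exp_part lam (W.two_step lam a b 0 j w) 0 = 0" if w: "w \<in> V" for j w
  proof -
    have "\<phi> j (exp_part lam (W.two_step lam a b 0 j w) 0) = 0"
      using two_step_part(2)[OF w, of 0 j lam 0] * lam(2) \<open>inverse lam0 \<noteq> lam\<close>
      by (simp add: W0.two_step_def)
    then show ?thesis using two_step_part(1)[OF w, of lam 0 j 0] phi_eq_0 by simp
  qed
  then show False using W.all_zero_if_exp_part_zero[OF lam] W.nontrivial by blast
qed

lemma lam0_ne_1: "lam0 \<noteq> 1"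
  using lam0_cases lam by auto

lemmas Xop_rel = Xop_rel_graded[OF _ lam_ne_1 lam0_ne_1]

end

locale loop_map = full_source_map s V d t V0 e lam lam0 a b b0 \<phi> "\<lambda>_. V0" + W0: simple_witt_rep t V0 e
  for s :: "complex \<Rightarrow> 'v::ab_group_add \<Rightarrow> 'v" and V d
    and t :: "complex \<Rightarrow> 'u::ab_group_add \<Rightarrow> 'u" and V0 e lam lam0 a b b0 \<phi>
begin

lemmas phi_in [simp] = phi_in_V0

lemma phi_simps [simp]:
  "u \<in> V \<Longrightarrow> v \<in> V \<Longrightarrow> \<phi> j (u + v) = \<phi> j u + \<phi> j v" "v \<in> V \<Longrightarrow> \<phi> j (s c v) = t c (\<phi> j v)"
  "u \<in> V \<Longrightarrow> v \<in> V \<Longrightarrow> \<phi> j (u - v) = \<phi> j u - \<phi> j v" "\<phi> j 0 = 0"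
  by (rule lin_on_add[OF lin] lin_on_scale[OF lin] lin_on_diff[OF lin] lin_on_zero[OF lin], simp_all)+

lemma Xop_zero_iff:
  "(\<forall>k n. \<forall>w\<in>V. W.Xop k n w = 0) \<longleftrightarrow> (\<forall>k n. \<forall>w\<in>V0. W0.Xop k n w = 0)"
proof -
  have *: "W.Xop k n w = 0 \<longleftrightarrow> W0.Xop k n (\<phi> 0 w) = 0" if "w \<in> V" for k n w
    using Xop_rel[OF that, of n 0 k] that lam lam0 by (simp add: phi_eq_0 del: add_0_right)
      (metis W0.scale_eq_0_iff W.Xop_in phi_eq_0 power_int_not_zero)
  show ?thesis using * phi_surj phi_in by metis
qed

text \<open>A polynomial family of operators of degree \<open>p\<close> in the grading that \<open>\<phi>\<close> matches with a family on the
  other side.  The polynomial dependence on \<open>p\<close> is what allows to separate exponentials again after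
  composing with \<open>d\<^sub>n\<^sub>-\<^sub>p\<close>.\<close>

definition good :: "(int \<Rightarrow> 'v \<Rightarrow> 'v) \<Rightarrow> (int \<Rightarrow> 'u \<Rightarrow> 'u) \<Rightarrow> bool" where
  "good X X0 \<longleftrightarrow> (\<forall>p. lin_on s V s (X p) \<and> lin_on t V0 t (X0 p)) \<and>
    (\<forall>w\<in>V. pfun s V (\<lambda>p. X p w)) \<and> (\<forall>w\<in>V0. pfun t V0 (\<lambda>p. X0 p w)) \<and>
    (\<forall>j p. \<forall>w\<in>V. \<phi> (p + j) (X p w) = X0 p (\<phi> j w))"

text \<open>On both sides \<open>Xop\<close> comes with the factor \<open>\<lambda>\<^sup>p\<close> or \<open>\<lambda>\<^sub>0\<^sup>p\<close>.  In the product of \<open>d\<^sub>n\<^sub>-\<^sub>p\<close> with it the exponent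
  \<open>\<lambda>\<close> belongs to \<open>c - D\<close> applied to \<open>Xop\<close>; if \<open>\<lambda>\<^sub>0 \<noteq> \<lambda>\<close>, this vanishes for two consecutive values of \<open>c\<close>.\<close>

lemma lam0_eq_if_Xop_nonzero:
  assumes w: "w \<in> V" "W.Xop k p w \<noteq> 0" shows "lam0 = lam"
proof (rule ccontr)
  assume ne: "lam0 \<noteq> lam"
  have z: "W.Aff (a + of_int (n - p) * b + of_int (p + j)) (W.Xop k p w) = 0" for n j
  proof -
    define xs where "xs = [(1, \<lambda>p. s (lam powi n) (W.E (n - p) (W.Xop k p w))),
      (lam, \<lambda>p. W.Aff (a + of_int (n - p) * b + of_int (p + j)) (W.Xop k p w))]"
    define ys where "ys = [(1, \<lambda>p. t (lam0 powi n) (W0.E (n - p) (W0.Xop k p (\<phi> j w)))),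
      (lam0, \<lambda>p. W0.Aff (a + of_int (n - p) * b0 + of_int (p + j)) (W0.Xop k p (\<phi> j w)))]"
    have powi: "l powi (n - q) * l powi q = l powi n" if "l \<noteq> 0" for l :: complex and q
      using that by (simp add: power_int_diff)
    have xs_sum: "exp_sum s xs q = W.Lop lam a b (n - q) (q + j) (s (lam powi q) (W.Xop k q w))" for q
      using w(1) lam(1) by (simp add: xs_def W.Lop_def powi)
    have ys_sum: "exp_sum t ys q =
        W0.Lop lam0 a b0 (n - q) (q + j) (t (lam0 powi q) (W0.Xop k q (\<phi> j w)))" for q
      using w(1) lam0(1) by (simp add: ys_def W0.Lop_def powi)
    have "\<phi> (n + j) (exp_part lam xs p) = exp_part lam ys p"
    proof (rule transfer(2))
      show "exp_list xs" unfolding xs_def exp_list_simps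
        by (intro conjI pfun_dnil[OF W.vector_space_axioms, of V] pfun_scale[OF W.vector_space_axioms W.sub]
            W.pfun_E_reflect W.pfun_Aff W.Xop_pfun) (auto simp: w lam algebra_simps)
      show "exp_list ys" unfolding ys_def exp_list_simps
        by (intro conjI pfun_dnil[OF W0.vector_space_axioms, of V0] pfun_scale[OF W0.vector_space_axioms W0.sub]
            W0.pfun_E_reflect W0.pfun_Aff W0.Xop_pfun) (auto simp: w lam0 algebra_simps)
      show "exp_sum s xs q \<in> V" for q using w(1) by (simp add: xs_sum)
      show "\<phi> (n + j) (exp_sum s xs q) = exp_sum t ys q" for q
        using inter[of "s (lam powi q) (W.Xop k q w)" "n - q" "q + j"] Xop_rel[OF w(1), of q j k] w(1)
        by (simp add: xs_sum ys_sum)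
    qed
    then show ?thesis using w(1) ne lam by (simp add: xs_def ys_def phi_eq_0)
  qed
  have "W.Aff (a + of_int (p - p) * b + of_int (p + 1)) (W.Xop k p w) =
      W.Aff (a + of_int (p - p) * b + of_int (p + 0)) (W.Xop k p w) + W.Xop k p w"
    using W.Aff_shift[of "a + of_int (p - p) * b + of_int (p + 0)" 1] by (simp add: algebra_simps)
  then show False using z[of p 1] z[of p 0] w by simp
qed

lemma good_simps:
  assumes "good X X0"
  shows "w \<in> V \<Longrightarrow> \<phi> (p + j) (X p w) = X0 p (\<phi> j w)"
    and "w \<in> V \<Longrightarrow> X p w \<in> V" "v \<in> V0 \<Longrightarrow> X0 p v \<in> V0"
    and "lin_on s V s (X p)" "lin_on t V0 t (X0 p)"
    and "w \<in> V \<Longrightarrow> pfun s V (\<lambda>p. X p w)" "v \<in> V0 \<Longrightarrow> pfun t V0 (\<lambda>p. X0 p v)"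
  using assms pfun_in[OF W.vector_space_axioms W.sub] pfun_in[OF W0.vector_space_axioms W0.sub]
  unfolding good_def by blast+

context
  assumes lam_eq: "lam0 = lam"
begin

lemma good_Xop: "good (W.Xop k) (W0.Xop k)"
  unfolding good_def
proof (intro conjI allI ballI W.Xop_lin W0.Xop_lin W.Xop_pfun W0.Xop_pfun)
  fix j p w assume w: "w \<in> V"
  have "t (lam powi p) (\<phi> (p + j) (W.Xop k p w)) = t (lam powi p) (W0.Xop k p (\<phi> j w))"
    using Xop_rel[OF w, of p j k] w by (simp add: lam_eq)
  then show "\<phi> (p + j) (W.Xop k p w) = W0.Xop k p (\<phi> j w)" using lam by simp
qed

text \<open>The two summands of \<open>d\<^sub>m\<^sub>-\<^sub>j\<^sub>-\<^sub>p\<close> carry the exponents \<open>\<lambda>\<inverse>\<close> and \<open>1\<close> in \<open>p\<close>, so they are matched separately.  In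
  the second one, \<open>m\<close> and \<open>j\<close> are arbitrary: the degree of the operator is no longer tied to \<open>p\<close>.\<close>

lemma good_compose:
  assumes g: "good X X0" and w: "w \<in> V"
  shows "\<phi> m (W.E (m - j - p) (X p w)) = W0.E (m - j - p) (X0 p (\<phi> j w))"
    and "\<phi> m (W.Aff (a + of_int (m - j - p) * b + of_int (p + j)) (X p w)) =
      W0.Aff (a + of_int (m - j - p) * b0 + of_int (p + j)) (X0 p (\<phi> j w))"
proof -
  note gs = good_simps[OF g]
  let ?n = "m - j"
  define xs where "xs = [(inverse lam, \<lambda>p. s (lam powi ?n) (W.E (?n - p) (X p w))),
    (1, \<lambda>p. W.Aff (a + of_int (?n - p) * b + of_int (p + j)) (X p w))]"
  define ys where "ys = [(inverse lam, \<lambda>p. t (lam powi ?n) (W0.E (?n - p) (X0 p (\<phi> j w)))),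
    (1, \<lambda>p. W0.Aff (a + of_int (?n - p) * b0 + of_int (p + j)) (X0 p (\<phi> j w)))]"
  have powi: "inverse lam powi q * lam powi n = lam powi (n - q)" for n q
    using lam(1) by (simp add: power_int_diff power_int_inverse field_simps)
  have xs_sum: "exp_sum s xs q = W.Lop lam a b (?n - q) (q + j) (X q w)" for q
    by (simp add: xs_def W.Lop_def powi)
  have ys_sum: "exp_sum t ys q = W0.Lop lam0 a b0 (?n - q) (q + j) (X0 q (\<phi> j w))" for q
    by (simp add: ys_def W0.Lop_def powi lam_eq)
  have part: "\<phi> m (exp_part \<nu> xs p) = exp_part \<nu> ys p" for \<nu>
  proof (rule transfer(2))
    show "exp_list xs" unfolding xs_def exp_list_simps
      by (intro conjI pfun_dnil[OF W.vector_space_axioms, of V] pfun_scale[OF W.vector_space_axioms W.sub]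
          W.pfun_E_reflect W.pfun_Aff gs(6)) (auto simp: w lam algebra_simps)
    show "exp_list ys" unfolding ys_def exp_list_simps
      by (intro conjI pfun_dnil[OF W0.vector_space_axioms, of V0] pfun_scale[OF W0.vector_space_axioms W0.sub]
          W0.pfun_E_reflect W0.pfun_Aff gs(7)) (auto simp: w lam algebra_simps)
    show "exp_sum s xs q \<in> V" for q using gs(2)[OF w] by (simp add: xs_sum)
    show "\<phi> m (exp_sum s xs q) = exp_sum t ys q" for q
      using inter[OF gs(2)[OF w], of "?n - q" "q + j" q] gs(1)[OF w, of q j]
      by (simp add: xs_sum ys_sum)
  qed
  have inv: "inverse lam \<noteq> 1" using lam by auto
  have "t (lam powi ?n) (\<phi> m (W.E (?n - p) (X p w))) = t (lam powi ?n) (W0.E (?n - p) (X0 p (\<phi> j w)))"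
    using part[of "inverse lam"] inv gs(2)[OF w] by (simp add: xs_def ys_def)
  then show "\<phi> m (W.E (?n - p) (X p w)) = W0.E (?n - p) (X0 p (\<phi> j w))"
    using lam by simp
  show "\<phi> m (W.Aff (a + of_int (?n - p) * b + of_int (p + j)) (X p w)) =
      W0.Aff (a + of_int (?n - p) * b0 + of_int (p + j)) (X0 p (\<phi> j w))"
    using part[of 1] inv by (simp add: xs_def ys_def)
qed

text \<open>Precompose the second relation with \<open>d\<^sub>l\<close>.  The term with exponent \<open>1\<close> is quadratic in \<open>l\<close>, and these are
  its coefficients at \<open>l\<^sup>2\<close> and \<open>l\<close>.\<close>

lemma good_quadratic:
  fixes m j p :: int
  assumes g: "good X X0" and w: "w \<in> V"
  defines "u \<equiv> a + of_int (m - j - p) * b + of_int (p + j)"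
    and "u0 \<equiv> a + of_int (m - j - p) * b0 + of_int (p + j)"
  shows "t (b * (1 - b)) (\<phi> m (X p w)) = t (b0 * (1 - b0)) (X0 p (\<phi> j w))"
    and "\<phi> m (s (1 - b) (X p (W.Aff (a + of_int j) w)) + s b (W.Aff u (X p w))) =
      t (1 - b0) (X0 p (W0.Aff (a + of_int j) (\<phi> j w))) + t b0 (W0.Aff u0 (X0 p (\<phi> j w)))"
proof -
  note gs = good_simps[OF g]
  note Xl = lin_on_add[OF gs(4)] lin_on_scale[OF gs(4)] lin_on_add[OF gs(5)] lin_on_scale[OF gs(5)]
    gs(2,3)
  define A where "A = (\<lambda>l. W.Aff (a + of_int (m - (l + j) - p) * b + of_int (p + (l + j))))"
  define A0 where "A0 = (\<lambda>l. W0.Aff (a + of_int (m - (l + j) - p) * b0 + of_int (p + (l + j))))"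
  define xs where "xs = [(lam, \<lambda>l. A l (X p (W.E l w))),
    (1, \<lambda>l. A l (X p (W.Aff (a + of_int l * b + of_int j) w)))]"
  define ys where "ys = [(lam, \<lambda>l. A0 l (X0 p (W0.E l (\<phi> j w)))),
    (1, \<lambda>l. A0 l (X0 p (W0.Aff (a + of_int l * b0 + of_int j) (\<phi> j w))))]"
  have xs_sum: "exp_sum s xs l = A l (X p (W.Lop lam a b l j w))" for l
    using w by (simp add: xs_def A_def W.Lop_def Xl)
  have ys_sum: "exp_sum t ys l = A0 l (X0 p (W0.Lop lam0 a b0 l j (\<phi> j w)))" for l
    using w by (simp add: ys_def A0_def W0.Lop_def lam_eq Xl)
  have part: "\<phi> m (exp_part 1 xs l) = exp_part 1 ys l" for l
  proof (rule transfer(2))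
    show "exp_list xs" unfolding xs_def exp_list_simps A_def
      by (intro conjI pfun_dnil[OF W.vector_space_axioms, of V] W.pfun_Aff
          pfun_lin[OF W.vector_space_axioms W.sub gs(4)] W.E_pfun pfun_const gs(2))
        (auto simp: w lam algebra_simps)
    show "exp_list ys" unfolding ys_def exp_list_simps A0_def
      by (intro conjI pfun_dnil[OF W0.vector_space_axioms, of V0] W0.pfun_Aff
          pfun_lin[OF W0.vector_space_axioms W0.sub gs(5)] W0.E_pfun pfun_const gs(3))
        (auto simp: w lam algebra_simps)
    show "exp_sum s xs l \<in> V" for l using w by (simp add: xs_sum A_def Xl)
    show "\<phi> m (exp_sum s xs l) = exp_sum t ys l" for l
      using good_compose(2)[OF g W.Lop_in[OF w], of m "l + j" p lam a b l j] inter[OF w, of l j]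
      by (simp add: xs_sum ys_sum A_def A0_def)
  qed
  let ?y = "X p w" and ?z = "X p (W.Aff (a + of_int j) w)"
  let ?yy = "X0 p (\<phi> j w)" and ?zz = "X0 p (W0.Aff (a + of_int j) (\<phi> j w))"
  have yz: "?y \<in> V" "?z \<in> V" "?yy \<in> V0" "?zz \<in> V0" using w by (simp_all add: Xl)
  have expand: "A l (X p (W.Aff (a + of_int l * b + of_int j) w)) =
      W.Aff u ?z + s (of_int l) (s (1 - b) ?z + s b (W.Aff u ?y)) + s (of_int l ^ 2) (s (b * (1 - b)) ?y)" for l
  proof -
    have 1: "W.Aff (a + of_int l * b + of_int j) w = W.Aff (a + of_int j) w + s (of_int l * b) w"
      using W.Aff_shift[of "a + of_int j" "of_int l * b" w] by (simp add: algebra_simps)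
    have 2: "A l v = W.Aff u v + s (of_int l * (1 - b)) v" for v
      unfolding A_def W.Aff_shift[symmetric] u_def by (simp add: algebra_simps)
    show ?thesis unfolding 1 2 using w yz
      by (simp add: Xl W.scale_right_distrib W.scale_right_diff_distrib power2_eq_square algebra_simps)
  qed
  have expand0: "A0 l (X0 p (W0.Aff (a + of_int l * b0 + of_int j) (\<phi> j w))) =
      W0.Aff u0 ?zz + t (of_int l) (t (1 - b0) ?zz + t b0 (W0.Aff u0 ?yy)) +
      t (of_int l ^ 2) (t (b0 * (1 - b0)) ?yy)" for l
  proof -
    have 1: "W0.Aff (a + of_int l * b0 + of_int j) v = W0.Aff (a + of_int j) v + t (of_int l * b0) v" for v
      using W0.Aff_shift[of "a + of_int j" "of_int l * b0" v] by (simp add: algebra_simps)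
    have 2: "A0 l v = W0.Aff u0 v + t (of_int l * (1 - b0)) v" for v
      unfolding A0_def W0.Aff_shift[symmetric] u0_def by (simp add: algebra_simps)
    show ?thesis unfolding 1 2 using w yz
      by (simp add: Xl W0.scale_right_distrib W0.scale_right_diff_distrib power2_eq_square algebra_simps)
  qed
  have "(\<phi> m (W.Aff u ?z) - W0.Aff u0 ?zz) +
     t (of_int l) (\<phi> m (s (1 - b) ?z + s b (W.Aff u ?y)) - (t (1 - b0) ?zz + t b0 (W0.Aff u0 ?yy))) +
     t (of_int l ^ 2) (t (b * (1 - b)) (\<phi> m ?y) - t (b0 * (1 - b0)) ?yy) = 0" for l
  proof -
    have "\<phi> m (W.Aff u ?z + s (of_int l) (s (1 - b) ?z + s b (W.Aff u ?y)) + s (of_int l ^ 2) (s (b * (1 - b)) ?y)) =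
      W0.Aff u0 ?zz + t (of_int l) (t (1 - b0) ?zz + t b0 (W0.Aff u0 ?yy)) +
      t (of_int l ^ 2) (t (b0 * (1 - b0)) ?yy)"
      unfolding expand[symmetric] expand0[symmetric]
      using part[of l] lam(2) by (simp add: xs_def ys_def)
    moreover have "\<phi> m (W.Aff u ?z + s (of_int l) (s (1 - b) ?z + s b (W.Aff u ?y)) + s (of_int l ^ 2) (s (b * (1 - b)) ?y)) =
      \<phi> m (W.Aff u ?z) + t (of_int l) (\<phi> m (s (1 - b) ?z + s b (W.Aff u ?y))) + t (of_int l ^ 2) (t (b * (1 - b)) (\<phi> m ?y))"
      using yz by (simp del: W.scale_scale W0.scale_scale)
    ultimately show ?thesis
      by (simp only: W0.scale_right_diff_distrib) (simp add: algebra_simps del: W0.scale_scale)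
  qed
  note q = quadratic_eq_zero[OF W0.vector_space_axioms this]
  show "t (b * (1 - b)) (\<phi> m (X p w)) = t (b0 * (1 - b0)) (X0 p (\<phi> j w))" using q(3) by simp
  show "\<phi> m (s (1 - b) ?z + s b (W.Aff u ?y)) = t (1 - b0) ?zz + t b0 (W0.Aff u0 ?yy)"
    using q(2) by simp
qed

text \<open>The first relation of lemma \<open>good_compose\<close> says that composition with \<open>E\<close> stays within the matched
  families; the index shifts because \<open>E (q - p)\<close> is attributed the degree \<open>q - p\<close>.\<close>

lemma good_step:
  assumes g: "good X X0"
  shows "good (\<lambda>q v. W.E (q - p) (X p v)) (\<lambda>q v. W0.E (q - p) (X0 p v))"
  unfolding good_def
proof (intro conjI allI ballI)
  note gs = good_simps[OF g]
  show "lin_on s V s (\<lambda>v. W.E (q - p) (X p v))" for q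
    by (rule lin_onI) (simp_all add: lin_on_add[OF gs(4)] lin_on_scale[OF gs(4)] gs(2))
  show "lin_on t V0 t (\<lambda>v. W0.E (q - p) (X0 p v))" for q
    by (rule lin_onI) (simp_all add: lin_on_add[OF gs(5)] lin_on_scale[OF gs(5)] gs(3))
  show "pfun s V (\<lambda>q. W.E (q - p) (X p w))" if "w \<in> V" for w
    by (rule W.pfun_E_shift[OF gs(2)[OF that]])
  show "pfun t V0 (\<lambda>q. W0.E (q - p) (X0 p w))" if "w \<in> V0" for w
    by (rule W0.pfun_E_shift[OF gs(3)[OF that]])
  show "\<phi> (q + j) (W.E (q - p) (X p w)) = W0.E (q - p) (X0 p (\<phi> j w))" if "w \<in> V" for j q w
    using good_compose(1)[OF g that, of "q + j" j p] by simp
qed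

lemma good_word:
  assumes g: "good X X0"
  shows "\<exists>Y Y0 q. good Y Y0 \<and> (\<forall>w. Y q w = foldr W.E ks (X p w)) \<and>
    (\<forall>w. Y0 q w = foldr W0.E ks (X0 p w))"
proof (induction ks)
  case Nil
  show ?case using g by auto
next
  case (Cons k ks)
  then obtain Y Y0 q where Y: "good Y Y0" "\<forall>w. Y q w = foldr W.E ks (X p w)"
    "\<forall>w. Y0 q w = foldr W0.E ks (X0 p w)" by blast
  show ?case
    by (rule exI[of _ "\<lambda>r v. W.E (r - q) (Y q v)"], rule exI[of _ "\<lambda>r v. W0.E (r - q) (Y0 q v)"],
        rule exI[of _ "k + q"]) (use good_step[OF Y(1), of q] Y in simp)
qed

lemma foldr_E_in [simp]: "w \<in> V \<Longrightarrow> foldr W.E ks w \<in> V"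
  by (induction ks) auto

lemma foldr_E_lin: "lin_on s V s (foldr W.E ks)"
proof (rule lin_onI)
  show "foldr W.E ks (u + v) = foldr W.E ks u + foldr W.E ks v" if "u \<in> V" "v \<in> V" for u v
    using that by (induction ks) auto
  show "foldr W.E ks (s c v) = s c (foldr W.E ks v)" if "v \<in> V" for c v
    using that by (induction ks) auto
qed

lemma foldr_E0_in [simp]: "w \<in> V0 \<Longrightarrow> foldr W0.E ks w \<in> V0"
  by (induction ks) auto

lemma foldr_E0_lin: "lin_on t V0 t (foldr W0.E ks)"
proof (rule lin_onI)
  show "foldr W0.E ks (u + v) = foldr W0.E ks u + foldr W0.E ks v" if "u \<in> V0" "v \<in> V0" for u v
    using that by (induction ks) auto
  show "foldr W0.E ks (t c v) = t c (foldr W0.E ks v)" if "v \<in> V0" for c v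
    using that by (induction ks) auto
qed

text \<open>The vectors on which \<open>\<phi> m\<close> commutes with all words in the \<open>E k\<close> form a submodule, and closure of good
  families under left multiplication puts \<open>X p z\<close> into it.\<close>

lemma phi_hom_if_good:
  assumes z: "z \<in> V" "z0 \<in> V0"
    and rel: "\<And>Y Y0 q. good Y Y0 \<Longrightarrow> \<phi> m (Y q z) = t r (Y0 q z0)"
    and g: "good X X0" and nz: "X p z \<noteq> 0" and x: "x \<in> V"
  shows "\<phi> m (W.E k x) = W0.E k (\<phi> m x)"
proof -
  define S where "S = {x \<in> V. \<forall>ks. \<phi> m (foldr W.E ks x) = foldr W0.E ks (\<phi> m x)}"
  have lins: "lin_on s V t (\<lambda>x. \<phi> m (foldr W.E ks x))" "lin_on s V t (\<lambda>x. foldr W0.E ks (\<phi> m x))" for ks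
    by (auto intro!: lin_onI simp: lin_on_add[OF foldr_E_lin] lin_on_scale[OF foldr_E_lin]
        lin_on_add[OF foldr_E0_lin] lin_on_scale[OF foldr_E0_lin])
  have sS: "W.subspace S"
  proof (rule W.subspaceI)
    show "0 \<in> S"
      using lin_on_zero[OF lins(1)] lin_on_zero[OF lins(2)] by (simp add: S_def)
    show "u + v \<in> S" if "u \<in> S" "v \<in> S" for u v
      using that by (simp add: S_def lin_on_add[OF foldr_E_lin] lin_on_add[OF foldr_E0_lin])
    show "s c v \<in> S" if "v \<in> S" for c v
      using that by (simp add: S_def lin_on_scale[OF foldr_E_lin] lin_on_scale[OF foldr_E0_lin])
  qed
  have ES: "W.E k v \<in> S" if v: "v \<in> S" for k v
  proof -
    have "\<phi> m (foldr W.E ks (W.E k v)) = foldr W0.E ks (\<phi> m (W.E k v))" for ks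
    proof -
      have "\<phi> m (foldr W.E (ks @ [k]) v) = foldr W0.E (ks @ [k]) (\<phi> m v)"
        "\<phi> m (foldr W.E [k] v) = foldr W0.E [k] (\<phi> m v)"
        using v unfolding S_def by blast+
      then show ?thesis by simp
    qed
    then show ?thesis using v by (simp add: S_def)
  qed
  have "W.stable S" unfolding W.stable_def
  proof (intro conjI allI ballI sS)
    show "S \<subseteq> V" by (auto simp: S_def)
    show "d i v \<in> S" if "v \<in> S" for i v
      using that ES by (intro W.d_in_of_E[OF _ sS]) (auto simp: S_def)
  qed
  moreover have "X p z \<in> S"
  proof -
    have "\<phi> m (foldr W.E ks (X p z)) = foldr W0.E ks (\<phi> m (X p z))" for ks
    proof -
      obtain Y Y0 q where Y: "good Y Y0" "\<forall>w. Y q w = foldr W.E ks (X p w)"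
        "\<forall>w. Y0 q w = foldr W0.E ks (X0 p w)" using good_word[OF g] by blast
      have "\<phi> m (foldr W.E ks (X p z)) = t r (foldr W0.E ks (X0 p z0))"
        using rel[OF Y(1), of q] Y by simp
      also have "\<dots> = foldr W0.E ks (t r (X0 p z0))"
        using z good_simps(3)[OF g] by (simp add: lin_on_scale[OF foldr_E0_lin])
      finally show ?thesis using rel[OF g, of p] by simp
    qed
    then show ?thesis using z good_simps(2)[OF g] by (simp add: S_def)
  qed
  ultimately have "S = V" using W.stable_eq_V nz by blast
  then have "\<phi> m (foldr W.E [k] x) = foldr W0.E [k] (\<phi> m x)" using x unfolding S_def by blast
  then show ?thesis by simp
qed

text \<open>For \<open>b (1 - b) \<noteq> 0\<close> the coefficient at \<open>l\<^sup>2\<close> makes \<open>\<phi> m\<close> respect all good families up to a scalar, which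
  is \<open>1\<close> since \<open>Xop\<close> is a combination of words.  For \<open>b = 0\<close> that coefficient gives \<open>b\<^sub>0 = 0\<close>, and the one at
  \<open>l\<close> takes its place, with \<open>z\<close> in the image of \<open>a + j - D\<close>.\<close>

lemma hom_and_b_eq:
  assumes w: "w \<in> V" "W.Xop k p w \<noteq> 0" and b: "b \<noteq> 1" "b0 \<noteq> 1"
  shows "b = b0 \<and> (\<exists>m. \<forall>l. \<forall>x\<in>V. \<phi> m (W.E l x) = W0.E l (\<phi> m x))"
proof -
  have gX: "good (W.Xop k) (W0.Xop k)" by (rule good_Xop)
  have ne: "W0.Xop k p (\<phi> j w) \<noteq> 0" for j
    using good_simps(1)[OF gX w(1), of p j] w phi_eq_0 by (metis W.Xop_in)
  show ?thesis
  proof (cases "b = 0")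
    case True
    have "t (b0 * (1 - b0)) (W0.Xop k p (\<phi> 0 w)) = 0"
      using good_quadratic(1)[OF gX w(1), of 0 p 0] True by simp
    then have b0: "b0 = 0" using ne b by simp
    have "W.Xop k p (W.Aff (a + of_int 1) w) = W.Xop k p (W.Aff (a + of_int 0) w) + W.Xop k p w"
      using w by (simp add: W.Aff_shift lin_on_add[OF W.Xop_lin])
    then obtain j where j: "W.Xop k p (W.Aff (a + of_int j) w) \<noteq> 0" using w(2) by (metis add_0)
    have "\<phi> 0 (W.E l x) = W0.E l (\<phi> 0 x)" if "x \<in> V" for l x
    proof (rule phi_hom_if_good[OF _ _ _ gX j that])
      show "\<phi> 0 (Y q (W.Aff (a + of_int j) w)) = t 1 (Y0 q (W0.Aff (a + of_int j) (\<phi> j w)))"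
        if "good Y Y0" for Y Y0 q
        using good_quadratic(2)[OF that w(1), of 0 q j] True b0 w by simp
    qed (use w in auto)
    then show ?thesis using True b0 by blast
  next
    case False
    \<comment> \<open>the factor by which the coefficients at \<open>l\<^sup>2\<close> differ\<close>
    define r where "r = b0 * (1 - b0) / (b * (1 - b))"
    have bb: "b * (1 - b) \<noteq> 0" using False b by simp
    have rel: "\<phi> m (Y q w) = t r (Y0 q (\<phi> j w))" if "good Y Y0" for Y Y0 q m j
    proof -
      have "t (inverse (b * (1 - b))) (t (b * (1 - b)) (\<phi> m (Y q w))) =
          t (inverse (b * (1 - b))) (t (b0 * (1 - b0)) (Y0 q (\<phi> j w)))"
        using good_quadratic(1)[OF that w(1), of m q j] by simp
      moreover have "inverse (b * (1 - b)) * (b * (1 - b)) = 1" by (rule left_inverse[OF bb])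
      moreover have "inverse (b * (1 - b)) * (b0 * (1 - b0)) = r"
        unfolding r_def divide_inverse by (rule mult.commute)
      ultimately show ?thesis by (simp only: W0.scale_scale W0.scale_one)
    qed
    have hom: "\<phi> m (W.E l x) = W0.E l (\<phi> m x)" if "x \<in> V" for l x m
      by (rule phi_hom_if_good[OF w(1) phi_in[OF w(1), of 0] _ gX w(2) that]) (rule rel)
    have homD: "\<phi> m (d 0 x) = e 0 (\<phi> m x)" if "x \<in> V" for x m
      using hom[OF that, of m 0] that by simp
    have homX: "\<phi> m (W.Xop k p w) = W0.Xop k p (\<phi> m w)" for m
      using w(1) by (simp add: W.Xop_def W0.Xop_def W.dif_pow_3 W0.dif_pow_3 hom)
    have "t r (W0.Xop k p (\<phi> 0 w)) = t 1 (W0.Xop k p (\<phi> 0 w))"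
      using rel[OF gX, of 0 p 0] homX by simp
    then have "r = 1" using ne by (metis W0.scale_cancel_right)
    \<comment> \<open>with \<open>m - p = 1\<close> the coefficient of \<open>b\<close> in the relation for \<open>c - D\<close> is \<open>1\<close>\<close>
    define m where "m = p + 1"
    let ?x = "W.Xop k p w"
    have x: "?x \<in> V" "?x \<noteq> 0" using w by auto
    have 1: "W0.Xop k p (\<phi> 0 w) = \<phi> m ?x" using rel[OF gX, of m p 0] \<open>r = 1\<close> by simp
    have "\<phi> m (W.Aff (a + b + of_int p) ?x) = W0.Aff (a + b0 + of_int p) (\<phi> m ?x)"
      using good_compose(2)[OF gX w(1), of m 0 p] unfolding 1 by (simp add: m_def)
    moreover have "\<phi> m (W.Aff (a + b + of_int p) ?x) = W0.Aff (a + b + of_int p) (\<phi> m ?x)"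
      using x homD by (simp add: W.Aff_def W0.Aff_def)
    ultimately have "t (a + b + of_int p) (\<phi> m ?x) = t (a + b0 + of_int p) (\<phi> m ?x)"
      by (simp add: W0.Aff_def)
    then have "b = b0" using x phi_eq_0[OF x(1)] by simp
    then show ?thesis using hom by blast
  qed
qed

end

text \<open>Comparison of coefficients in \<open>k\<close> turns a map that commutes with all \<open>E k\<close> into one that commutes with all \<open>d i\<close>.\<close>

lemma parameters_eq_if_Xop_nonzero:
  assumes "w \<in> V" "W.Xop k p w \<noteq> 0" "b \<noteq> 1" "b0 \<noteq> 1"
  shows "lam0 = lam" "b = b0"
    "\<exists>f. bij_betw f V V0 \<and> lin_on s V t f \<and> (\<forall>i. \<forall>x\<in>V. f (d i x) = e i (f x))"
proof -
  show *: "lam0 = lam" by (rule lam0_eq_if_Xop_nonzero[OF assms(1,2)])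
  show "b = b0" using hom_and_b_eq[OF * assms] by blast
  obtain m where m: "\<And>l x. x \<in> V \<Longrightarrow> \<phi> m (W.E l x) = W0.E l (\<phi> m x)"
    using hom_and_b_eq[OF * assms] by blast
  have "\<phi> m (d i x) = e i (\<phi> m x)" if x: "x \<in> V" for i x
  proof -
    obtain n n' where n: "\<forall>i\<ge>n. d i x = 0" "\<forall>i\<ge>n'. e i (\<phi> m x) = 0"
      using W.d_fin[OF x] W0.d_fin[OF phi_in[OF x]] by blast
    define N where "N = max (max n n') (Suc i)"
    let ?c = "\<lambda>i. t (1 / fact i) (\<phi> m (d i x) - e i (\<phi> m x))"
    have E: "W.E l x = (\<Sum>i<N. s (of_int l ^ i) (s (1 / fact i) (d i x)))" for l
      by (rule W.E_eq) (use n in \<open>simp add: N_def\<close>)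
    have E0: "W0.E l (\<phi> m x) = (\<Sum>i<N. t (of_int l ^ i) (t (1 / fact i) (e i (\<phi> m x))))" for l
      by (rule W0.E_eq) (use n in \<open>simp add: N_def\<close>)
    have "\<phi> m (W.E l x) = (\<Sum>i<N. t (of_int l ^ i) (t (1 / fact i) (\<phi> m (d i x))))" for l
      unfolding E by (subst lin_on_sum[OF W.vector_space_axioms W.sub lin])
        (simp_all add: x del: W0.scale_scale W.scale_scale)
    then have "0 = (\<Sum>i<N. t (of_int l ^ i) (?c i))" for l
      using m[OF x, of l] unfolding E0
      by (simp add: W0.scale_right_diff_distrib sum_subtractf del: W0.scale_scale)
    then have "?c i \<in> {0}"
      by (rule poly_coeff_in_subspace[OF W0.vector_space_axioms W0.subspace_single_0, where M = 0])
        (auto simp: N_def)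
    then show ?thesis by simp
  qed
  then show "\<exists>f. bij_betw f V V0 \<and> lin_on s V t f \<and> (\<forall>i. \<forall>x\<in>V. f (d i x) = e i (f x))"
    using bij lin by blast
qed

end

section \<open>Modules in the category \<open>\<O>\<close> and the Verma modules\<close>

lemma cvec_smult: "cvec (smult :: complex \<Rightarrow> complex poly \<Rightarrow> complex poly)"
  by (rule cvec.intro, unfold_locales) (simp_all add: smult_add_right smult_add_left)

interpretation poly_vs: cvec "smult :: complex \<Rightarrow> complex poly \<Rightarrow> complex poly"
  by (rule cvec_smult)

abbreviation wact :: "(complex poly, 'v) rep \<Rightarrow> nat \<Rightarrow> 'v \<Rightarrow> 'v" where
  "wact W i \<equiv> rep_act W (monom 1 i)"

lemma witt_bracket_monom:
  "lie_bracket witt (monom 1 i) (monom 1 j) = smult (of_int (int j - int i)) (monom 1 (i + j - 1))"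
  by (cases i; cases j) (auto simp: witt_def pderiv_monom mult_monom smult_monom diff_monom minus_monom add.commute)

lemma witt_d_monom: "witt_d (int i - 1) = monom 1 i"
  by (simp add: witt_d_def)

lemma witt_pre_if_module:
  assumes "lie_module witt W"
  shows "witt_pre (rep_scale W) (rep_carrier W) (wact W)"
proof -
  interpret cvec "rep_scale W" using assms by (intro cvec.intro) (simp add: lie_module_def)
  show ?thesis
  proof
    show "subspace (rep_carrier W)" using assms by (simp add: lie_module_def)
    show "lin_on (rep_scale W) (rep_carrier W) (rep_scale W) (wact W i)" for i
      using assms by (intro lin_onI) (auto simp: lie_module_def witt_def)
    fix w i j assume w: "w \<in> rep_carrier W"
    show "wact W i w \<in> rep_carrier W" using assms w by (auto simp: lie_module_def witt_def)
    have "rep_act W (lie_bracket witt (monom 1 i) (monom 1 j)) w = wact W i (wact W j w) - wact W j (wact W i w)"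
      using assms w by (simp add: lie_module_def witt_def)
    moreover have "rep_act W (smult c p) w = rep_scale W c (rep_act W p w)" for c p
      using assms w by (simp add: lie_module_def witt_def)
    ultimately show "wact W i (wact W j w) - wact W j (wact W i w) =
        rep_scale W (of_int (int j - int i)) (wact W (i + j - 1) w)"
      by (simp add: witt_bracket_monom)
  qed
qed

lemma act_monoms:
  assumes "lie_module witt W" "w \<in> rep_carrier W"
  shows "rep_act W p w = (\<Sum>i\<le>degree p. rep_scale W (coeff p i) (wact W i w))"
proof -
  have add: "rep_act W (p + q) w = rep_act W p w + rep_act W q w" for p q
    using assms by (simp add: lie_module_def witt_def)
  have scale: "rep_act W (smult c p) w = rep_scale W c (rep_act W p w)" for c p
    using assms by (simp add: lie_module_def witt_def)
  have zero: "rep_act W 0 w = 0" using add[of 0 0] by simp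
  have sum: "rep_act W (\<Sum>i\<in>I. f i) w = (\<Sum>i\<in>I. rep_act W (f i) w)" for I and f :: "nat \<Rightarrow> complex poly"
    by (induction I rule: infinite_finite_induct) (auto simp: add zero)
  have "rep_act W p w = rep_act W (\<Sum>i\<le>degree p. smult (coeff p i) (monom 1 i)) w"
    by (simp add: smult_monom poly_as_sum_of_monoms)
  then show ?thesis by (simp add: sum scale)
qed

lemma submodule_iff_stable:
  assumes "lie_module witt W"
  shows "submodule witt W S \<longleftrightarrow> witt_pre.stable (rep_scale W) (rep_carrier W) (wact W) S"
proof -
  interpret W: witt_pre "rep_scale W" "rep_carrier W" "wact W" by (rule witt_pre_if_module[OF assms])
  have "rep_act W p w \<in> S" if "W.stable S" "w \<in> S" for p w
  proof -
    have "w \<in> rep_carrier W" "W.subspace S" using that by (auto simp: W.stable_def)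
    then show ?thesis using that unfolding W.stable_def
      by (subst act_monoms[OF assms]) (auto intro!: W.subspace_sum W.subspace_scale)
  qed
  then show ?thesis unfolding submodule_def W.stable_def by (auto simp: witt_def)
qed

lemma witt_rep_if_category_O:
  assumes "category_O witt W"
  shows "witt_rep (rep_scale W) (rep_carrier W) (wact W)"
proof -
  interpret W: witt_pre "rep_scale W" "rep_carrier W" "wact W"
    by (rule witt_pre_if_module) (use assms in \<open>simp add: category_O_def\<close>)
  show ?thesis
  proof
    fix w assume "w \<in> rep_carrier W"
    then obtain n :: nat where n: "\<forall>i\<ge>int n. rep_act W (witt_d i) w = 0"
      using assms by (auto simp: category_O_def)
    have "wact W i w = 0" if "i \<ge> Suc n" for i
      using n[rule_format, of "int i - 1"] that by (simp add: witt_d_monom)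
    then show "\<exists>n. \<forall>i\<ge>n. wact W i w = 0" by blast
  qed
qed

lemma simple_witt_rep_if_simple_module:
  assumes "category_O witt W" "simple_module witt W" "\<not> trivial_module witt W"
  shows "simple_witt_rep (rep_scale W) (rep_carrier W) (wact W)"
proof -
  interpret W: witt_rep "rep_scale W" "rep_carrier W" "wact W"
    by (rule witt_rep_if_category_O[OF assms(1)])
  have mod: "lie_module witt W" using assms(1) by (simp add: category_O_def)
  show ?thesis
  proof
    show "U = {0} \<or> U = rep_carrier W" if "W.stable U" for U
      using assms(2) that submodule_iff_stable[OF mod] by (auto simp: simple_module_def)
    show "\<exists>i. \<exists>w\<in>rep_carrier W. wact W i w \<noteq> 0"
    proof (rule ccontr)
      assume "\<not> ?thesis"
      then have "rep_act W p w = 0" if "w \<in> rep_carrier W" for p w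
        using that by (subst act_monoms[OF mod]) auto
      then show False using assms(3) by (simp add: trivial_module_def)
    qed
  qed
qed

subsection \<open>Verma modules\<close>

abbreviation vact :: "complex \<Rightarrow> nat \<Rightarrow> complex poly \<Rightarrow> complex poly" where
  "vact c \<equiv> wact (verma c)"

lemma vact_eq: "vact c i v = [:0, 1:] * diff_op (monom 1 i) v + smult (c * of_nat i) (diff_op (monom 1 (i - 1)) v)"
proof -
  have "pderiv (monom 1 i) = smult (of_nat i) (monom (1 :: complex) (i - 1))"
    by (simp add: pderiv_monom smult_monom)
  then show ?thesis by (simp add: verma_def diff_op_smult_left)
qed

lemma diff_op_monom_0: "degree v < i \<Longrightarrow> diff_op (monom 1 i) v = 0"
proof (induction i arbitrary: v)
  case (Suc i)
  have e: "diff_op (monom 1 (Suc i)) v = diff_op (monom 1 i) (- pderiv v)"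
    by (simp add: monom_Suc diff_op_pCons)
  show ?case
  proof (cases "degree v = 0")
    case True
    then have "pderiv v = 0" by (simp add: pderiv_eq_0_iff)
    then show ?thesis unfolding e using diff_op_smult_right[of _ 0 0] by simp
  next
    case False
    then show ?thesis unfolding e using Suc.prems by (intro Suc.IH) (simp add: degree_pderiv)
  qed
qed simp

lemma verma_simps [simp]: "rep_scale (verma c) = smult" "rep_carrier (verma c) = UNIV"
  by (simp_all add: verma_def)

interpretation verma: witt_rep "smult :: complex \<Rightarrow> complex poly \<Rightarrow> complex poly" UNIV "vact c" for c
proof -
  interpret verma: witt_pre "smult :: complex \<Rightarrow> complex poly \<Rightarrow> complex poly" UNIV "vact c"
    using witt_pre_if_module[OF lie_module_verma] by simp
  show "witt_rep (smult :: complex \<Rightarrow> complex poly \<Rightarrow> complex poly) UNIV (vact c)"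
  proof
    fix w :: "complex poly"
    show "\<exists>n. \<forall>i\<ge>n. vact c i w = 0"
      by (rule exI[of _ "degree w + 2"]) (auto simp: vact_eq diff_op_monom_0)
  qed
qed

lemma diff_op_1 [simp]: "diff_op 1 v = v"
  by (simp add: diff_op_def)

lemma vact_0: "vact c 0 v = [:0, 1:] * v"
  unfolding vact_eq by (simp add: monom_0 flip: one_pCons)

lemma vact_0_one [simp]:
  "rep_act (verma c) 1 v = [:0, 1:] * v" "rep_act (verma c) [:1:] v = [:0, 1:] * v"
  using vact_0[of c v] by (simp_all add: monom_0 one_pCons)

lemma vact_1_const: "vact c 1 [:e:] = [:c * e:]"
  unfolding vact_eq by (simp add: diff_op_monom_0 monom_0 mult.commute flip: one_pCons)

lemma vact_const: "i \<ge> 2 \<Longrightarrow> vact c i [:e:] = 0"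
  unfolding vact_eq by (simp add: diff_op_monom_0)

text \<open>Both sides send \<open>1\<close> to \<open>x + c k\<close> and have the same commutator with the multiplication by \<open>x\<close>, which is
  the action of \<open>d/dt\<close>.\<close>

lemma verma_E: "verma.E c k v = [:c * of_int k, 1:] * pcompose v [:- of_int k, 1:]"
proof (induction v)
  case (pCons a v)
  have "verma.E c k 1 = (\<Sum>i<2. smult (of_int k ^ i) (smult (1 / fact i) (vact c i 1)))"
    using vact_const[of _ c 1] by (intro verma.E_eq) (simp add: one_pCons)
  then have 1: "verma.E c k 1 = [:c * of_int k, 1:]"
    using vact_1_const[of c 1] by (simp add: eval_nat_numeral vact_0 one_pCons mult.commute)
  have "pCons a v = smult a 1 + vact c 0 v" by (simp add: vact_0)
  then have "verma.E c k (pCons a v) = smult a (verma.E c k 1) + verma.E c k (vact c 0 v)"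
    by (simp only: verma.E_add verma.E_scale UNIV_I)
  also have "\<dots> = smult a [:c * of_int k, 1:] + [:- of_int k, 1:] * verma.E c k v"
  proof -
    have "verma.E c k (vact c 0 v) = vact c 0 (verma.E c k v) - smult (of_int k) (verma.E c k v)"
      by (rule verma.E_D) simp
    moreover have "[:0, 1:] * u - smult (of_int k) u = [:- of_int k, 1:] * u" for u :: "complex poly"
      by simp
    ultimately show ?thesis unfolding 1 vact_0 by (simp only:)
  qed
  also have "\<dots> = [:c * of_int k, 1:] * pcompose (pCons a v) [:- of_int k, 1:]"
  proof -
    have "smult a u = u * [:a:]" for u :: "complex poly" by simp
    then show ?thesis by (simp only: pCons.IH pcompose_pCons distrib_left mult.left_commute)
  qed
  finally show ?case .
qed simp

lemma verma_Aff: "verma.Aff c e v = [:e, - 1:] * v"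
  by (simp add: verma.Aff_def vact_0)

lemma verma_Lop: "verma.Lop c lam a b k j v =
    smult (lam powi k) ([:c * of_int k, 1:] * pcompose v [:- of_int k, 1:]) +
    [:a + of_int k * b + of_int j, - 1:] * v"
  by (simp only: verma.Lop_def verma_E verma_Aff)

text \<open>The reflection \<open>x \<mapsto> a + j - x\<close> exchanges the roles of the two summands of the action, and the
  scalar \<open>\<lambda>\<^sup>-\<^sup>j\<close> divides the action of \<open>d\<^sub>k\<close> by \<open>\<lambda>\<^sup>k\<close>.\<close>

definition flip :: "complex \<Rightarrow> complex \<Rightarrow> int \<Rightarrow> complex poly \<Rightarrow> complex poly" where
  "flip lam a j v = smult (lam powi (- j)) (pcompose v [:a + of_int j, - 1:])"

lemma flip_lin: "lin_on smult UNIV smult (flip lam a j)"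
  by (rule lin_onI) (simp_all add: flip_def pcompose_add pcompose_smult smult_add_right mult.commute)

lemma flip_bij:
  assumes "lam \<noteq> 0" shows "bij (flip lam a j)"
proof (rule o_bij)
  let ?g = "\<lambda>v. smult (lam powi j) (pcompose v [:a + of_int j, - 1:])"
  have "pcompose [:a + of_int j, - 1:] [:a + of_int j, - 1:] = [:0, 1:]"
    by (simp add: pcompose_pCons)
  then show "?g \<circ> flip lam a j = id" "flip lam a j \<circ> ?g = id"
    using assms by (simp_all add: fun_eq_iff flip_def pcompose_smult pcompose_assoc[symmetric]
        power_int_minus field_simps)
qed

lemma flip_Lop:
  assumes "lam \<noteq> 0"
  shows "flip lam a (k + j) (verma.Lop h lam a (h0 + 1) k j v) =
    verma.Lop h0 (inverse lam) a (h + 1) k j (flip lam a j v)"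
proof -
  let ?r = "[:a + of_int j, - 1:]" and ?r' = "[:a + of_int (k + j), - 1:]"
  let ?u = "pcompose v ?r" and ?u' = "pcompose v ?r'"
  have p: "lam powi (- (k + j)) * lam powi k = lam powi (- j)"
    "lam powi (- (k + j)) = inverse lam powi k * lam powi (- j)"
    unfolding power_int_inverse power_int_minus[symmetric]
    by (subst power_int_add[symmetric]; use assms in simp)+
  have c: "pcompose [:h * of_int k, 1:] ?r' = [:a + of_int j + of_int k * (h + 1), - 1:]"
    "pcompose [:- of_int k, 1:] ?r' = ?r"
    "pcompose [:a + of_int k * (h0 + 1) + of_int j, - 1:] ?r' = [:h0 * of_int k, 1:]"
    "pcompose ?r [:- of_int k, 1:] = ?r'"
    by (simp_all add: pcompose_pCons algebra_simps)
  have "flip lam a (k + j) (verma.Lop h lam a (h0 + 1) k j v) =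
      smult (lam powi (- (k + j)) * lam powi k) ([:a + of_int j + of_int k * (h + 1), - 1:] * ?u) +
      smult (lam powi (- (k + j))) ([:h0 * of_int k, 1:] * ?u')"
    unfolding flip_def verma_Lop
    by (simp only: pcompose_add pcompose_smult pcompose_mult pcompose_assoc[symmetric] c
        smult_add_right smult_smult)
  also have "\<dots> = verma.Lop h0 (inverse lam) a (h + 1) k j (flip lam a j v)"
  proof -
    have e: "a + of_int k * (h + 1) + of_int j = a + of_int j + of_int k * (h + 1)" by simp
    show ?thesis
      unfolding flip_def verma_Lop p(1) e unfolding p(2)
      by (simp only: pcompose_smult pcompose_assoc[symmetric] c mult_smult_right smult_smult add.commute)
  qed
  finally show ?thesis .
qed

subsection \<open>Highest weight modules\<close>

context witt_pre
begin

context
  fixes w h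
  assumes w: "w \<in> V" "w \<noteq> 0" and h: "h \<noteq> 0"
    and hw: "d 1 w = s h w" "\<And>i. i \<ge> 2 \<Longrightarrow> d i w = 0"
    and gen: "\<And>U. stable U \<Longrightarrow> w \<in> U \<Longrightarrow> U = V"
begin

abbreviation (input) "\<Phi> \<equiv> pact (d 0) w"

lemma D_image: "d 0 ` V \<subseteq> V" by auto

lemmas Phi_simps = pact_pCons[OF sub d_lin D_image] pact_in[OF sub d_lin D_image w(1)]
  pact_add[OF sub d_lin D_image w(1)] pact_smult[OF sub d_lin D_image w(1)] pact_0[OF sub d_lin D_image]

lemma Phi_X: "\<Phi> ([:0, 1:] * p) = d 0 (\<Phi> p)"
  by (simp add: Phi_simps)

lemma Phi_diff: "\<Phi> (p - q) = \<Phi> p - \<Phi> q"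
  using Phi_simps(3)[of "p - q" q] by simp

lemma Phi_intertwines: "\<Phi> (vact h i p) = d i (\<Phi> p)"
proof (induction p arbitrary: i)
  case 0
  show ?case by (simp add: Phi_simps)
next
  case (pCons a p)
  have one: "\<Phi> (vact h i 1) = d i w"
  proof -
    consider "i = 0" | "i = 1" | "i \<ge> 2" by linarith
    then show ?thesis
    proof cases
      case 1
      then show ?thesis using Phi_X[of 1] by (simp add: Phi_simps one_pCons)
    next
      case 2
      then show ?thesis using vact_1_const[of h 1] hw(1) by (simp add: Phi_simps one_pCons)
    next
      case 3
      then show ?thesis using vact_const[of i h 1] hw(2) by (simp add: Phi_simps one_pCons)
    qed
  qed
  have "pCons a p = smult a 1 + vact h 0 p" by (simp add: vact_0)
  then have "vact h i (pCons a p) = smult a (vact h i 1) + vact h i (vact h 0 p)"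
    by (simp only: verma.d_add verma.d_scale UNIV_I)
  also have "vact h i (vact h 0 p) = vact h 0 (vact h i p) - smult (of_nat i) (vact h (i - 1) p)"
    by (rule verma.d_D) simp
  finally have "\<Phi> (vact h i (pCons a p)) =
      s a (d i w) + (d 0 (\<Phi> (vact h i p)) - s (of_nat i) (\<Phi> (vact h (i - 1) p)))"
    by (simp only: Phi_simps Phi_diff one Phi_X vact_0[of h "vact h i p"])
  also have "\<dots> = s a (d i w) + d i (d 0 (\<Phi> p))"
    by (simp only: pCons.IH d_D[OF Phi_simps(2)])
  also have "\<dots> = d i (\<Phi> (pCons a p))"
    using w Phi_simps(2)[of p] by (simp add: Phi_simps(1))
  finally show ?case .
qed

text \<open>The vector \<open>d (n + 1) (d 0)\<^sup>n w\<close> is a nonzero multiple of \<open>h w\<close>, and \<open>d (n + 1)\<close> kills all smaller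
  powers; so the map from the Verma module is injective for \<open>h \<noteq> 0\<close>.\<close>

lemma Phi_level:
  "p \<noteq> 0 \<Longrightarrow> d (Suc (degree p)) (\<Phi> p) \<noteq> 0 \<and> (\<forall>i>Suc (degree p). d i (\<Phi> p) = 0)"
proof (induction p)
  case (pCons a p)
  show ?case
  proof (cases "p = 0")
    case True
    then have "\<Phi> (pCons a p) = s a w" "a \<noteq> 0" using pCons by (simp_all add: Phi_simps)
    then show ?thesis using True w hw h by simp
  next
    case False
    have e: "d (Suc i) (\<Phi> (pCons a p)) = s a (d (Suc i) w) + (d 0 (d (Suc i) (\<Phi> p)) - s (of_nat (Suc i)) (d i (\<Phi> p)))" for i
      using w Phi_simps(2)[of p] d_D[OF Phi_simps(2), of "Suc i" p] by (simp add: Phi_simps(1))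
    have "d (Suc (Suc (degree p))) (\<Phi> (pCons a p)) = - s (of_nat (Suc (Suc (degree p)))) (d (Suc (degree p)) (\<Phi> p))"
      unfolding e using pCons False hw(2) by simp
    moreover have "d i (\<Phi> (pCons a p)) = 0" if "i > Suc (Suc (degree p))" for i
      using that e[of "i - 1"] pCons False hw(2) by (cases i) auto
    ultimately show ?thesis using pCons False by (simp del: of_nat_Suc)
  qed
qed simp

lemma Phi_bij: "bij_betw \<Phi> UNIV V"
proof -
  have "inj \<Phi>"
  proof (rule injI)
    fix p q assume "\<Phi> p = \<Phi> q"
    then have "\<Phi> (p - q) = 0" by (simp add: Phi_diff)
    then have "p - q = 0" using Phi_level[of "p - q"] by auto
    then show "p = q" by simp
  qed
  moreover have "stable (range \<Phi>)" unfolding stable_def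
  proof (intro conjI allI ballI)
    show "subspace (range \<Phi>)"
    proof (rule subspaceI)
      show "0 \<in> range \<Phi>" by (rule image_eqI[of _ _ 0]) (simp_all add: Phi_simps)
      show "x + y \<in> range \<Phi>" if "x \<in> range \<Phi>" "y \<in> range \<Phi>" for x y
        using that by (auto simp: Phi_simps(3)[symmetric])
      show "s c x \<in> range \<Phi>" if "x \<in> range \<Phi>" for c x
        using that by (auto simp: Phi_simps(4)[symmetric])
    qed
    show "range \<Phi> \<subseteq> V" using Phi_simps(2) by auto
    show "d i x \<in> range \<Phi>" if "x \<in> range \<Phi>" for i x
      using that by (auto simp: Phi_intertwines[symmetric])
  qed
  moreover have "w \<in> range \<Phi>"
    by (rule image_eqI[of _ _ 1]) (simp_all add: Phi_simps one_pCons)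
  ultimately show ?thesis using gen by (auto simp: bij_betw_def)
qed

lemma iso_verma:
  "\<exists>f. bij_betw f UNIV V \<and> lin_on smult UNIV s f \<and> (\<forall>i p. f (vact h i p) = d i (f p)) \<and> f 1 = w"
  by (rule exI[of _ \<Phi>])
    (auto simp: Phi_bij Phi_intertwines one_pCons Phi_simps intro!: lin_onI)

end
end

section \<open>Loop modules over Verma modules\<close>

lemma coeff_transfer:
  fixes s :: "complex \<Rightarrow> 'v::ab_group_add \<Rightarrow> 'v" and t :: "complex \<Rightarrow> 'u::ab_group_add \<Rightarrow> 'u"
  assumes s: "vector_space s" "module.subspace s U" and t: "vector_space t" and lin: "lin_on s U t f"
    and F: "\<And>k::int. (\<Sum>i<N. s (of_int k ^ i) (v i)) \<in> U"
    and eq: "\<And>k::int. f (\<Sum>i<N. s (of_int k ^ i) (v i)) = (\<Sum>i<N. t (of_int k ^ i) (u i))"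
    and i: "i < N"
  shows "v i \<in> U" "f (v i) = u i"
proof -
  interpret s: cvec s by (rule cvec.intro, fact s)
  interpret t: cvec t by (rule cvec.intro, fact t)
  have v: "v i \<in> U" if "i < N" for i
    by (rule poly_coeff_in_subspace[OF s, where F = "\<lambda>k. \<Sum>i<N. s (of_int k ^ i) (v i)" and M = 0, OF refl])
      (use F that in auto)
  then show "v i \<in> U" using i by simp
  have "0 = (\<Sum>i<N. t (of_int k ^ i) (f (v i) - u i))" for k :: int
  proof -
    have "f (\<Sum>i<N. s (of_int k ^ i) (v i)) = (\<Sum>i<N. t (of_int k ^ i) (f (v i)))"
      by (subst lin_on_sum[OF s lin]) (auto intro!: s.subspace_scale[OF s(2)] v sum.cong simp: lin_on_scale[OF lin v])
    then show ?thesis using eq[of k] by (simp add: t.scale_right_diff_distrib sum_subtractf)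
  qed
  then have "f (v i) - u i \<in> {0}"
    by (rule poly_coeff_in_subspace[OF t t.subspace_single_0, where M = 0]) (use i in auto)
  then show "f (v i) = u i" by simp
qed

text \<open>The coefficients of the translation \<open>v(x - k)\<close> as a polynomial in \<open>k\<close>.\<close>

definition tay :: "nat \<Rightarrow> complex poly \<Rightarrow> complex poly" where
  "tay K v = smult (1 / fact K) (diff_op (monom 1 K) v)"

lemma tay_0: "degree v < K \<Longrightarrow> tay K v = 0"
  by (simp add: tay_def diff_op_monom_0)

lemma coeff_diff_op_monom:
  "coeff (diff_op (monom 1 K) v) i = (- 1) ^ K * (fact (i + K) / fact i) * coeff v (i + K)"
proof (induction K arbitrary: v)
  case 0
  then show ?case by (simp add: monom_0 flip: one_pCons)
next
  case (Suc K)
  have "diff_op (monom 1 (Suc K)) v = diff_op (monom 1 K) (- pderiv v)"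
    by (simp add: monom_Suc diff_op_pCons)
  then show ?case by (simp add: Suc coeff_pderiv field_simps)
qed

lemma coeff_tay: "coeff (tay K v) i = (- 1) ^ K * (fact (i + K) / (fact i * fact K)) * coeff v (i + K)"
  by (simp add: tay_def coeff_diff_op_monom)

lemma tay_degree: "tay (degree v) v = [:(- 1) ^ degree v * lead_coeff v:]"
proof (rule poly_eqI)
  fix i
  show "coeff (tay (degree v) v) i = coeff [:(- 1) ^ degree v * lead_coeff v:] i"
    by (cases i) (simp_all add: coeff_tay coeff_eq_0)
qed

text \<open>Compare the two expressions for \<open>E k\<close> on the Verma module of highest weight \<open>0\<close> and cancel \<open>x\<close>.\<close>

lemma pcompose_tay:
  assumes "degree v < N"
  shows "pcompose v [:- of_int k, 1:] = (\<Sum>K<N. smult (of_int k ^ K) (tay K v))"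
proof -
  have "verma.E 0 k v = (\<Sum>i<N. smult (of_int k ^ i) (smult (1 / fact i) (vact 0 i v)))"
    by (rule verma.E_eq) (use assms in \<open>simp add: vact_eq diff_op_monom_0\<close>)
  then have "[:0, 1:] * pcompose v [:- of_int k, 1:] =
      [:0, 1:] * (\<Sum>K<N. smult (of_int k ^ K) (tay K v))"
    unfolding verma_E vact_eq tay_def sum_distrib_left by simp
  then show ?thesis by (subst (asm) mult_cancel_left) simp
qed

text \<open>With \<open>c = a + j\<close> and \<open>\<beta> = b - 1\<close>, the \<open>\<lambda>\<close>-part of \<open>d\<^sub>-\<^sub>k d\<^sub>k\<close> on \<open>v \<otimes> t\<^sup>j\<close> is
  \<open>(x + h k) (c - x - \<beta> k) v(x - k)\<close>.  Its coefficient at \<open>k\<^sup>K\<close>:\<close>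

definition lcoeff :: "complex \<Rightarrow> complex \<Rightarrow> complex \<Rightarrow> nat \<Rightarrow> complex poly \<Rightarrow> complex poly" where
  "lcoeff h \<beta> c K v = [:0, c, - 1:] * tay K v
    + (if K \<ge> 1 then [:h * c, - (h + \<beta>):] * tay (K - 1) v else 0)
    - (if K \<ge> 2 then smult (h * \<beta>) (tay (K - 2) v) else 0)"

lemma lcoeff_0: "degree v + 2 < K \<Longrightarrow> lcoeff h \<beta> c K v = 0"
  by (simp add: lcoeff_def tay_0)

lemma lcoeff_sum:
  assumes "degree v + 2 < N"
  shows "[:h * of_int k, 1:] * [:c - of_int k * \<beta>, - 1:] * pcompose v [:- of_int k, 1:] =
    (\<Sum>K<N. smult (of_int k ^ K) (lcoeff h \<beta> c K v))"
proof -
  obtain M where N: "N = Suc (Suc M)" using assms by (metis Suc_diff_Suc add_2_eq_Suc' less_nat_zero_code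
    not0_implies_Suc old.nat.inject zero_less_Suc gr0_conv_Suc less_trans_Suc Suc_lessE)
  have M: "degree v < M" using assms N by simp
  let ?k = "of_int k :: complex" and ?q = "[:0, c, - 1:]" and ?r = "[:h * c, - (h + \<beta>):]"
  let ?S = "\<Sum>K<M. smult (?k ^ K) (tay K v)"
  have 1: "(\<Sum>K<N. smult (?k ^ K) (?q * tay K v)) = ?q * ?S"
    using M by (simp add: N tay_0 sum_distrib_left)
  have 2: "(\<Sum>K<N. smult (?k ^ K) (if K \<ge> 1 then ?r * tay (K - 1) v else 0)) = smult ?k (?r * ?S)"
    unfolding N using M
    by (subst sum.lessThan_Suc_shift)
      (simp add: tay_0 sum_distrib_left poly_vs.scale_sum_right)
  have 3: "(\<Sum>K<N. smult (?k ^ K) (if K \<ge> 2 then smult (h * \<beta>) (tay (K - 2) v) else 0)) =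
      smult (?k ^ 2 * (h * \<beta>)) ?S"
    unfolding N
    by (subst sum.lessThan_Suc_shift, subst sum.lessThan_Suc_shift)
      (simp add: poly_vs.scale_sum_right power2_eq_square ac_simps)
  have "[:h * ?k, 1:] * [:c - ?k * \<beta>, - 1:] = ?q + smult ?k ?r - [:?k ^ 2 * (h * \<beta>):]"
    by (simp add: power2_eq_square algebra_simps)
  then have "[:h * ?k, 1:] * [:c - ?k * \<beta>, - 1:] * ?S =
      ?q * ?S + smult ?k (?r * ?S) - smult (?k ^ 2 * (h * \<beta>)) ?S"
    by (simp only: left_diff_distrib distrib_right mult_smult_left) simp
  then show ?thesis unfolding pcompose_tay[OF M] lcoeff_def
    by (simp only: smult_add_right smult_diff_right sum.distrib sum_subtractf 1 2 3)
qed

lemma lcoeff_top: "lcoeff h \<beta> c (degree v + 2) v = [:- (h * \<beta>) * (- 1) ^ degree v * lead_coeff v:]"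
  by (simp add: lcoeff_def tay_0 tay_degree)

lemma lcoeff_next:
  assumes "odd (degree v)"
  shows "coeff (lcoeff h \<beta> c (degree v + 1) v) 1 = lead_coeff v * (h + \<beta> - h * \<beta> * of_nat (degree v))"
proof -
  obtain e where e: "degree v = Suc e" "even e" using assms by (cases "degree v") auto
  have "coeff (tay e v) 1 = of_nat (Suc e) * coeff v (Suc e)"
    using e(2) by (simp add: coeff_tay)
  then show ?thesis
    using tay_degree[of v] e by (simp add: lcoeff_def tay_0 algebra_simps)
qed

lemma verma_lambda_part:
  "verma.E h k (verma.Aff h (a + of_int (0 - k) * b + of_int j) v) =
    [:h * of_int k, 1:] * [:a + of_int j - of_int k * (b - 1), - 1:] * pcompose v [:- of_int k, 1:]"
proof -
  have "pcompose [:a + of_int (0 - k) * b + of_int j, - 1:] [:- of_int k, 1:] =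
      [:a + of_int j - of_int k * (b - 1), - 1:]"
    by (simp add: pcompose_pCons algebra_simps)
  then show ?thesis by (simp only: verma_E verma_Aff pcompose_mult mult.assoc)
qed

lemma verma_one_part:
  fixes h a b :: complex and j k :: int
  defines "c \<equiv> a + of_int j"
  shows "verma.E h (0 - k) (verma.E h k v) +
      verma.Aff h (a + of_int (0 - k) * b + of_int (k + j)) (verma.Aff h (a + of_int k * b + of_int j) v) =
    (\<Sum>i<3. smult (of_int k ^ i) (([[:c * c:] - smult 2 [:0, c, - 1:], [:c:],
      [:- (h * (h + 1) + b * (b - 1)):]] ! i) * v))"
proof -
  have "pcompose (pcompose v [:- of_int k, 1:]) [:- of_int (0 - k), 1:] = v"
    by (simp add: pcompose_assoc[symmetric] pcompose_pCons)
  moreover have "pcompose [:h * of_int k, 1:] [:- of_int (0 - k), 1:] = [:h * of_int k + of_int k, 1:]"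
    by (simp add: pcompose_pCons)
  ultimately have "verma.E h (0 - k) (verma.E h k v) = [:h * of_int (0 - k), 1:] * ([:h * of_int k + of_int k, 1:] * v)"
    by (simp only: verma_E pcompose_mult)
  moreover have "[:h * of_int (0 - k), 1:] * [:h * of_int k + of_int k, 1:] +
      [:a + of_int (0 - k) * b + of_int (k + j), - 1:] * [:a + of_int k * b + of_int j, - 1:] =
    ([:c * c:] - smult 2 [:0, c, - 1:]) + smult (of_int k) [:c:] +
      smult (of_int k ^ 2) [:- (h * (h + 1) + b * (b - 1)):]"
    by (simp add: c_def power2_eq_square algebra_simps)
  ultimately have "verma.E h (0 - k) (verma.E h k v) +
      verma.Aff h (a + of_int (0 - k) * b + of_int (k + j)) (verma.Aff h (a + of_int k * b + of_int j) v) =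
     (([:c * c:] - smult 2 [:0, c, - 1:]) + smult (of_int k) [:c:] +
      smult (of_int k ^ 2) [:- (h * (h + 1) + b * (b - 1)):]) * v"
    by (simp only: verma_Aff mult.assoc[symmetric] distrib_right[symmetric])
  then show ?thesis
    by (simp only: eval_nat_numeral sum.lessThan_Suc distrib_right mult_smult_left)
      (simp add: eval_nat_numeral)
qed

locale verma_map = graded_map smult UNIV "vact h" smult UNIV "vact h0" lam lam a b b0 \<phi> U U0
  for h h0 lam a b b0 \<phi> and U U0 :: "int \<Rightarrow> complex poly set" +
  assumes lam_ne_1: "lam \<noteq> 1"
begin

text \<open>The term of \<open>d\<^sub>-\<^sub>k d\<^sub>k\<close> with exponent \<open>1\<close> is the multiplication by a polynomial that is quadratic in \<open>k\<close>; the
  quadratic coefficient is a scalar and the constant one is \<open>c\<^sup>2 - 2 x (c - x)\<close> with \<open>c = a + j\<close>.\<close>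

lemma one_coeff:
  assumes v: "v \<in> U j"
  shows "[:0, a + of_int j, - 1:] * v \<in> U j"
    and "\<phi> j ([:0, a + of_int j, - 1:] * v) = [:0, a + of_int j, - 1:] * \<phi> j v"
    and "v \<noteq> 0 \<Longrightarrow> h * (h + 1) + b * (b - 1) = h0 * (h0 + 1) + b0 * (b0 - 1)"
proof -
  let ?c = "a + of_int j" and ?q = "[:0, a + of_int j, - 1:]"
  let ?L = "\<lambda>h b i. ([[:?c * ?c:] - smult 2 ?q, [:?c:], [:- (h * (h + 1) + b * (b - 1)):]] ! i)"
  have inv: "inverse lam \<noteq> 1" using lam_ne_1 by auto
  have e: "exp_part 1 (W.two_step lam a b 0 j v) k = (\<Sum>i<3. smult (of_int k ^ i) (?L h b i * v))" for k
    unfolding verma_one_part[symmetric] using lam_ne_1 inv by (simp add: W.two_step_def)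
  have e0: "exp_part 1 (W0.two_step lam a b0 0 j (\<phi> j v)) k =
      (\<Sum>i<3. smult (of_int k ^ i) (?L h0 b0 i * \<phi> j v))" for k
    unfolding verma_one_part[symmetric] using lam_ne_1 inv by (simp add: W0.two_step_def)
  have in_U: "(\<Sum>i<3. smult (of_int k ^ i) (?L h b i * v)) \<in> U j" for k
    using two_step_part(1)[OF v, of 1 0 k] unfolding e by simp
  have eq: "\<phi> j (\<Sum>i<3. smult (of_int k ^ i) (?L h b i * v)) =
      (\<Sum>i<3. smult (of_int k ^ i) (?L h0 b0 i * \<phi> j v))" for k
    using two_step_part(2)[OF v, of 0 1 k] unfolding e e0 by simp
  note tr = coeff_transfer[OF W.vector_space_axioms U(1) W.vector_space_axioms lin in_U eq]
  have "Q * v = smult (1 / 2) (smult e v - (([:e:] - smult 2 Q) * v))" for e and Q v :: "complex poly"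
    by (simp add: left_diff_distrib smult_diff_right)
  note q = this[of ?q _ "?c * ?c"]
  have N0: "([:?c * ?c:] - smult 2 ?q) * v \<in> U j"
    "\<phi> j (([:?c * ?c:] - smult 2 ?q) * v) = ([:?c * ?c:] - smult 2 ?q) * \<phi> j v"
    using tr(1)[of 0] tr(2)[of 0] by (simp_all only: nth_Cons_0 zero_less_numeral)
  note sub = W.subspace_scale[OF U(1)] W.subspace_diff[OF U(1)]
  show "?q * v \<in> U j" unfolding q by (intro sub v N0)
  show "\<phi> j (?q * v) = ?q * \<phi> j v"
    unfolding q
    by (simp only: lin_on_scale[OF lin sub(2)[OF sub(1)[OF v] N0(1)]]
        lin_on_diff[OF lin sub(2)[OF sub(1)[OF v] N0(1)] N0(1)] lin_on_scale[OF lin v] N0(2))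
  assume "v \<noteq> 0"
  have "\<phi> j (smult (- (h * (h + 1) + b * (b - 1))) v) = smult (- (h0 * (h0 + 1) + b0 * (b0 - 1))) (\<phi> j v)"
    using tr(2)[of 2] by (simp add: eval_nat_numeral)
  then have "smult (- (h * (h + 1) + b * (b - 1))) (\<phi> j v) = smult (- (h0 * (h0 + 1) + b0 * (b0 - 1))) (\<phi> j v)"
    by (simp only: phi_scale[OF v])
  moreover have "\<phi> j v \<noteq> 0" using phi_eq_0[OF v] \<open>v \<noteq> 0\<close> by simp
  ultimately show "h * (h + 1) + b * (b - 1) = h0 * (h0 + 1) + b0 * (b0 - 1)"
    by (metis W.scale_cancel_right neg_equal_iff_equal)
qed

text \<open>For \<open>\<lambda> = -1\<close> the \<open>\<lambda>\<close>-part and the \<open>\<lambda>\<inverse>\<close>-part cannot be separated, and only the even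
  coefficients are available.\<close>

lemma lambda_coeff:
  assumes v: "v \<in> U j" and K: "even K \<or> lam \<noteq> - 1"
  shows "\<phi> j (lcoeff h (b - 1) (a + of_int j) K v) = lcoeff h0 (b0 - 1) (a + of_int j) K (\<phi> j v)"
proof -
  \<comment> \<open>for \<open>\<lambda> = -1\<close> the sum of the two terms is seen, in which the odd coefficients cancel\<close>
  define g where "g = (\<lambda>K::nat. if inverse lam = lam then 1 + (- 1) ^ K else (1 :: complex))"
  have lam_inv: "inverse lam = lam \<Longrightarrow> lam = - 1"
    using lam_ne_1 lam_nz by (metis left_inverse mult_cancel_right square_eq_1_iff)
  have "\<exists>N. degree v + 2 < N \<and> degree (\<phi> j v) + 2 < N \<and> K < N"
    by (rule exI[of _ "degree v + degree (\<phi> j v) + K + 3"]) simp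
  then obtain N where N: "degree v + 2 < N" "degree (\<phi> j v) + 2 < N" "K < N" by blast
  have g: "g K \<noteq> 0" using K lam_inv by (auto simp: g_def)
  have part: "(if inverse lam = lam then P k + P (- k) else P k) = (\<Sum>K<N. smult (of_int k ^ K) (smult (g K) (l K)))"
    if "\<And>k. P k = (\<Sum>K<N. smult (of_int k ^ K) (l K))" for k :: int and P and l :: "nat \<Rightarrow> complex poly"
  proof -
    have *: "smult (of_int (- k) ^ K) u = smult (of_int k ^ K) (smult ((- 1) ^ K) u)" for K and u :: "complex poly"
      by (simp add: power_minus[of "of_int k"] mult.commute)
    show ?thesis
    proof (cases "inverse lam = lam")
      case True
      have "P k + P (- k) = (\<Sum>K<N. smult (of_int k ^ K) (l K) + smult (of_int k ^ K) (smult ((- 1) ^ K) (l K)))"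
        unfolding that[of k] that[of "- k"] * by (simp only: sum.distrib)
      also have "\<dots> = (\<Sum>K<N. smult (of_int k ^ K) (smult (g K) (l K)))"
        by (intro sum.cong refl) (simp add: g_def True smult_add_left smult_add_right distrib_left)
      finally show ?thesis using True by simp
    qed (simp add: that g_def)
  qed
  have e: "exp_part lam (W.two_step lam a b 0 j v) k =
      (\<Sum>K<N. smult (of_int k ^ K) (smult (g K) (lcoeff h (b - 1) (a + of_int j) K v)))" for k
    unfolding part[OF lcoeff_sum[OF N(1)], symmetric]
    using lam_ne_1 verma_lambda_part[of h k a b j v] verma_lambda_part[of h "- k" a b j v]
    by (simp add: W.two_step_def)
  have e0: "exp_part lam (W0.two_step lam a b0 0 j (\<phi> j v)) k =
      (\<Sum>K<N. smult (of_int k ^ K) (smult (g K) (lcoeff h0 (b0 - 1) (a + of_int j) K (\<phi> j v))))" for k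
    unfolding part[OF lcoeff_sum[OF N(2)], symmetric]
    using lam_ne_1 verma_lambda_part[of h0 k a b0 j "\<phi> j v"] verma_lambda_part[of h0 "- k" a b0 j "\<phi> j v"]
    by (simp add: W0.two_step_def)
  note tr = coeff_transfer[OF W.vector_space_axioms U(1) W.vector_space_axioms lin]
  let ?l = "lcoeff h (b - 1) (a + of_int j) K v"
  have 1: "smult (g K) ?l \<in> U j"
    by (rule tr(1)[where N = N and u = "\<lambda>K. smult (g K) (lcoeff h0 (b0 - 1) (a + of_int j) K (\<phi> j v))"])
      (use two_step_part(1)[OF v, of lam 0, unfolded e] two_step_part(2)[OF v, of 0 lam, unfolded e e0] N in simp_all)
  have 2: "\<phi> j (smult (g K) ?l) = smult (g K) (lcoeff h0 (b0 - 1) (a + of_int j) K (\<phi> j v))"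
    by (rule tr(2)[where N = N])
      (use two_step_part(1)[OF v, of lam 0, unfolded e] two_step_part(2)[OF v, of 0 lam, unfolded e e0] N in simp_all)
  have "smult (inverse (g K)) (smult (g K) ?l) \<in> U j" by (rule W.subspace_scale[OF U(1) 1])
  then have "?l \<in> U j" using g by simp
  then show ?thesis using 2 g by (simp add: phi_scale)
qed

text \<open>Let \<open>c = a + j\<close>.  The constant \<open>1\<close> has the \<open>\<lambda>\<close>-term \<open>x (c - x) + \<dots> - h (b - 1) k\<^sup>2\<close>, of degree \<open>2\<close> in \<open>k\<close>.  On a polynomial of even
  degree \<open>e > 0\<close> the degree in \<open>k\<close> is \<open>e + 2\<close>.  On one of odd degree the coefficient at \<open>k\<^sup>e\<^sup>+\<^sup>1\<close> might
  vanish or fit, but not at the same time for \<open>\<phi> 1\<close> and for its product with \<open>x (c - x)\<close>.\<close>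

lemma phi_one:
  assumes U1: "1 \<in> U j" and nz: "h0 \<noteq> 0" "b0 \<noteq> 1"
  shows "\<exists>\<gamma>. \<gamma> \<noteq> 0 \<and> \<phi> j 1 = [:\<gamma>:]" and "h * (b - 1) = h0 * (b0 - 1)"
proof -
  let ?c = "a + of_int j"
  let ?q = "[:0, ?c, - 1:]"
  let ?l = "lcoeff h (b - 1) ?c" and ?m = "lcoeff h0 (b0 - 1) ?c"
  define g where "g = \<phi> j 1"
  define e where "e = degree g"
  have g0: "g \<noteq> 0" using phi_eq_0[OF U1] by (simp add: g_def)
  have q0: "\<phi> j 0 = 0" using lin_on_zero[OF lin W.subspace_0[OF U(1)]] .
  have Uq: "?q \<in> U j" "\<phi> j ?q = ?q * g"
    using one_coeff(1,2)[OF U1] by (simp_all add: g_def)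
  have dq: "degree (?q * g) = e + 2" "lead_coeff (?q * g) = - lead_coeff g"
  proof -
    show "degree (?q * g) = e + 2" using g0 by (subst degree_mult_eq) (auto simp: e_def)
    show "lead_coeff (?q * g) = - lead_coeff g" by (subst lead_coeff_mult) simp
  qed
  have l1: "?l 2 1 = [:- (h * (b - 1)):]" using lcoeff_top[of h "b - 1" ?c 1] by (simp add: one_pCons numeral_2_eq_2)
  have lq: "?l 4 ?q = [:h * (b - 1):]" using lcoeff_top[of h "b - 1" ?c ?q] by (simp add: eval_nat_numeral)
  have c1: "\<phi> j [:x:] = smult x g" for x
    using phi_scale[OF U1, of x] by (simp add: g_def one_pCons)
  have "e = 0"
  proof (rule ccontr)
    assume e0: "e \<noteq> 0"
    show False
    proof (cases "even e")
      case True
      have "\<phi> j (?l (e + 2) 1) = ?m (e + 2) g"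
        unfolding g_def by (rule lambda_coeff[OF U1]) (use True in simp)
      moreover have "?l (e + 2) 1 = 0" by (rule lcoeff_0) (use e0 in simp)
      ultimately show False using q0 lcoeff_top[of h0 "b0 - 1" ?c g] nz g0 by (simp add: e_def)
    next
      case False
      have 1: "\<phi> j (?l (e + 1) 1) = ?m (e + 1) g"
        unfolding g_def by (rule lambda_coeff[OF U1]) (use False in simp)
      have 2: "\<phi> j (?l (e + 3) ?q) = ?m (e + 3) (?q * g)"
        unfolding Uq(2)[symmetric] by (rule lambda_coeff[OF Uq(1)]) (use False in simp)
      have c1': "coeff (?m (e + 1) g) 1 = lead_coeff g * (h0 + (b0 - 1) - h0 * (b0 - 1) * of_nat e)"
        using lcoeff_next[of g h0 "b0 - 1" ?c] False by (simp add: e_def)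
      have c2': "coeff (?m (e + 3) (?q * g)) 1 =
          - lead_coeff g * (h0 + (b0 - 1) - h0 * (b0 - 1) * of_nat (e + 2))"
      proof -
        have "coeff (?m (e + 3) G) 1 = - lead_coeff g * (h0 + (b0 - 1) - h0 * (b0 - 1) * of_nat (e + 2))"
          if "degree G = e + 2" "lead_coeff G = - lead_coeff g" for G
        proof -
          have "odd (degree G)" using that(1) False by simp
          from lcoeff_next[OF this, of h0 "b0 - 1" ?c] that show ?thesis
            by (simp add: eval_nat_numeral)
        qed
        from this[OF dq] show ?thesis .
      qed
      show False
      proof (cases "e = 1")
        case True
        have "coeff (\<phi> j (?l 2 1)) 1 = - (h * (b - 1)) * lead_coeff g"
          unfolding l1 c1 using True by (simp add: e_def)
        then have "lead_coeff g * (h0 + (b0 - 1) - h0 * (b0 - 1)) = - (h * (b - 1)) * lead_coeff g"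
          using 1 c1' True by (simp add: numeral_2_eq_2)
        then have "lead_coeff g * (h0 + (b0 - 1) - h0 * (b0 - 1) + h * (b - 1)) = 0" by algebra
        then have "h0 + (b0 - 1) - h0 * (b0 - 1) + h * (b - 1) = 0" using g0 by simp
        moreover have "coeff (\<phi> j (?l 4 ?q)) 1 = h * (b - 1) * lead_coeff g"
          unfolding lq c1 using True by (simp add: e_def)
        then have "- lead_coeff g * (h0 + (b0 - 1) - h0 * (b0 - 1) * 3) = h * (b - 1) * lead_coeff g"
          using 2 c2' True by (simp add: eval_nat_numeral)
        then have "lead_coeff g * (h0 + (b0 - 1) - h0 * (b0 - 1) * 3 + h * (b - 1)) = 0" by algebra
        then have "h0 + (b0 - 1) - h0 * (b0 - 1) * 3 + h * (b - 1) = 0" using g0 by simp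
        ultimately have "h0 * (b0 - 1) = 0" by algebra
        then show False using nz by simp
      next
        case False
        with \<open>odd e\<close> have e3: "e \<ge> 3" by (cases e) (auto elim!: oddE)
        have "?l (e + 1) 1 = 0" "?l (e + 3) ?q = 0" by (rule lcoeff_0, use e3 in simp)+
        then have "h0 + (b0 - 1) - h0 * (b0 - 1) * of_nat e = 0"
          "h0 + (b0 - 1) - h0 * (b0 - 1) * of_nat (e + 2) = 0"
          using 1 2 c1' c2' q0 g0 by simp_all
        then have "h0 * (b0 - 1) * of_nat (e + 2) - h0 * (b0 - 1) * of_nat e = 0" by algebra
        moreover have "h0 * (b0 - 1) * of_nat (e + 2) - h0 * (b0 - 1) * of_nat e = 2 * (h0 * (b0 - 1))"
          by (simp add: algebra_simps)
        ultimately have "h0 * (b0 - 1) = 0" by simp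
        then show False using nz by simp
      qed
    qed
  qed
  then obtain \<gamma> where \<gamma>: "g = [:\<gamma>:]" using degree_eq_zeroE unfolding e_def by blast
  then show "\<exists>\<gamma>. \<gamma> \<noteq> 0 \<and> \<phi> j 1 = [:\<gamma>:]" using g0 by (auto simp: g_def)
  have "\<phi> j (?l 2 1) = ?m 2 g" unfolding g_def by (rule lambda_coeff[OF U1]) simp
  then have "- (h * (b - 1)) * \<gamma> = - (h0 * (b0 - 1)) * \<gamma>"
    unfolding l1 c1 \<gamma> using lcoeff_top[of h0 "b0 - 1" ?c "[:\<gamma>:]"] by (simp add: numeral_2_eq_2)
  then show "h * (b - 1) = h0 * (b0 - 1)" using g0 \<gamma> by simp
qed

text \<open>The same degree count shows that \<open>\<phi>\<close> maps \<open>x\<close> to a polynomial of degree one, and the coefficient at \<open>k\<^sup>2\<close>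
  then gives the sum of \<open>h\<close> and \<open>b - 1\<close>; their product is known from the constant \<open>1\<close>.\<close>

lemma phi_X:
  assumes UU: "U j = UNIV" and nz: "h0 \<noteq> 0" "b0 \<noteq> 1"
  obtains \<gamma> \<gamma>' \<delta> where "\<phi> j 1 = [:\<gamma>:]" "\<phi> j [:0, 1:] = [:\<delta>, \<gamma>':]" "\<gamma> \<noteq> 0" "\<gamma>' \<noteq> 0"
    "h + (b - 1) = h0 + (b0 - 1)" "h * (b - 1) = h0 * (b0 - 1)"
proof -
  let ?c = "a + of_int j" and ?X = "[:0, 1:] :: complex poly"
  let ?q = "[:0, ?c, - 1:]"
  let ?l = "lcoeff h (b - 1) ?c" and ?m = "lcoeff h0 (b0 - 1) ?c"
  have mem [simp]: "v \<in> U j" for v using UU by simp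
  obtain \<gamma> where \<gamma>: "\<gamma> \<noteq> 0" "\<phi> j 1 = [:\<gamma>:]" using phi_one(1)[OF mem nz] by blast
  have pp: "h * (b - 1) = h0 * (b0 - 1)" by (rule phi_one(2)[OF mem nz])
  have add: "\<phi> j (u + v) = \<phi> j u + \<phi> j v" and scale: "\<phi> j (smult x v) = smult x (\<phi> j v)" for u v x
    using phi_add[of u j v] phi_scale[of v j x] by simp_all
  have z: "\<phi> j 0 = 0" using scale[of 0 0] by simp
  have const: "\<phi> j [:x:] = [:x * \<gamma>:]" for x
    using scale[of x 1] \<gamma> by (simp add: one_pCons)
  define g where "g = \<phi> j ?X"
  define e where "e = degree g"
  have coeff: "\<phi> j (?l K ?X) = ?m K g" if "even K" for K
    unfolding g_def by (rule lambda_coeff) (use that in auto)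
  have "e \<noteq> 0"
  proof
    assume "e = 0"
    then obtain y where y: "g = [:y:]" unfolding e_def by (metis degree_eq_zeroE)
    have "\<phi> j [:- (y / \<gamma>), 1:] = \<phi> j ?X + \<phi> j [:- (y / \<gamma>):]" by (simp flip: add)
    also have "\<dots> = 0" using y \<gamma> by (simp add: const g_def[symmetric])
    finally show False using phi_eq_0[of "[:- (y / \<gamma>), 1:]" j] by simp
  qed
  then have g0: "g \<noteq> 0" by (auto simp: e_def)
  have "odd e"
  proof
    assume "even e"
    then have "\<phi> j (?l (e + 2) ?X) = ?m (e + 2) g" by (intro coeff) simp
    moreover have "?l (e + 2) ?X = 0"
      by (rule lcoeff_0) (use \<open>even e\<close> \<open>e \<noteq> 0\<close> in \<open>auto elim!: evenE\<close>)
    ultimately show False using z lcoeff_top[of h0 "b0 - 1" ?c g] nz g0 by (simp add: e_def)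
  qed
  have next1: "coeff (?m (e + 1) g) 1 = lead_coeff g * (h0 + (b0 - 1) - h0 * (b0 - 1) * of_nat e)"
    using lcoeff_next[of g h0 "b0 - 1" ?c] \<open>odd e\<close> by (simp add: e_def)
  have "e = 1"
  proof (rule ccontr)
    assume "e \<noteq> 1"
    with \<open>odd e\<close> have e3: "e \<ge> 3" by (cases e) (auto elim!: oddE)
    have "\<phi> j (?l (e + 1) ?X) = ?m (e + 1) g" by (rule coeff) (use \<open>odd e\<close> in simp)
    moreover have "?l (e + 1) ?X = 0" by (rule lcoeff_0) (use e3 in simp)
    ultimately have 1: "h0 + (b0 - 1) - h0 * (b0 - 1) * of_nat e = 0"
      using z next1 g0 by simp
    have qX: "\<phi> j (?q * ?X) = ?q * g" unfolding g_def by (rule one_coeff) simp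
    have "\<phi> j (?l (e + 3) (?q * ?X)) = ?m (e + 3) (?q * g)"
      unfolding qX[symmetric] by (rule lambda_coeff) (use \<open>odd e\<close> in auto)
    moreover have "?l (e + 3) (?q * ?X) = 0" by (rule lcoeff_0) (use e3 in simp)
    ultimately have 2: "coeff (?m (e + 3) (?q * g)) 1 = 0" using z by simp
    have "coeff (?m (e + 3) G) 1 = lead_coeff G * (h0 + (b0 - 1) - h0 * (b0 - 1) * of_nat (e + 2))"
      if "degree G = e + 2" for G
    proof -
      have "odd (degree G)" using that(1) \<open>odd e\<close> by simp
      from lcoeff_next[OF this, of h0 "b0 - 1" ?c] that show ?thesis
        by (simp add: eval_nat_numeral)
    qed
    moreover have "degree (?q * g) = e + 2" using g0 by (subst degree_mult_eq) (auto simp: e_def)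
    moreover have "lead_coeff (?q * g) \<noteq> 0" using g0 by (subst lead_coeff_mult) simp
    ultimately have "h0 + (b0 - 1) - h0 * (b0 - 1) * of_nat (e + 2) = 0"
      using 2 by (metis mult_eq_0_iff)
    with 1 have "h0 * (b0 - 1) * of_nat (e + 2) - h0 * (b0 - 1) * of_nat e = 0" by algebra
    moreover have "h0 * (b0 - 1) * of_nat (e + 2) - h0 * (b0 - 1) * of_nat e = 2 * (h0 * (b0 - 1))"
      by (simp add: algebra_simps)
    ultimately have "h0 * (b0 - 1) = 0" by simp
    then show False using nz by simp
  qed
  then obtain \<delta> \<gamma>' where g: "g = [:\<delta>, \<gamma>':]" "\<gamma>' \<noteq> 0"
    unfolding e_def by (metis degree1_coeffs)
  have "tay 2 ?X = 0" by (rule tay_0) simp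
  moreover have "tay 1 ?X = [:- 1:]" "tay 0 ?X = ?X"
    using tay_degree[of ?X] by (auto simp: tay_def monom_0 simp flip: one_pCons)
  ultimately have "?l 2 ?X = smult (h + (b - 1) - h * (b - 1)) ?X + [:- (h * ?c):]"
    by (simp add: lcoeff_def algebra_simps)
  then have "\<phi> j (?l 2 ?X) = smult (h + (b - 1) - h * (b - 1)) g + [:- (h * ?c) * \<gamma>:]"
    by (simp only: add scale const g_def)
  then have "coeff (?m 2 g) 1 = (h + (b - 1) - h * (b - 1)) * \<gamma>'"
    using coeff[of 2] g by simp
  moreover have "coeff (?m 2 g) 1 = \<gamma>' * (h0 + (b0 - 1) - h0 * (b0 - 1))"
    using next1 \<open>e = 1\<close> g by (simp add: numeral_2_eq_2)
  ultimately have "h + (b - 1) = h0 + (b0 - 1)" using g(2) pp by simp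
  with g \<gamma> pp that show ?thesis by (simp add: g_def)
qed

text \<open>Sum and product determine \<open>h\<close> and \<open>b - 1\<close> up to order.  For \<open>\<lambda> \<noteq> -1\<close> the odd coefficients are
  available too, and those at \<open>k\<close> on \<open>1\<close> and on \<open>x\<close> exclude the exchange, on a component with \<open>a + j \<noteq> 0\<close>.\<close>

lemma parameters_eq:
  assumes UU: "\<And>j. U j = UNIV" and nz: "h0 \<noteq> 0" "b0 \<noteq> 1"
  shows "(h = h0 \<and> b = b0) \<or> (lam = - 1 \<and> h = b0 - 1 \<and> b = h0 + 1)"
proof -
  obtain j where c: "a + of_int j \<noteq> 0"
  proof (cases "a = 0")
    case True then show ?thesis using that[of 1] by simp
  next
    case False then show ?thesis using that[of 0] by simp
  qed
  let ?c = "a + of_int j" and ?X = "[:0, 1:] :: complex poly"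
  let ?q = "[:0, ?c, - 1:]"
  let ?l = "lcoeff h (b - 1) ?c" and ?m = "lcoeff h0 (b0 - 1) ?c"
  obtain \<gamma> \<gamma>' \<delta> where g: "\<phi> j 1 = [:\<gamma>:]" "\<phi> j ?X = [:\<delta>, \<gamma>':]" "\<gamma> \<noteq> 0" "\<gamma>' \<noteq> 0"
    and s: "h + (b - 1) = h0 + (b0 - 1)" and p: "h * (b - 1) = h0 * (b0 - 1)"
    using phi_X[OF UU nz, of j] by metis
  have "(h - h0) * (h - (b0 - 1)) = 0" using s p by algebra
  then consider "h = h0" | "h = b0 - 1" "h \<noteq> h0" by auto
  then show ?thesis
  proof cases
    case 1 then show ?thesis using s by auto
  next
    case 2
    have "lam = - 1"
    proof (rule ccontr)
      assume lam: "lam \<noteq> - 1"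
      have mem [simp]: "v \<in> U i" for v i using UU by simp
      have add: "\<phi> j (u + v) = \<phi> j u + \<phi> j v" and scale: "\<phi> j (smult x v) = smult x (\<phi> j v)" for u v x
        using phi_add[of u j v] phi_scale[of v j x] by simp_all
      have const: "\<phi> j [:x:] = [:x * \<gamma>:]" for x
        using scale[of x 1] g by (simp add: one_pCons)
      have lin2: "\<phi> j [:x, y:] = [:x * \<gamma> + y * \<delta>, y * \<gamma>':]" for x y
      proof -
        have "\<phi> j ([:x:] + smult y ?X) = [:x * \<gamma>:] + smult y [:\<delta>, \<gamma>':]"
          by (simp only: add const scale g)
        then show ?thesis by simp
      qed
      have coeff: "\<phi> j (?l K v) = ?m K (\<phi> j v)" for K v
        by (rule lambda_coeff) (use lam in auto)
      have tay_lin: "tay 0 [:x, y:] = [:x, y:]" "tay 1 [:x, y:] = [:- y:]"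
        "K \<ge> 2 \<Longrightarrow> tay K [:x, y:] = 0" for x y K
      proof -
        show "tay 0 [:x, y:] = [:x, y:]" by (simp add: tay_def monom_0 flip: one_pCons)
        show "tay 1 [:x, y:] = [:- y:]"
        proof (rule poly_eqI)
          show "coeff (tay 1 [:x, y:]) i = coeff [:- y:] i" for i
            by (cases i) (simp_all add: coeff_tay)
        qed
        show "K \<ge> 2 \<Longrightarrow> tay K [:x, y:] = 0" by (rule tay_0) (simp add: degree_pCons_eq_if)
      qed
      have l3: "lcoeff u v ?c 3 [:x, y:] = [:u * v * y:]" for u v x y
        using tay_lin(2)[of x y] by (simp add: lcoeff_def tay_lin)
      have l1: "lcoeff u v ?c 1 [:x, y:] = smult (- y + (u + v) * y) ?q +
          [:u * ?c * x, - (u + v) * x + (u - (u + v)) * ?c * y:]" for u v x y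
        using tay_lin(2)[of x y] by (simp add: lcoeff_def tay_lin algebra_simps)
      have "\<gamma> = \<gamma>'"
        using coeff[of 3 ?X] p nz g by (simp add: l3 const)
      have q: "\<phi> j ?q = [:0, ?c * \<gamma>, - \<gamma>:]"
        using one_coeff(2)[of 1 j] g by (simp add: mult.commute)
      have 1: "(h - h0) * ?c * \<gamma> = (h0 + (b0 - 1)) * \<delta>"
      proof -
        have "\<phi> j (?l 1 [:1, 0:]) = ?m 1 [:\<gamma>, 0:]"
          using coeff[of 1 1] g by (simp add: one_pCons)
        then show ?thesis unfolding l1 s using \<open>\<gamma> = \<gamma>'\<close>
          by (simp add: lin2) algebra
      qed
      have 2: "(h - h0) * ?c * \<gamma> = - (h0 + (b0 - 1)) * \<delta>"
      proof -
        have "\<phi> j (?l 1 ?X) = ?m 1 [:\<delta>, \<gamma>:]"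
          using coeff[of 1 ?X] g \<open>\<gamma> = \<gamma>'\<close> by simp
        then show ?thesis unfolding l1 s add scale q lin2 using \<open>\<gamma> = \<gamma>'\<close>
          by simp algebra
      qed
      have "2 * ((h - h0) * ?c * \<gamma>) = 0" using 1 2 by algebra
      then show False using c g \<open>h \<noteq> h0\<close> by simp
    qed
    then show ?thesis using 2 s by auto
  qed
qed

end

section \<open>Loop modules and graded maps\<close>

lemma module_iso_trans:
  assumes "module_iso L M N" "module_iso L N P" shows "module_iso L M P"
proof -
  obtain f where f: "bij_betw f (rep_carrier M) (rep_carrier N)"
    "\<And>u v. u \<in> rep_carrier M \<Longrightarrow> v \<in> rep_carrier M \<Longrightarrow> f (u + v) = f u + f v"
    "\<And>c v. v \<in> rep_carrier M \<Longrightarrow> f (rep_scale M c v) = rep_scale N c (f v)"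
    "\<And>x v. x \<in> lie_carrier L \<Longrightarrow> v \<in> rep_carrier M \<Longrightarrow> f (rep_act M x v) = rep_act N x (f v)"
    using assms(1) unfolding module_iso_def by blast
  obtain g where g: "bij_betw g (rep_carrier N) (rep_carrier P)"
    "\<And>u v. u \<in> rep_carrier N \<Longrightarrow> v \<in> rep_carrier N \<Longrightarrow> g (u + v) = g u + g v"
    "\<And>c v. v \<in> rep_carrier N \<Longrightarrow> g (rep_scale N c v) = rep_scale P c (g v)"
    "\<And>x v. x \<in> lie_carrier L \<Longrightarrow> v \<in> rep_carrier N \<Longrightarrow> g (rep_act N x v) = rep_act P x (g v)"
    using assms(2) unfolding module_iso_def by blast
  have fin: "v \<in> rep_carrier M \<Longrightarrow> f v \<in> rep_carrier N" for v by (rule bij_betw_apply[OF f(1)])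
  show ?thesis unfolding module_iso_def
    by (rule exI[of _ "g \<circ> f"]) (auto simp: f g fin intro: bij_betw_trans[OF f(1) g(1)])
qed

text \<open>The graded subspace \<open>\<Oplus>\<^sub>j U\<^sub>j \<otimes> t\<^sup>j\<close> of a loop module.\<close>

definition loop_sub ::
  "('g, 'v::ab_group_add) rep \<Rightarrow> (int \<Rightarrow> int \<Rightarrow> 'v \<Rightarrow> 'v) \<Rightarrow> (int \<Rightarrow> 'v set) \<Rightarrow> (vir, int \<Rightarrow>\<^sub>0 'v) rep" where
  "loop_sub V D U = (loop_rep V D)\<lparr>rep_carrier := {f. \<forall>j. Poly_Mapping.lookup f j \<in> U j}\<rparr>"

lemma loop_sub_simps [simp]:
  "rep_carrier (loop_sub V D U) = {f. \<forall>j. Poly_Mapping.lookup f j \<in> U j}"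
  "rep_scale (loop_sub V D U) = pm_scale (rep_scale V)"
  "rep_act (loop_sub V D U) = rep_act (loop_rep V D)"
  by (simp_all add: loop_sub_def loop_rep_def)

lemma loop_rep_eq: "loop_rep V D = loop_sub V D (\<lambda>_. rep_carrier V)"
  by (simp add: loop_sub_def loop_rep_def)

lemma sum_singles: "(\<Sum>j\<in>Poly_Mapping.keys f. Poly_Mapping.single j (Poly_Mapping.lookup f j)) = f"
  by (rule poly_mapping_eqI) (auto simp: lookup_sum lookup_single when_def in_keys_iff)

lemma lookup_loop_act:
  assumes "vector_space (rep_scale V)" "\<And>k j. D k j 0 = 0"
  shows "Poly_Mapping.lookup (rep_act (loop_rep V D) x f) i =
    (\<Sum>k\<in>Poly_Mapping.keys (fst x). rep_scale V (Poly_Mapping.lookup (fst x) k) (D k (i - k) (Poly_Mapping.lookup f (i - k))))"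
proof -
  have "(\<Sum>j\<in>Poly_Mapping.keys f. Poly_Mapping.lookup (Poly_Mapping.single (k + j) (D k j (Poly_Mapping.lookup f j))) i) =
      D k (i - k) (Poly_Mapping.lookup f (i - k))" for k
  proof -
    have "(\<Sum>j\<in>Poly_Mapping.keys f. Poly_Mapping.lookup (Poly_Mapping.single (k + j) (D k j (Poly_Mapping.lookup f j))) i) =
        (\<Sum>j\<in>Poly_Mapping.keys f. if j = i - k then D k j (Poly_Mapping.lookup f j) else 0)"
      by (intro sum.cong refl) (auto simp: lookup_single when_def)
    then show ?thesis using assms(2) by (auto simp: sum.delta' in_keys_iff)
  qed
  then show ?thesis
    by (simp add: loop_rep_def lookup_sum lookup_pm_scale[OF assms(1)])
qed

lemma lookup_loop_act_d:
  assumes "vector_space (rep_scale V)" "\<And>k j. D k j 0 = 0"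
  shows "Poly_Mapping.lookup (rep_act (loop_rep V D) (vir_d k) f) i = D k (i - k) (Poly_Mapping.lookup f (i - k))"
proof -
  interpret vector_space "rep_scale V" by fact
  show ?thesis by (simp add: lookup_loop_act[where D = D, OF assms] vir_d_def)
qed

lemma loop_act_single:
  assumes "vector_space (rep_scale V)" "\<And>k j. D k j 0 = 0"
  shows "rep_act (loop_rep V D) (vir_d k) (Poly_Mapping.single j w) = Poly_Mapping.single (k + j) (D k j w)"
  by (rule poly_mapping_eqI)
    (auto simp: lookup_loop_act_d[where D = D, OF assms] lookup_single when_def assms(2))

lemma single_in_loop_sub:
  assumes "\<And>i. 0 \<in> U i"
  shows "Poly_Mapping.single j w \<in> {f. \<forall>i. Poly_Mapping.lookup f i \<in> U i} \<longleftrightarrow> w \<in> U j"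
  using assms by (auto simp: lookup_single when_def)

lemma pm_scale_single:
  assumes "vector_space s" shows "pm_scale s c (Poly_Mapping.single j w) = Poly_Mapping.single j (s c w)"
proof -
  interpret vector_space s by fact
  show ?thesis by (rule poly_mapping_eqI) (auto simp: lookup_pm_scale[OF assms] lookup_single when_def)
qed

definition graded_iso where
  "graded_iso s U D t U' D' \<phi> \<longleftrightarrow> (\<forall>j. bij_betw (\<phi> j) (U j) (U' j) \<and> lin_on s (U j) t (\<phi> j) \<and>
    (\<forall>k. \<forall>w\<in>U j. \<phi> (k + j) (D k j w) = D' k j (\<phi> j w)))"

lemma module_iso_if_graded_iso:
  assumes s: "vector_space (rep_scale V)" "\<And>j. module.subspace (rep_scale V) (U j)"
    and D0: "\<And>k j. D k j 0 = 0" "\<And>k j w. w \<in> U j \<Longrightarrow> D k j w \<in> U (k + j)"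
    and t: "vector_space (rep_scale V')" "\<And>j. module.subspace (rep_scale V') (U' j)"
    and D'0: "\<And>k j. D' k j 0 = 0"
    and g: "graded_iso (rep_scale V) U D (rep_scale V') U' D' \<phi>"
  shows "module_iso virasoro (loop_sub V D U) (loop_sub V' D' U')"
proof -
  interpret s: cvec "rep_scale V" by (rule cvec.intro, fact)
  interpret t: cvec "rep_scale V'" by (rule cvec.intro, fact)
  have bij: "bij_betw (\<phi> j) (U j) (U' j)" and lin: "lin_on (rep_scale V) (U j) (rep_scale V') (\<phi> j)"
    and inter: "w \<in> U j \<Longrightarrow> \<phi> (k + j) (D k j w) = D' k j (\<phi> j w)" for k j w
    using g by (auto simp: graded_iso_def)
  have zero: "0 \<in> U j" "0 \<in> U' j" for j using s.subspace_0[OF s(2)] t.subspace_0[OF t(2)] by auto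
  have phi0: "\<phi> j 0 = 0" for j by (rule lin_on_zero[OF lin zero(1)])
  define F where "F = Poly_Mapping.mapp \<phi>"
  have lF: "Poly_Mapping.lookup (F f) j = \<phi> j (Poly_Mapping.lookup f j)" for f j
    by (auto simp: F_def lookup_mapp when_def in_keys_iff phi0)
  let ?C = "{f. \<forall>j. Poly_Mapping.lookup f j \<in> U j}" and ?C' = "{f. \<forall>j. Poly_Mapping.lookup f j \<in> U' j}"
  have "bij_betw F ?C ?C'"
  proof (rule bij_betwI')
    fix f g assume fg: "f \<in> ?C" "g \<in> ?C"
    show "F f = F g \<longleftrightarrow> f = g"
    proof
      assume "F f = F g"
      then have "\<phi> j (Poly_Mapping.lookup f j) = \<phi> j (Poly_Mapping.lookup g j)" for j unfolding lF[symmetric] by simp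
      then have "Poly_Mapping.lookup f j = Poly_Mapping.lookup g j" for j
        using fg inj_onD[OF bij_betw_imp_inj_on[OF bij]] by blast
      then show "f = g" by (rule poly_mapping_eqI)
    qed simp
  next
    fix f assume "f \<in> ?C" then show "F f \<in> ?C'" using bij_betw_apply[OF bij] by (auto simp: lF)
  next
    fix g assume g: "g \<in> ?C'"
    define f where "f = Poly_Mapping.mapp (\<lambda>j. inv_into (U j) (\<phi> j)) g"
    have inv0: "inv_into (U j) (\<phi> j) 0 = 0" for j
      using inv_into_f_f[OF bij_betw_imp_inj_on[OF bij] zero(1), of j] phi0 by simp
    have lf: "Poly_Mapping.lookup f j = inv_into (U j) (\<phi> j) (Poly_Mapping.lookup g j)" for j
      by (auto simp: f_def lookup_mapp when_def in_keys_iff inv0)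
    have "f \<in> ?C" using g bij_betw_apply[OF bij_betw_inv_into[OF bij]] by (auto simp: lf)
    moreover have "g = F f"
      by (rule poly_mapping_eqI) (use g bij_betw_inv_into_right[OF bij] in \<open>auto simp: lF lf\<close>)
    ultimately show "\<exists>f\<in>?C. g = F f" by blast
  qed
  moreover have "F (f + g) = F f + F g" if "f \<in> ?C" "g \<in> ?C" for f g
    by (rule poly_mapping_eqI) (use that in \<open>simp add: lF lookup_add lin_on_add[OF lin]\<close>)
  moreover have "F (pm_scale (rep_scale V) c f) = pm_scale (rep_scale V') c (F f)" if "f \<in> ?C" for c f
    by (rule poly_mapping_eqI)
      (use that in \<open>simp add: lF lookup_pm_scale[OF s(1)] lookup_pm_scale[OF t(1)] lin_on_scale[OF lin]\<close>)
  moreover have "F (rep_act (loop_rep V D) x f) = rep_act (loop_rep V' D') x (F f)" if f: "f \<in> ?C" for x f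
  proof (rule poly_mapping_eqI)
    fix i
    have m: "D k (i - k) (Poly_Mapping.lookup f (i - k)) \<in> U i" for k
      using D0(2)[of "Poly_Mapping.lookup f (i - k)" "i - k" k] f by simp
    have "\<phi> i (D k (i - k) (Poly_Mapping.lookup f (i - k))) = D' k (i - k) (\<phi> (i - k) (Poly_Mapping.lookup f (i - k)))" for k
      using inter[of "Poly_Mapping.lookup f (i - k)" "i - k" k] f by simp
    then show "Poly_Mapping.lookup (F (rep_act (loop_rep V D) x f)) i = Poly_Mapping.lookup (rep_act (loop_rep V' D') x (F f)) i"
      unfolding lF lookup_loop_act[where D = D, OF s(1) D0(1)] lookup_loop_act[where D = D', OF t(1) D'0]
      by (subst lin_on_sum[OF s(1) s(2) lin])
        (auto intro!: s.subspace_scale[OF s(2)] m simp: lin_on_scale[OF lin m])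
  qed
  ultimately show ?thesis unfolding module_iso_def by (intro exI[of _ F]) auto
qed

text \<open>The eigenvalues of \<open>d\<^sub>0\<close> recover the grading, so every isomorphism is graded.\<close>

lemma graded_iso_if_module_iso:
  assumes iso: "module_iso virasoro (loop_sub V D U) (loop_sub V' D' U')"
    and s: "vector_space (rep_scale V)" "\<And>j. module.subspace (rep_scale V) (U j)"
    and D0: "\<And>k j. D k j 0 = 0" "\<And>j w. w \<in> U j \<Longrightarrow> D 0 j w = rep_scale V (a + of_int j) w"
    and t: "vector_space (rep_scale V')" "\<And>j. module.subspace (rep_scale V') (U' j)"
    and D'0: "\<And>k j. D' k j 0 = 0" "\<And>j w. w \<in> U' j \<Longrightarrow> D' 0 j w = rep_scale V' (a' + of_int j) w"
    and nz: "\<exists>j. \<exists>w\<in>U j. w \<noteq> 0"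
    and Re: "0 \<le> Re a" "Re a < 1" "0 \<le> Re a'" "Re a' < 1"
  shows "a = a'" "\<exists>\<phi>. graded_iso (rep_scale V) U D (rep_scale V') U' D' \<phi>"
proof -
  interpret s: cvec "rep_scale V" by (rule cvec.intro, fact)
  interpret t: cvec "rep_scale V'" by (rule cvec.intro, fact)
  let ?C = "{f. \<forall>j. Poly_Mapping.lookup f j \<in> U j}" and ?C' = "{f. \<forall>j. Poly_Mapping.lookup f j \<in> U' j}"
  obtain f where bij: "bij_betw f ?C ?C'"
    and add: "\<And>u v. u \<in> ?C \<Longrightarrow> v \<in> ?C \<Longrightarrow> f (u + v) = f u + f v"
    and scale: "\<And>c v. v \<in> ?C \<Longrightarrow> f (pm_scale (rep_scale V) c v) = pm_scale (rep_scale V') c (f v)"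
    and act: "\<And>x v. v \<in> ?C \<Longrightarrow> f (rep_act (loop_rep V D) x v) = rep_act (loop_rep V' D') x (f v)"
    using iso unfolding module_iso_def by (auto simp: virasoro_def)
  have zero: "0 \<in> U j" "0 \<in> U' j" for j using s.subspace_0[OF s(2)] t.subspace_0[OF t(2)] by auto
  have sC: "Poly_Mapping.single j w \<in> ?C" if "w \<in> U j" for j w
    by (subst single_in_loop_sub) (use that zero in auto)
  have sC': "Poly_Mapping.single j w \<in> ?C'" if "w \<in> U' j" for j w
    by (subst single_in_loop_sub) (use that zero in auto)
  have fC: "f u \<in> ?C'" if "u \<in> ?C" for u using bij_betw_apply[OF bij that] .
  have inj: "f u = f v \<longleftrightarrow> u = v" if "u \<in> ?C" "v \<in> ?C" for u v
    using inj_on_eq_iff[OF bij_betw_imp_inj_on[OF bij] that] .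
  have f0: "f 0 = 0" using add[of 0 0] zero by simp
  have d0: "rep_act (loop_rep V D) (vir_d 0) (Poly_Mapping.single j w) = pm_scale (rep_scale V) (a + of_int j) (Poly_Mapping.single j w)"
    if "w \<in> U j" for j w
    using that by (simp add: loop_act_single[where D = D, OF s(1) D0(1)] D0(2) pm_scale_single[OF s(1)])
  have key: "a' + of_int i = a + of_int j" if w: "w \<in> U j" "Poly_Mapping.lookup (f (Poly_Mapping.single j w)) i \<noteq> 0" for i j w
  proof -
    let ?v = "Poly_Mapping.lookup (f (Poly_Mapping.single j w)) i"
    have v: "?v \<in> U' i" using fC[OF sC[OF w(1)]] by simp
    have "rep_act (loop_rep V' D') (vir_d 0) (f (Poly_Mapping.single j w)) = pm_scale (rep_scale V') (a + of_int j) (f (Poly_Mapping.single j w))"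
      using act[OF sC[OF w(1)], of "vir_d 0"] scale[OF sC[OF w(1)]] d0[OF w(1)] by simp
    then have "Poly_Mapping.lookup (rep_act (loop_rep V' D') (vir_d 0) (f (Poly_Mapping.single j w))) i =
      Poly_Mapping.lookup (pm_scale (rep_scale V') (a + of_int j) (f (Poly_Mapping.single j w))) i" by simp
    then have "rep_scale V' (a' + of_int i) ?v = rep_scale V' (a + of_int j) ?v"
      by (simp add: lookup_loop_act_d[where D = D', OF t(1) D'0(1)] lookup_pm_scale[OF t(1)] D'0(2)[OF v])
    then show ?thesis using w(2) by simp
  qed
  obtain j0 w0 where w0: "w0 \<in> U j0" "w0 \<noteq> 0" using nz by blast
  have "Poly_Mapping.single j0 w0 \<noteq> 0" using w0 by (metis lookup_single_eq lookup_zero)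
  then have "f (Poly_Mapping.single j0 w0) \<noteq> 0" using inj[OF sC[OF w0(1)], of 0] zero f0 by auto
  then obtain i0 where "Poly_Mapping.lookup (f (Poly_Mapping.single j0 w0)) i0 \<noteq> 0"
    by (metis poly_mapping_eqI lookup_zero)
  then have e: "a' + of_int i0 = a + of_int j0" by (rule key[OF w0(1)])
  then have "Re a' + of_int i0 = Re a + of_int j0" "Im a' = Im a"
    by (metis plus_complex.sel(1) Re_complex_of_real of_real_of_int_eq, metis plus_complex.sel(2) Im_complex_of_real of_real_of_int_eq add.right_neutral)
  moreover from this have "i0 = j0" using Re by linarith
  ultimately show aa: "a = a'" by (simp add: complex_eq_iff)
  define \<phi> where "\<phi> = (\<lambda>j w. Poly_Mapping.lookup (f (Poly_Mapping.single j w)) j)"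
  have fs: "f (Poly_Mapping.single j w) = Poly_Mapping.single j (\<phi> j w)" if w: "w \<in> U j" for j w
  proof (rule poly_mapping_eqI)
    fix i show "Poly_Mapping.lookup (f (Poly_Mapping.single j w)) i = Poly_Mapping.lookup (Poly_Mapping.single j (\<phi> j w)) i"
      using key[OF w, of i] aa by (auto simp: \<phi>_def lookup_single when_def)
  qed
  have phiU: "\<phi> j w \<in> U' j" if "w \<in> U j" for j w
    using fC[OF sC[OF that]] by (simp add: \<phi>_def)
  have "graded_iso (rep_scale V) U D (rep_scale V') U' D' \<phi>"
    unfolding graded_iso_def
  proof (intro allI conjI ballI)
    fix j
    show "bij_betw (\<phi> j) (U j) (U' j)"
    proof (rule bij_betwI')
      fix u v assume uv: "u \<in> U j" "v \<in> U j"
      show "\<phi> j u = \<phi> j v \<longleftrightarrow> u = v"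
      proof
        assume "\<phi> j u = \<phi> j v"
        then have "Poly_Mapping.single j u = Poly_Mapping.single j v"
          using inj[OF sC[OF uv(1)] sC[OF uv(2)]] fs[OF uv(1)] fs[OF uv(2)] by simp
        then show "u = v" by (metis lookup_single_eq)
      qed simp
    next
      fix v assume v: "v \<in> U' j"
      then obtain u where u: "u \<in> ?C" "Poly_Mapping.single j v = f u"
        using sC'[OF v] unfolding bij_betw_imp_surj_on[OF bij, symmetric] by blast
      have "rep_act (loop_rep V' D') (vir_d 0) (Poly_Mapping.single j v) = pm_scale (rep_scale V') (a + of_int j) (Poly_Mapping.single j v)"
        using v aa by (simp add: loop_act_single[where D = D', OF t(1) D'0(1)] D'0(2) pm_scale_single[OF t(1)])
      then have "f (rep_act (loop_rep V D) (vir_d 0) u) = f (pm_scale (rep_scale V) (a + of_int j) u)"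
        using u by (simp add: act scale)
      moreover have "rep_act (loop_rep V D) (vir_d 0) u \<in> ?C"
        using u s.subspace_scale[OF s(2)] by (auto simp: lookup_loop_act_d[where D = D, OF s(1) D0(1)] D0(2))
      moreover have "pm_scale (rep_scale V) (a + of_int j) u \<in> ?C"
        using u s.subspace_scale[OF s(2)] by (auto simp: lookup_pm_scale[OF s(1)])
      ultimately have eq: "rep_act (loop_rep V D) (vir_d 0) u = pm_scale (rep_scale V) (a + of_int j) u"
        using inj by blast
      have "Poly_Mapping.lookup u i = Poly_Mapping.lookup (Poly_Mapping.single j (Poly_Mapping.lookup u j)) i" for i
      proof -
        have "rep_scale V (a + of_int i) (Poly_Mapping.lookup u i) = rep_scale V (a + of_int j) (Poly_Mapping.lookup u i)"
          using arg_cong[OF eq, of "\<lambda>f. Poly_Mapping.lookup f i"] u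
          by (simp add: lookup_loop_act_d[where D = D, OF s(1) D0(1)] D0(2) lookup_pm_scale[OF s(1)])
        then show ?thesis by (auto simp: lookup_single when_def)
      qed
      then have us: "u = Poly_Mapping.single j (Poly_Mapping.lookup u j)" by (rule poly_mapping_eqI)
      then have "Poly_Mapping.single j v = Poly_Mapping.single j (\<phi> j (Poly_Mapping.lookup u j))"
        using fs[of "Poly_Mapping.lookup u j" j] u by simp
      then have "v = \<phi> j (Poly_Mapping.lookup u j)" by (metis lookup_single_eq)
      then show "\<exists>w\<in>U j. v = \<phi> j w" using u by auto
    qed (rule phiU)
    show "lin_on (rep_scale V) (U j) (rep_scale V') (\<phi> j)"
    proof (rule lin_onI)
      show "\<phi> j (u + v) = \<phi> j u + \<phi> j v" if "u \<in> U j" "v \<in> U j" for u v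
        using add[OF sC[OF that(1)] sC[OF that(2)]] by (simp add: \<phi>_def single_add lookup_add)
      show "\<phi> j (rep_scale V c v) = rep_scale V' c (\<phi> j v)" if "v \<in> U j" for c v
        using scale[OF sC[OF that], of c]
        by (simp add: \<phi>_def pm_scale_single[OF s(1)] lookup_pm_scale[OF t(1)])
    qed
    fix k w assume w: "w \<in> U j"
    have "f (Poly_Mapping.single (k + j) (D k j w)) = Poly_Mapping.single (k + j) (D' k j (\<phi> j w))"
      using act[OF sC[OF w], of "vir_d k"] by (simp add: loop_act_single[where D = D, OF s(1) D0(1)] loop_act_single[where D = D', OF t(1) D'0(1)] fs[OF w])
    then show "\<phi> (k + j) (D k j w) = D' k j (\<phi> j w)" by (simp add: \<phi>_def)
  qed
  then show "\<exists>\<phi>. graded_iso (rep_scale V) U D (rep_scale V') U' D' \<phi>" by blast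
qed

lemma graded_iso_comp:
  assumes f: "graded_iso s U D t U' D' \<phi>" and g: "graded_iso t U' D' r U'' D'' \<psi>"
  shows "graded_iso s U D r U'' D'' (\<lambda>j. \<psi> j \<circ> \<phi> j)"
proof -
  have fin: "\<phi> j w \<in> U' j" if "w \<in> U j" for j w
    using f that bij_betw_apply unfolding graded_iso_def by metis
  show ?thesis
    using f g fin unfolding graded_iso_def lin_on_def
    by (auto intro: bij_betw_trans)
qed

subsection \<open>Isomorphisms of modules over the derivations\<close>

definition witt_iso where
  "witt_iso s V d t V0 e f \<longleftrightarrow> bij_betw f V V0 \<and> lin_on s V t f \<and> (\<forall>i. \<forall>w\<in>V. f (d i w) = e i (f w))"

lemma witt_iso_comp:
  assumes "witt_iso s V d t V0 e f" "witt_iso t V0 e r V1 c g"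
  shows "witt_iso s V d r V1 c (g \<circ> f)"
proof -
  have "f w \<in> V0" if "w \<in> V" for w
    using assms(1) that bij_betw_apply unfolding witt_iso_def by metis
  then show ?thesis
    using assms unfolding witt_iso_def lin_on_def by (auto intro: bij_betw_trans)
qed

lemma lin_on_inv_into:
  assumes s: "vector_space s" "module.subspace s U" and bij: "bij_betw f U U'" and lin: "lin_on s U t f"
  shows "lin_on t U' s (inv_into U f)"
proof -
  interpret vector_space s by fact
  note inv = bij_betw_apply[OF bij_betw_inv_into[OF bij]] bij_betw_inv_into_right[OF bij]
    bij_betw_inv_into_left[OF bij]
  show ?thesis
  proof (rule lin_onI)
    fix u v assume uv: "u \<in> U'" "v \<in> U'"
    let ?x = "inv_into U f u + inv_into U f v"
    have "?x \<in> U" by (intro subspace_add[OF s(2)] inv(1) uv)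
    moreover have "f ?x = u + v" using uv by (simp add: lin_on_add[OF lin] inv)
    ultimately show "inv_into U f (u + v) = ?x" using inv(3) by metis
  next
    fix c v assume v: "v \<in> U'"
    have "s c (inv_into U f v) \<in> U" by (intro subspace_scale[OF s(2)] inv(1) v)
    moreover have "f (s c (inv_into U f v)) = t c v" using v by (simp add: lin_on_scale[OF lin] inv)
    ultimately show "inv_into U f (t c v) = s c (inv_into U f v)" using inv(3) by metis
  qed
qed

lemma witt_iso_inv:
  assumes "vector_space s" "module.subspace s V" "\<And>i w. w \<in> V \<Longrightarrow> d i w \<in> V"
    and f: "witt_iso s V d t V0 e f"
  shows "witt_iso t V0 e s V d (inv_into V f)"
proof -
  have bij: "bij_betw f V V0" and lin: "lin_on s V t f" and hom: "\<And>i w. w \<in> V \<Longrightarrow> f (d i w) = e i (f w)"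
    using f by (auto simp: witt_iso_def)
  note inv = bij_betw_apply[OF bij_betw_inv_into[OF bij]] bij_betw_inv_into_right[OF bij]
    bij_betw_inv_into_left[OF bij]
  have "inv_into V f (e i w) = d i (inv_into V f w)" if w: "w \<in> V0" for i w
  proof -
    have "d i (inv_into V f w) \<in> V" by (intro assms(3) inv(1) w)
    moreover have "f (d i (inv_into V f w)) = e i w" using w by (simp add: hom inv)
    ultimately show ?thesis using inv(3) by metis
  qed
  then show ?thesis unfolding witt_iso_def
    using bij_betw_inv_into[OF bij] lin_on_inv_into[OF assms(1,2) bij lin] by blast
qed

lemma witt_iso_Lop:
  assumes "witt_rep s V d" "witt_rep t V0 e" and f: "witt_iso s V d t V0 e f" and w: "w \<in> V"
  shows "f (witt_rep.Lop s d lam a b k j w) = witt_rep.Lop t e lam a b k j (f w)"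
proof -
  interpret W: witt_rep s V d by fact
  interpret W0: witt_rep t V0 e by fact
  have bij: "bij_betw f V V0" and lin: "lin_on s V t f" and hom: "\<And>i w. w \<in> V \<Longrightarrow> f (d i w) = e i (f w)"
    using f by (auto simp: witt_iso_def)
  have fw: "f w \<in> V0" by (rule bij_betw_apply[OF bij w])
  obtain n where n: "\<forall>i\<ge>n. d i w = 0" using W.d_fin[OF w] by blast
  then have n': "\<forall>i\<ge>n. e i (f w) = 0"
    using hom[OF w] lin_on_zero[OF lin W.V_0] by metis
  have "W.E k w = (\<Sum>i<n. s (of_int k ^ i) (s (1 / fact i) (d i w)))"
    by (rule W.E_eq) (use n in blast)
  moreover have "W0.E k (f w) = (\<Sum>i<n. t (of_int k ^ i) (t (1 / fact i) (e i (f w))))"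
    by (rule W0.E_eq) (use n' in blast)
  ultimately have E: "f (W.E k w) = W0.E k (f w)"
    by (simp add: lin_on_sum[OF W.vector_space_axioms W.sub lin] lin_on_scale[OF lin] w hom
        del: W.scale_scale W0.scale_scale)
  show ?thesis
    unfolding W.Lop_def W0.Lop_def W.Aff_def W0.Aff_def using w
    by (simp add: lin_on_add[OF lin] lin_on_diff[OF lin] lin_on_scale[OF lin] E hom)
qed

lemma module_iso_if_witt_iso:
  assumes M: "lie_module witt W" "lie_module witt W0"
    and f: "witt_iso (rep_scale W) (rep_carrier W) (wact W) (rep_scale W0) (rep_carrier W0) (wact W0) f"
  shows "module_iso witt W W0"
proof -
  interpret W: witt_pre "rep_scale W" "rep_carrier W" "wact W" by (rule witt_pre_if_module[OF M(1)])
  have bij: "bij_betw f (rep_carrier W) (rep_carrier W0)"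
    and lin: "lin_on (rep_scale W) (rep_carrier W) (rep_scale W0) f"
    and hom: "\<And>i w. w \<in> rep_carrier W \<Longrightarrow> f (wact W i w) = wact W0 i (f w)"
    using f by (auto simp: witt_iso_def)
  have "f (rep_act W p w) = rep_act W0 p (f w)" if w: "w \<in> rep_carrier W" for p w
    unfolding act_monoms[OF M(1) w, of p] act_monoms[OF M(2) bij_betw_apply[OF bij w], of p]
    by (subst lin_on_sum[OF W.vector_space_axioms W.sub lin]) (simp_all add: w lin_on_scale[OF lin] hom)
  then show ?thesis unfolding module_iso_def
    using bij lin by (intro exI[of _ f]) (auto simp: lin_on_def)
qed

lemma witt_iso_if_module_iso:
  assumes "module_iso witt W W0"
  shows "\<exists>f. witt_iso (rep_scale W) (rep_carrier W) (wact W) (rep_scale W0) (rep_carrier W0) (wact W0) f"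
  using assms unfolding module_iso_def witt_iso_def lin_on_def by (auto simp: witt_def)

subsection \<open>Loop modules of isomorphic modules\<close>

abbreviation lop where "lop W \<equiv> witt_rep.Lop (rep_scale W) (wact W)"

lemma L_mod_eq:
  assumes "witt_rep (rep_scale W) (rep_carrier W) (wact W)"
  shows "L_mod W lam a b = loop_sub W (lop W lam a b) (\<lambda>_. rep_carrier W)"
proof -
  interpret W: witt_rep "rep_scale W" "rep_carrier W" "wact W" by fact
  have "rep_act W (witt_d (- 1)) = wact W 0" using witt_d_monom[of 0] by simp
  moreover have "exp_act W k w = W.E k w" for k w
    by (simp add: exp_act_def W.E_def witt_d_monom)
  ultimately show ?thesis
    unfolding L_mod_def loop_rep_eq by (simp add: W.Lop_def[abs_def] W.Aff_def add_diff_eq diff_add_eq)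
qed

lemma (in witt_rep) Lop_facts:
  "Lop lam a b k j 0 = 0" "w \<in> V \<Longrightarrow> Lop lam a b 0 j w = s (a + of_int j) w"
  by (simp_all add: Lop_def Aff_def)

lemma L_mod_iso_if_witt_iso:
  assumes W: "witt_rep (rep_scale W) (rep_carrier W) (wact W)"
    and W0: "witt_rep (rep_scale W0) (rep_carrier W0) (wact W0)"
    and f: "witt_iso (rep_scale W) (rep_carrier W) (wact W) (rep_scale W0) (rep_carrier W0) (wact W0) f"
  shows "module_iso virasoro (L_mod W lam a b) (L_mod W0 lam a b)"
proof -
  interpret W: witt_rep "rep_scale W" "rep_carrier W" "wact W" by fact
  interpret W0: witt_rep "rep_scale W0" "rep_carrier W0" "wact W0" by fact
  show ?thesis unfolding L_mod_eq[OF W] L_mod_eq[OF W0]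
  proof (rule module_iso_if_graded_iso[where \<phi> = "\<lambda>_. f"])
    show "graded_iso (rep_scale W) (\<lambda>_. rep_carrier W) (W.Lop lam a b) (rep_scale W0)
     (\<lambda>_. rep_carrier W0) (W0.Lop lam a b) (\<lambda>_. f)"
      unfolding graded_iso_def using f witt_iso_Lop[OF W W0 f] by (simp add: witt_iso_def)
  qed (simp_all add: W.vector_space_axioms W0.vector_space_axioms W.sub W0.sub W.Lop_facts W0.Lop_facts)
qed

lemma verma_witt_rep: "witt_rep (rep_scale (verma c)) (rep_carrier (verma c)) (vact c)"
  by (simp add: verma.witt_rep_axioms)

lemma L_mod_verma_flip:
  assumes "lam \<noteq> 0"
  shows "module_iso virasoro (L_mod (verma h) lam a (h0 + 1)) (L_mod (verma h0) (inverse lam) a (h + 1))"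
  unfolding L_mod_eq[OF verma_witt_rep]
proof (rule module_iso_if_graded_iso[where \<phi> = "flip lam a"])
  show "graded_iso (rep_scale (verma h)) (\<lambda>_. rep_carrier (verma h)) (lop (verma h) lam a (h0 + 1))
     (rep_scale (verma h0)) (\<lambda>_. rep_carrier (verma h0)) (lop (verma h0) (inverse lam) a (h + 1)) (flip lam a)"
    unfolding graded_iso_def using flip_bij[OF assms] flip_lin flip_Lop[OF assms] by simp
qed (simp_all add: poly_vs.vector_space_axioms verma.Lop_facts)

text \<open>The isomorphism extends \<open>1 \<mapsto> w\<close>, and \<open>W\<close> inherits local finiteness from the Verma module through it.\<close>

lemma verma_iso_if_highest_weight_module:
  assumes hw: "highest_weight_module W w c" and c: "c \<noteq> 0"
  shows "\<exists>f. witt_iso smult UNIV (vact c) (rep_scale W) (rep_carrier W) (wact W) f \<and> f 1 = w"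
    and "witt_rep (rep_scale W) (rep_carrier W) (wact W)"
proof -
  have mod: "lie_module witt W" using hw by (simp add: highest_weight_module_def)
  interpret W: witt_pre "rep_scale W" "rep_carrier W" "wact W" by (rule witt_pre_if_module[OF mod])
  have w: "w \<in> rep_carrier W" "w \<noteq> 0" "wact W 1 w = rep_scale W c w"
    using hw witt_d_monom[of 1] by (simp_all add: highest_weight_module_def highest_weight_vector_def)
  have z: "wact W i w = 0" if "i \<ge> 2" for i
    using hw witt_d_monom[of i] that unfolding highest_weight_module_def highest_weight_vector_def
    by (metis diff_gt_0_iff_gt less_le_trans numeral_2_eq_2 lessI of_nat_1 of_nat_less_iff One_nat_def)
  obtain f where f: "bij_betw f UNIV (rep_carrier W)" "lin_on smult UNIV (rep_scale W) f"
    "\<forall>i p. f (vact c i p) = wact W i (f p)" "f 1 = w"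
    using W.iso_verma[OF w(1,2) c w(3) z] hw submodule_iff_stable[OF mod]
    unfolding highest_weight_module_def by metis
  then show "\<exists>f. witt_iso smult UNIV (vact c) (rep_scale W) (rep_carrier W) (wact W) f \<and> f 1 = w"
    unfolding witt_iso_def by blast
  show "witt_rep (rep_scale W) (rep_carrier W) (wact W)"
  proof
    fix u assume "u \<in> rep_carrier W"
    then obtain p where p: "u = f p" using f(1) by (auto simp: bij_betw_def)
    obtain n where "\<forall>i\<ge>n. vact c i p = 0" using verma.d_fin by blast
    then have "\<forall>i\<ge>n. wact W i u = 0" using f(3) lin_on_zero[OF f(2)] p by (metis UNIV_I)
    then show "\<exists>n. \<forall>i\<ge>n. wact W i u = 0" by blast
  qed
qed

lemma highest_weight_module_if_simple:
  assumes "lie_module witt W" "simple_module witt W" "w \<in> rep_carrier W" "w \<noteq> 0"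
    "wact W 1 w = rep_scale W h w" "\<And>i. i \<ge> 2 \<Longrightarrow> wact W i w = 0"
  shows "highest_weight_module W w h"
  unfolding highest_weight_module_def highest_weight_vector_def
proof (intro conjI allI impI)
  show "rep_act W (witt_d 0) w = rep_scale W h w" using assms(5) witt_d_monom[of 1] by simp
  show "rep_act W (witt_d i) w = 0" if "i > 0" for i
    using assms(6)[of "nat (i + 1)"] that by (simp add: witt_d_def)
  show "S = rep_carrier W" if "submodule witt W S \<and> w \<in> S" for S
    using assms(2,4) that unfolding simple_module_def by blast
qed (use assms in auto)

lemma highest_weight_module_if_verma_iso:
  assumes W: "category_O witt W" "simple_module witt W"
    and f: "witt_iso smult UNIV (vact h) (rep_scale W) (rep_carrier W) (wact W) f"
  shows "highest_weight_module W (f 1) h"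
proof -
  have bij: "bij_betw f UNIV (rep_carrier W)" and lin: "lin_on smult UNIV (rep_scale W) f"
    and hom: "\<And>i p. f (vact h i p) = wact W i (f p)"
    using f by (auto simp: witt_iso_def)
  show ?thesis
  proof (rule highest_weight_module_if_simple)
    show "f 1 \<noteq> 0"
      using inj_on_eq_iff[OF bij_betw_imp_inj_on[OF bij], of 1 0] lin_on_zero[OF lin] by simp
    show "wact W 1 (f 1) = rep_scale W h (f 1)"
      using hom[of 1 1] vact_1_const[of h 1] lin_on_scale[OF lin, of 1 h] by (simp add: one_pCons)
    show "wact W i (f 1) = 0" if "i \<ge> 2" for i
      using hom[of i 1] vact_const[OF that, of h 1] lin_on_zero[OF lin] by (simp add: one_pCons)
  qed (use W bij_betw_apply[OF bij] in \<open>auto simp: category_O_def\<close>)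
qed

subsection \<open>The submodules for \<open>\<lambda> = -1\<close>\<close>

text \<open>The weight spaces of the two submodules are the eigenspaces of the reflection.\<close>

definition refl_space :: "int \<Rightarrow> complex \<Rightarrow> int \<Rightarrow> complex poly set" where
  "refl_space p a j = {v. pcompose v [:a + of_int j, - 1:] = smult ((- 1) powi (j + p)) v}"

lemma refl_space_flip: "v \<in> refl_space p a j \<longleftrightarrow> flip (- 1) a j v = smult ((- 1) powi p) v"
proof -
  have pw: "(- 1) powi (- j) * (- 1) powi (j + p) = ((- 1) powi p :: complex)"
    "(- 1) powi j * (- 1) powi (- j) = (1 :: complex)"
    "(- 1) powi j * (- 1) powi p = ((- 1) powi (j + p) :: complex)"
    by (subst power_int_add[symmetric]; simp)+
  have "u = smult ((- 1) powi (j + p)) v" if "smult ((- 1) powi (- j)) u = smult ((- 1) powi p) v" for u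
  proof -
    have "smult ((- 1) powi j) (smult ((- 1) powi (- j)) u) = smult ((- 1) powi j) (smult ((- 1) powi p) v)"
      by (simp only: that)
    then show ?thesis by (simp only: smult_smult pw smult_1_left)
  qed
  moreover have "smult ((- 1) powi (- j)) u = smult ((- 1) powi p) v" if "u = smult ((- 1) powi (j + p)) v" for u
    unfolding that by (simp only: smult_smult pw)
  ultimately show ?thesis unfolding refl_space_def flip_def by blast
qed

lemma refl_space_subspace: "poly_vs.subspace (refl_space p a j)"
  by (rule poly_vs.subspaceI) (auto simp: refl_space_def pcompose_add pcompose_smult smult_add_right mult.commute)

lemma refl_space_Lop:
  assumes "v \<in> refl_space p a j"
  shows "verma.Lop c (- 1) a (c + 1) k j v \<in> refl_space p a (k + j)"
proof -
  have "flip (- 1) a (k + j) (verma.Lop c (- 1) a (c + 1) k j v) = verma.Lop c (- 1) a (c + 1) k j (flip (- 1) a j v)"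
    using flip_Lop[of "- 1" a k j c c v] by simp
  then show ?thesis
    using assms unfolding refl_space_flip by (simp add: lin_on_scale[OF verma.Lop_lin])
qed

lemma const_in_refl_space:
  assumes "e \<noteq> 0" shows "[:e:] \<in> refl_space p a j \<longleftrightarrow> even (j + p)"
  using assms by (auto simp: refl_space_def power_int_minus_left)

lemma degree_refl_space:
  assumes v: "v \<in> refl_space p a j" "v \<noteq> 0"
  shows "even (int (degree v)) \<longleftrightarrow> even (j + p)"
proof -
  have "lead_coeff (pcompose v [:a + of_int j, - 1:]) = lead_coeff v * (- 1) ^ degree v"
    by (subst lead_coeff_comp) auto
  moreover have "lead_coeff (pcompose v [:a + of_int j, - 1:]) = (- 1) powi (j + p) * lead_coeff v"
    using v(1) by (simp add: refl_space_def)
  ultimately have "(- 1) ^ degree v = ((- 1) powi (j + p) :: complex)" using v(2) by simp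
  then show ?thesis by (auto simp: power_int_minus_left minus_one_power_iff split: if_splits)
qed

text \<open>Each application of \<open>d\<^sub>1\<close> raises the degree by one, so the given generators span the eigenspaces.\<close>

lemma generator_degree:
  assumes "even (m + p)"
  shows "\<exists>u. ((rep_act (loop_rep (verma c) (verma.Lop c (- 1) a (c + 1))) (vir_d 1) ^^ i) (Poly_Mapping.single m 1)) =
      Poly_Mapping.single (m + int i) u \<and> u \<in> refl_space p a (m + int i) \<and> u \<noteq> 0 \<and> degree u = i"
proof (induction i)
  case 0
  have "[:1:] \<in> refl_space p a m" using const_in_refl_space[of 1 p a m] assms by simp
  then show ?case by (intro exI[of _ 1]) (simp add: one_pCons)
next
  case (Suc i)
  then obtain u where u: "(rep_act (loop_rep (verma c) (verma.Lop c (- 1) a (c + 1))) (vir_d 1) ^^ i) (Poly_Mapping.single m 1) =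
      Poly_Mapping.single (m + int i) u" "u \<in> refl_space p a (m + int i)" "u \<noteq> 0" "degree u = i" by blast
  let ?v = "verma.Lop c (- 1) a (c + 1) 1 (m + int i) u"
  let ?r = "a + (c + 1) + of_int (m + int i)"
  have deg: "degree (pcompose u [:- 1, 1:]) = i" "lead_coeff (pcompose u [:- 1, 1:]) = lead_coeff u"
    using u(4) lead_coeff_comp[of "[:- 1, 1:]" u] by (simp_all add: degree_pcompose)
  have v: "?v = - ([:c, 1:] * pcompose u [:- 1, 1:]) + [:?r, - 1:] * u"
    by (simp add: verma_Lop del: mult_pCons_left)
  have "coeff ?v (Suc i) = - 2 * lead_coeff u"
    unfolding v using deg u(4) by (simp add: coeff_eq_0)
  moreover have "degree ?v \<le> Suc i"
    unfolding v using deg u(4)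
    by (intro degree_add_le) (auto intro!: degree_mult_le[THEN order_trans] simp del: mult_pCons_left)
  ultimately have "degree ?v = Suc i" "?v \<noteq> 0"
    using u(3) le_degree[of ?v "Suc i"] by auto
  moreover have "?v \<in> refl_space p a (m + int (Suc i))"
    using refl_space_Lop[OF u(2), of c 1] by (simp add: algebra_simps)
  moreover have "(rep_act (loop_rep (verma c) (verma.Lop c (- 1) a (c + 1))) (vir_d 1) ^^ Suc i) (Poly_Mapping.single m 1) =
      Poly_Mapping.single (m + int (Suc i)) ?v"
  proof -
    have "rep_act (loop_rep (verma c) (verma.Lop c (- 1) a (c + 1))) (vir_d 1) (Poly_Mapping.single (m + int i) u) =
        Poly_Mapping.single (1 + (m + int i)) ?v"
      by (rule loop_act_single) (simp_all add: poly_vs.vector_space_axioms verma.Lop_facts)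
    moreover have "1 + (m + int i) = m + int (Suc i)" by simp
    ultimately show ?thesis by (simp only: funpow.simps o_apply u(1))
  qed
  ultimately show ?case by blast
qed

text \<open>The model of \<open>\<L>\<^sub>p(a, c)\<close> inside the loop module over the Verma module.\<close>

definition refl_mod :: "int \<Rightarrow> complex \<Rightarrow> complex \<Rightarrow> (vir, int \<Rightarrow>\<^sub>0 complex poly) rep" where
  "refl_mod p a c = loop_sub (verma c) (verma.Lop c (- 1) a (c + 1)) (refl_space p a)"

text \<open>Every component of the reflection eigenspaces contains generators of all degrees of one parity, and no
  polynomials of the other parity, so induction on the degree shows that the generators span.\<close>

lemma L_parity_verma: "L_parity_mod p (verma c) 1 a c = refl_mod p a c"
proof -
  let ?act = "rep_act (loop_rep (verma c) (verma.Lop c (- 1) a (c + 1))) (vir_d 1)"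
  let ?G = "{(?act ^^ i) (Poly_Mapping.single (2 * j + p) 1) | (i::nat) (j::int). True}"
  let ?C = "{f. \<forall>j. Poly_Mapping.lookup f j \<in> refl_space p a j}"
  interpret pm: vector_space "pm_scale smult :: complex \<Rightarrow> (int \<Rightarrow>\<^sub>0 complex poly) \<Rightarrow> _"
    by (rule vector_space_pm_scale) (rule poly_vs.vector_space_axioms)
  note sub = poly_vs.subspace_0[OF refl_space_subspace] poly_vs.subspace_add[OF refl_space_subspace]
    poly_vs.subspace_scale[OF refl_space_subspace] poly_vs.subspace_diff[OF refl_space_subspace]
  note gen = generator_degree[where p = p and c = c and a = a]
  have "pm.span ?G = ?C"
  proof
    have "pm.subspace ?C"
      by (rule pm.subspaceI) (auto simp: lookup_add lookup_pm_scale[OF poly_vs.vector_space_axioms] intro: sub)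
    moreover have "?G \<subseteq> ?C"
    proof
      fix f assume "f \<in> ?G"
      then obtain i j where f: "f = (?act ^^ i) (Poly_Mapping.single (2 * j + p) 1)" by blast
      obtain u where "f = Poly_Mapping.single (2 * j + p + int i) u" "u \<in> refl_space p a (2 * j + p + int i)"
        using gen[where m = "2 * j + p" and i = i] f by auto
      then show "f \<in> ?C" by (auto simp: lookup_single when_def sub(1))
    qed
    ultimately show "pm.span ?G \<subseteq> ?C" by (rule pm.span_minimal[rotated])
  next
    have single: "Poly_Mapping.single j v \<in> pm.span ?G" if "v \<in> refl_space p a j" for j v
      using that
    proof (induction "if v = 0 then 0 else Suc (degree v)" arbitrary: v rule: less_induct)
      case less
      show ?case
      proof (cases "v = 0")
        case True
        then show ?thesis by (simp add: pm.span_zero)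
      next
        case False
        \<comment> \<open>the generator that starts at \<open>t\<^sup>m\<close> reaches \<open>t\<^sup>j\<close> with the degree of \<open>v\<close>\<close>
        define m where "m = j - int (degree v)"
        have mp: "even (m + p)" using degree_refl_space[OF less.prems False] by (auto simp: m_def)
        then have "even (m - p)" by presburger
        then obtain l where l: "m = 2 * l + p" by (metis add.commute diff_add_cancel evenE)
        have mj: "m + int (degree v) = j" by (simp add: m_def)
        obtain u where u: "(?act ^^ degree v) (Poly_Mapping.single m 1) = Poly_Mapping.single j u"
          "u \<in> refl_space p a j" "u \<noteq> 0" "degree u = degree v"
          using gen[OF mp, of "degree v"] unfolding mj by blast
        define w where "w = v - smult (lead_coeff v / lead_coeff u) u"
        have "coeff w (degree v) = 0" "degree w \<le> degree v"
          using u(3,4) leading_coeff_0_iff[of u] by (simp_all add: w_def degree_diff_le)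
        then have "w = 0 \<or> degree w < degree v"
          by (metis le_neq_implies_less leading_coeff_0_iff)
        moreover have "w \<in> refl_space p a j" unfolding w_def by (intro sub less.prems u(2))
        ultimately have "Poly_Mapping.single j w \<in> pm.span ?G"
          using less.hyps[of w] False by auto
        moreover have "Poly_Mapping.single j u \<in> pm.span ?G"
          unfolding u(1)[symmetric] l by (rule pm.span_base) blast
        ultimately have "Poly_Mapping.single j w + pm_scale smult (lead_coeff v / lead_coeff u) (Poly_Mapping.single j u) \<in> pm.span ?G"
          by (intro pm.span_add pm.span_scale)
        then show ?thesis
          by (simp add: pm_scale_single[OF poly_vs.vector_space_axioms] w_def flip: single_add)
      qed
    qed
    show "?C \<subseteq> pm.span ?G"
    proof
      fix f assume "f \<in> ?C"
      then have "(\<Sum>j\<in>Poly_Mapping.keys f. Poly_Mapping.single j (Poly_Mapping.lookup f j)) \<in> pm.span ?G"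
        by (intro pm.span_sum single) auto
      then show "f \<in> pm.span ?G" by (simp add: sum_singles)
    qed
  qed
  then show ?thesis
    unfolding L_parity_mod_def Let_def L_mod_eq[OF verma_witt_rep] refl_mod_def
    by (simp add: loop_sub_def loop_rep_def)
qed

text \<open>The isomorphism between \<open>W\<close> and the Verma module sends generators to generators.\<close>

lemma L_parity_iso:
  assumes hw: "highest_weight_module W w c" and c: "c \<noteq> 0"
  shows "module_iso virasoro (L_parity_mod p W w a c) (refl_mod p a c)"
    and "module_iso virasoro (refl_mod p a c) (L_parity_mod p W w a c)"
proof -
  have wr: "witt_rep (rep_scale W) (rep_carrier W) (wact W)"
    by (rule verma_iso_if_highest_weight_module(2)[OF hw c])
  interpret W: witt_rep "rep_scale W" "rep_carrier W" "wact W" by (rule wr)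
  obtain f where f: "witt_iso smult UNIV (vact c) (rep_scale W) (rep_carrier W) (wact W) f" "f 1 = w"
    using verma_iso_if_highest_weight_module(1)[OF hw c] by blast
  have bij: "bij_betw f UNIV (rep_carrier W)" and lin: "lin_on smult UNIV (rep_scale W) f"
    using f(1) by (auto simp: witt_iso_def)
  have inj: "inj f" using bij by (simp add: bij_betw_def)
  have f0: "f 0 = 0" by (rule lin_on_zero[OF lin]) simp
  let ?D = "verma.Lop c (- 1) a (c + 1)" and ?D' = "W.Lop (- 1) a (c + 1)"
  have inter: "f (?D k j v) = ?D' k j (f v)" for k j v
    by (rule witt_iso_Lop[OF verma.witt_rep_axioms wr f(1)]) simp
  let ?U = "refl_space p a" and ?U' = "\<lambda>j. f ` refl_space p a j"
  have subU': "W.subspace (?U' j)" for j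
  proof (rule W.subspaceI)
    show "0 \<in> ?U' j" using f0 poly_vs.subspace_0[OF refl_space_subspace] by (metis image_eqI)
    show "x + y \<in> ?U' j" if "x \<in> ?U' j" "y \<in> ?U' j" for x y
      using that poly_vs.subspace_add[OF refl_space_subspace]
      by (auto simp: lin_on_add[OF lin UNIV_I UNIV_I, symmetric])
    show "rep_scale W e x \<in> ?U' j" if "x \<in> ?U' j" for e x
      using that poly_vs.subspace_scale[OF refl_space_subspace]
      by (auto simp: lin_on_scale[OF lin UNIV_I, symmetric])
  qed
  have eq: "L_parity_mod p W w a c = loop_sub W ?D' ?U'"
  proof -
    define F where "F = Poly_Mapping.mapp (\<lambda>_::int. f)"
    have lF: "Poly_Mapping.lookup (F u) j = f (Poly_Mapping.lookup u j)" for u j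
      by (auto simp: F_def lookup_mapp when_def in_keys_iff f0)
    interpret pm: vector_space "pm_scale smult :: complex \<Rightarrow> (int \<Rightarrow>\<^sub>0 complex poly) \<Rightarrow> _"
      by (rule vector_space_pm_scale) (rule poly_vs.vector_space_axioms)
    interpret pm': vector_space "pm_scale (rep_scale W) :: complex \<Rightarrow> (int \<Rightarrow>\<^sub>0 'a) \<Rightarrow> _"
      by (rule vector_space_pm_scale) (rule W.vector_space_axioms)
    interpret F: module_hom "pm_scale smult :: complex \<Rightarrow> (int \<Rightarrow>\<^sub>0 complex poly) \<Rightarrow> _" "pm_scale (rep_scale W)" F
    proof
      show "F (u + v) = F u + F v" for u v
        by (rule poly_mapping_eqI) (simp add: lF lookup_add lin_on_add[OF lin])
      show "F (pm_scale smult r u) = pm_scale (rep_scale W) r (F u)" for r u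
        by (rule poly_mapping_eqI) (simp add: lF lookup_pm_scale[OF poly_vs.vector_space_axioms]
            lookup_pm_scale[OF W.vector_space_axioms] lin_on_scale[OF lin])
    qed
    let ?act = "rep_act (loop_rep (verma c) ?D) (vir_d 1)" and ?act' = "rep_act (loop_rep W ?D') (vir_d 1)"
    have Fact: "F (?act u) = ?act' (F u)" for u
    proof (rule poly_mapping_eqI)
      show "Poly_Mapping.lookup (F (?act u)) i = Poly_Mapping.lookup (?act' (F u)) i" for i
        using lookup_loop_act_d[where V = "verma c" and D = ?D] lookup_loop_act_d[where V = W and D = ?D']
        by (simp add: lF inter poly_vs.vector_space_axioms W.vector_space_axioms verma.Lop_facts W.Lop_facts)
    qed
    have Fsingle: "F (Poly_Mapping.single j 1) = Poly_Mapping.single j w" for j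
      by (rule poly_mapping_eqI) (auto simp: lF lookup_single when_def f0 f(2))
    have Fgen: "F ((?act ^^ i) (Poly_Mapping.single j 1)) = (?act' ^^ i) (Poly_Mapping.single j w)" for i j
      by (induction i) (simp_all add: Fsingle Fact)
    let ?G = "{(?act ^^ i) (Poly_Mapping.single (2 * j + p) 1) | (i::nat) (j::int). True}"
    let ?G' = "{(?act' ^^ i) (Poly_Mapping.single (2 * j + p) w) | (i::nat) (j::int). True}"
    have FG: "F ` ?G = ?G'" by (auto simp: Fgen[symmetric])
    have "pm'.span ?G' = F ` pm.span ?G" unfolding FG[symmetric] by (rule F.span_image)
    also have "pm.span ?G = {u. \<forall>j. Poly_Mapping.lookup u j \<in> ?U j}"
      using arg_cong[OF L_parity_verma[of p c a], of rep_carrier]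
      unfolding L_parity_mod_def Let_def L_mod_eq[OF verma_witt_rep] refl_mod_def by simp
    also have "F ` {u. \<forall>j. Poly_Mapping.lookup u j \<in> ?U j} = {u. \<forall>j. Poly_Mapping.lookup u j \<in> ?U' j}"
    proof
      show "F ` {u. \<forall>j. Poly_Mapping.lookup u j \<in> ?U j} \<subseteq> {u. \<forall>j. Poly_Mapping.lookup u j \<in> ?U' j}"
        by (auto simp: lF)
      show "{u. \<forall>j. Poly_Mapping.lookup u j \<in> ?U' j} \<subseteq> F ` {u. \<forall>j. Poly_Mapping.lookup u j \<in> ?U j}"
      proof
        fix u assume u: "u \<in> {u. \<forall>j. Poly_Mapping.lookup u j \<in> ?U' j}"
        define v where "v = Poly_Mapping.mapp (\<lambda>_. inv f) u"
        have lv: "Poly_Mapping.lookup v j = inv f (Poly_Mapping.lookup u j)" for j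
          using inv_f_f[OF inj, of 0] f0 by (auto simp: v_def lookup_mapp when_def in_keys_iff)
        have vm: "Poly_Mapping.lookup v j \<in> ?U j" "f (Poly_Mapping.lookup v j) = Poly_Mapping.lookup u j" for j
        proof -
          obtain x where "x \<in> ?U j" "Poly_Mapping.lookup u j = f x" using u by blast
          then show "Poly_Mapping.lookup v j \<in> ?U j" "f (Poly_Mapping.lookup v j) = Poly_Mapping.lookup u j"
            by (simp_all add: lv inv_f_f[OF inj])
        qed
        have "u = F v" by (rule poly_mapping_eqI) (simp add: lF vm)
        then show "u \<in> F ` {u. \<forall>j. Poly_Mapping.lookup u j \<in> ?U j}" using vm(1) by blast
      qed
    qed
    finally have "pm'.span ?G' = {u. \<forall>j. Poly_Mapping.lookup u j \<in> ?U' j}" .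
    then show ?thesis
      unfolding L_parity_mod_def Let_def L_mod_eq[OF wr]
      by (simp add: loop_sub_def loop_rep_def)
  qed
  have bijU: "bij_betw f (?U j) (?U' j)" for j using inj by (simp add: bij_betw_def inj_on_def)
  have linU: "lin_on smult (?U j) (rep_scale W) f" for j using lin by (simp add: lin_on_def)
  have g: "graded_iso smult ?U ?D (rep_scale W) ?U' ?D' (\<lambda>_. f)"
    unfolding graded_iso_def using bijU linU inter by blast
  have g': "graded_iso (rep_scale W) ?U' ?D' smult ?U ?D (\<lambda>j. inv_into (?U j) f)"
    unfolding graded_iso_def
  proof (intro allI conjI ballI)
    fix j
    show "bij_betw (inv_into (?U j) f) (?U' j) (?U j)" by (rule bij_betw_inv_into[OF bijU])
    show "lin_on (rep_scale W) (?U' j) smult (inv_into (?U j) f)"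
      by (rule lin_on_inv_into[OF poly_vs.vector_space_axioms refl_space_subspace bijU linU])
    fix k x assume "x \<in> ?U' j"
    then obtain v where v: "v \<in> ?U j" "x = f v" by blast
    have "inv_into (?U (k + j)) f (f (?D k j v)) = ?D k j v"
      by (rule bij_betw_inv_into_left[OF bijU refl_space_Lop[OF v(1)]])
    then show "inv_into (?U (k + j)) f (?D' k j x) = ?D k j (inv_into (?U j) f x)"
      using bij_betw_inv_into_left[OF bijU v(1)] v by (simp add: inter)
  qed
  have D'U: "?D' k j x \<in> ?U' (k + j)" if "x \<in> ?U' j" for k j x
    using that refl_space_Lop by (auto simp: inter[symmetric])
  show "module_iso virasoro (refl_mod p a c) (L_parity_mod p W w a c)"
    unfolding eq refl_mod_def
    by (rule module_iso_if_graded_iso[where \<phi> = "\<lambda>_. f"])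
      (use g subU' in \<open>simp_all add: poly_vs.vector_space_axioms W.vector_space_axioms refl_space_subspace
        verma.Lop_facts W.Lop_facts refl_space_Lop\<close>)
  show "module_iso virasoro (L_parity_mod p W w a c) (refl_mod p a c)"
    unfolding eq refl_mod_def
    by (rule module_iso_if_graded_iso[where \<phi> = "\<lambda>j. inv_into (?U j) f"])
      (use g' subU' D'U in \<open>simp_all add: poly_vs.vector_space_axioms W.vector_space_axioms refl_space_subspace
        verma.Lop_facts W.Lop_facts\<close>)
qed

text \<open>The component of \<open>t\<^sup>-\<^sup>p\<close> contains the constant \<open>1\<close>, whose image is a constant.  This yields
  \<open>c\<^sup>2 = c'\<^sup>2\<close>, the quadratic coefficient of the other term yields \<open>c (c + 1) = c' (c' + 1)\<close>, and the parity of the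
  component that contains constants is an invariant.\<close>

lemma refl_mod_iso_imp:
  assumes iso: "module_iso virasoro (refl_mod p a c) (refl_mod q a' c')"
    and c: "c \<noteq> 0" "c' \<noteq> 0" and Re: "0 \<le> Re a" "Re a < 1" "0 \<le> Re a'" "Re a' < 1"
  shows "a = a'" "c = c'" "even (p + q)"
proof -
  let ?D = "verma.Lop c (- 1) a (c + 1)" and ?D' = "verma.Lop c' (- 1) a' (c' + 1)"
  have one: "1 \<in> refl_space p a (- p)" using const_in_refl_space[of 1 p a "- p"] by (simp add: one_pCons)
  then have nz: "\<exists>j. \<exists>w\<in>refl_space p a j. w \<noteq> 0" by (metis one_neq_zero)
  note gr = graded_iso_if_module_iso[OF iso[unfolded refl_mod_def], of a a']
  have "a = a'" "\<exists>\<phi>. graded_iso smult (refl_space p a) ?D smult (refl_space q a') ?D' \<phi>"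
    using gr nz Re by (simp_all add: poly_vs.vector_space_axioms refl_space_subspace verma.Lop_facts)
  then show "a = a'" by simp
  obtain \<phi> where \<phi>: "graded_iso smult (refl_space p a) ?D smult (refl_space q a') ?D' \<phi>"
    using \<open>\<exists>\<phi>. graded_iso smult (refl_space p a) ?D smult (refl_space q a') ?D' \<phi>\<close> by blast
  interpret m: verma_map c c' "- 1" a "c + 1" "c' + 1" \<phi> "refl_space p a" "refl_space q a"
    by unfold_locales (use \<phi> \<open>a = a'\<close> in \<open>auto simp: graded_iso_def refl_space_subspace refl_space_Lop\<close>)
  obtain \<gamma> where \<gamma>: "\<gamma> \<noteq> 0" "\<phi> (- p) 1 = [:\<gamma>:]" using m.phi_one(1)[OF one] c by auto
  have "c * c = c' * c'" using m.phi_one(2)[OF one] c by simp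
  moreover have "c * (c + 1) + (c + 1) * (c + 1 - 1) = c' * (c' + 1) + (c' + 1) * (c' + 1 - 1)"
    by (rule m.one_coeff(3)[OF one]) simp
  ultimately show "c = c'" by algebra
  have "[:\<gamma>:] \<in> refl_space q a (- p)" using m.phi_in_U0[OF one] \<gamma> by simp
  then have "even (- p + q)" using const_in_refl_space \<gamma>(1) by blast
  then show "even (p + q)" by simp
qed

section \<open>The modules \<open>\<N>(B, a)\<close>\<close>

text \<open>The operator by which \<open>d\<^sub>m\<close> maps \<open>B \<otimes> t\<^sup>n\<close> to \<open>B \<otimes> t\<^sup>n\<^sup>+\<^sup>m\<close> in \<open>\<N>(B, a)\<close>.\<close>

definition nop :: "(complex poly, 'v::ab_group_add) rep \<Rightarrow> complex \<Rightarrow> int \<Rightarrow> int \<Rightarrow> 'v \<Rightarrow> 'v" where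
  "nop B a m n v = rep_scale B (a + of_int n) v
    + Sum_any (\<lambda>i::nat. rep_scale B (of_int m ^ (i + 1) / fact (i + 1)) (rep_act B (witt_d (int i)) v))"

lemma N_mod_eq: "N_mod B a = loop_sub B (nop B a) (\<lambda>_. rep_carrier B)"
  unfolding N_mod_def loop_rep_eq nop_def[abs_def] by simp

lemma borel_bracket:
  "lie_bracket borel (witt_d (int i)) (witt_d (int l)) = lie_scale borel (of_int (int l - int i)) (witt_d (int (i + l)))"
  using witt_bracket_d[of "int i" "int l"] by (simp add: borel_def add.commute)

text \<open>The vectors killed by all \<open>d\<^sub>i\<close> with \<open>i \<ge> n\<close> form a submodule.\<close>

lemma borel_uniform:
  assumes "category_O borel B" "simple_module borel B"
  shows "\<exists>R. \<forall>i\<ge>R. \<forall>v\<in>rep_carrier B. rep_act B (witt_d (int i)) v = 0"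
proof -
  let ?C = "rep_carrier B" and ?s = "rep_scale B"
  have mod: "lie_module borel B" using assms(1) by (simp add: category_O_def)
  then interpret cvec ?s by (intro cvec.intro) (simp add: lie_module_def)
  have sC: "subspace ?C" using mod by (simp add: lie_module_def)
  have d: "witt_d (int i) \<in> lie_carrier borel" for i
    by (auto simp: borel_def intro!: poly_vs.span_base)
  have lin: "rep_act B x v \<in> ?C" "rep_act B x (u + v) = rep_act B x u + rep_act B x v"
    "rep_act B x (?s e v) = ?s e (rep_act B x v)" "rep_act B (x + y) v = rep_act B x v + rep_act B y v"
    "rep_act B (smult e x) v = ?s e (rep_act B x v)"
    "rep_act B (lie_bracket borel x y) v = rep_act B x (rep_act B y v) - rep_act B y (rep_act B x v)"
    if "x \<in> lie_carrier borel" "y \<in> lie_carrier borel" "u \<in> ?C" "v \<in> ?C" for x y u v e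
    using mod that by (auto simp: lie_module_def borel_def witt_def)
  have zero: "0 \<in> ?C" by (rule subspace_0[OF sC])
  have act0: "rep_act B x 0 = 0" if "x \<in> lie_carrier borel" for x
    using lin(2)[OF that that zero zero] by simp
  have "\<exists>w\<in>?C. w \<noteq> 0" using assms(2) zero unfolding simple_module_def by blast
  then obtain w where w: "w \<in> ?C" "w \<noteq> 0" by blast
  obtain n :: nat where n: "\<forall>i\<ge>int n. rep_act B (witt_d i) w = 0"
    using assms(1) w by (auto simp: category_O_def)
  define S where "S = {v \<in> ?C. \<forall>i\<ge>n. rep_act B (witt_d (int i)) v = 0}"
  have sS: "subspace S"
    unfolding S_def
    by (rule subspaceI) (auto simp: act0 d zero lin(2)[OF d d] lin(3)[OF d d zero] intro: subspace_add[OF sC] subspace_scale[OF sC])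
  have "rep_act B x v \<in> S" if x: "x \<in> lie_carrier borel" and v: "v \<in> S" for x v
  proof -
    have vC: "v \<in> ?C" using v by (simp add: S_def)
    have "poly_vs.subspace {x \<in> lie_carrier borel. rep_act B x v \<in> S}"
    proof (rule poly_vs.subspaceI)
      have z: "(0::complex poly) \<in> lie_carrier borel" by (simp add: borel_def poly_vs.span_zero)
      then show "0 \<in> {x \<in> lie_carrier borel. rep_act B x v \<in> S}"
        using lin(5)[OF z z zero vC, of 0] subspace_0[OF sS] by simp
      show "x + y \<in> {x \<in> lie_carrier borel. rep_act B x v \<in> S}"
        if "x \<in> {x \<in> lie_carrier borel. rep_act B x v \<in> S}" "y \<in> {x \<in> lie_carrier borel. rep_act B x v \<in> S}" for x y
        using that lin(4)[of x y v v] vC subspace_add[OF sS] by (auto simp: borel_def poly_vs.span_add)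
      show "smult e x \<in> {x \<in> lie_carrier borel. rep_act B x v \<in> S}"
        if "x \<in> {x \<in> lie_carrier borel. rep_act B x v \<in> S}" for e x
        using that lin(5)[of x x v v] vC subspace_scale[OF sS] by (auto simp: borel_def poly_vs.span_scale)
    qed
    moreover have "{witt_d i | i. i \<ge> 0} \<subseteq> {x \<in> lie_carrier borel. rep_act B x v \<in> S}"
    proof
      fix y assume "y \<in> {witt_d i | i. i \<ge> 0}"
      then obtain l where y: "y = witt_d (int l)" using nonneg_int_cases by blast
      have "rep_act B (witt_d (int i)) (rep_act B y v) = 0" if i: "i \<ge> n" for i
      proof -
        have "rep_act B (witt_d (int (i + l))) v = 0" using v trans_le_add1[OF i, of l] unfolding S_def by blast
        then have "rep_act B (lie_bracket borel (witt_d (int i)) y) v = 0"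
          unfolding y borel_bracket using lin(5)[OF d d vC vC, of "of_int (int l - int i)" "i + l"]
          by (simp add: borel_def witt_def)
        moreover have "rep_act B (witt_d (int i)) v = 0" using v i by (simp add: S_def)
        ultimately show ?thesis
          using lin(6)[OF d d vC vC, of i l] act0[OF d] by (simp add: y)
      qed
      then show "y \<in> {x \<in> lie_carrier borel. rep_act B x v \<in> S}"
        using lin(1)[OF d d vC vC] d by (simp add: y S_def)
    qed
    ultimately have "poly_vs.span {witt_d i | i. i \<ge> 0} \<subseteq> {x \<in> lie_carrier borel. rep_act B x v \<in> S}"
      by (rule poly_vs.span_minimal[rotated])
    then show ?thesis using x by (auto simp: borel_def)
  qed
  then have "submodule borel B S" using sS by (auto simp: submodule_def S_def)
  moreover have "w \<in> S" using w n by (simp add: S_def)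
  ultimately have "S = ?C" using assms(2) w unfolding simple_module_def by blast
  then show ?thesis unfolding S_def by blast
qed

lemma nop_facts:
  assumes B: "category_O borel B"
    and R: "\<forall>i\<ge>R. \<forall>v\<in>rep_carrier B. rep_act B (witt_d (int i)) v = 0"
  shows "vector_space (rep_scale B)" "module.subspace (rep_scale B) (rep_carrier B)"
    "nop B a k j 0 = 0" "nop B a 0 j v = rep_scale B (a + of_int j) v"
    "v \<in> rep_carrier B \<Longrightarrow> nop B a k j v \<in> rep_carrier B"
    "v \<in> rep_carrier B \<Longrightarrow>
      pdeg (rep_scale B) (rep_carrier B) (Suc R + R) (\<lambda>k. nop B a (- k) (k + j) (nop B a k j v))"
proof -
  let ?C = "rep_carrier B" and ?s = "rep_scale B"
  let ?g = "\<lambda>i. rep_act B (witt_d (int i))"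
  have mod: "lie_module borel B" using B by (simp add: category_O_def)
  then show vs: "vector_space ?s" and sC: "module.subspace ?s ?C" by (simp_all add: lie_module_def)
  interpret cvec ?s by (rule cvec.intro, fact)
  have d: "witt_d (int i) \<in> lie_carrier borel" for i
    by (auto simp: borel_def intro!: poly_vs.span_base)
  have gC: "?g i v \<in> ?C" if "v \<in> ?C" for i v using mod d that by (simp add: lie_module_def)
  have glin: "lin_on ?s ?C ?s (?g i)" for i using mod d by (intro lin_onI) (auto simp: lie_module_def)
  have zero: "0 \<in> ?C" by (rule subspace_0[OF sC])
  have g0: "?g i 0 = 0" for i by (rule lin_on_zero[OF glin zero])
  note CI = subspace_add[OF sC] subspace_scale[OF sC] subspace_sum[OF sC] gC
  show "nop B a k j 0 = 0" by (simp add: nop_def g0)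
  show "nop B a 0 j v = ?s (a + of_int j) v" for v by (simp add: nop_def)
  have eq: "nop B a k j v = ?s (a + of_int j) v + (\<Sum>i<R. ?s (of_int k ^ Suc i) (?s (1 / fact (Suc i)) (?g i v)))"
    if v: "v \<in> ?C" for k j v
  proof -
    have "Sum_any (\<lambda>i::nat. ?s (of_int k ^ (i + 1) / fact (i + 1)) (?g i v)) =
        (\<Sum>i<R. ?s (of_int k ^ (i + 1) / fact (i + 1)) (?g i v))"
      by (rule Sum_any.expand_superset) (use R v in \<open>auto intro: leI\<close>)
    then show ?thesis by (simp add: nop_def)
  qed
  show nC: "nop B a k j v \<in> ?C" if "v \<in> ?C" for k j v
    unfolding eq[OF that] by (intro CI that)
  have nlin: "lin_on ?s ?C ?s (nop B a k j)" for k j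
  proof (rule lin_onI)
    show "nop B a k j (u + v) = nop B a k j u + nop B a k j v" if "u \<in> ?C" "v \<in> ?C" for u v
      using that by (simp add: eq CI lin_on_add[OF glin] scale_right_distrib sum.distrib)
    show "nop B a k j (?s e v) = ?s e (nop B a k j v)" if "v \<in> ?C" for e v
      using that by (simp add: eq CI lin_on_scale[OF glin] scale_right_distrib scale_sum_right mult.commute)
  qed
  have p1: "pdeg ?s ?C R (\<lambda>k. \<Sum>i<R. ?s (of_int k ^ Suc i) (?s (1 / fact (Suc i)) (?g i v)))"
    if v: "v \<in> ?C" for v
  proof (rule pdeg_sum[OF zero])
    fix i assume "i \<in> {..<R}"
    then show "pdeg ?s ?C R (\<lambda>k. ?s (of_int k ^ Suc i) (?s (1 / fact (Suc i)) (?g i v)))"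
      by (intro pdeg_mono[OF pdeg_power[OF _ vs]] CI v) simp
  qed
  have deg1: "pdeg ?s ?C R (\<lambda>k. nop B a k j v)" if v: "v \<in> ?C" for j v
    unfolding eq[OF v]
    by (rule pdeg_add[OF pdeg_mono[OF pdeg_const] p1[OF v]]) (simp_all add: CI v)
  have deg2: "pdeg ?s ?C (Suc R) (\<lambda>k. nop B a (- k) (k + j) v)" if v: "v \<in> ?C" for j v
  proof -
    have "pdeg ?s ?C (Suc R) (\<lambda>k. nop B a (0 - k) j v + ?s (of_int k) v)"
      by (rule pdeg_add[OF pdeg_Suc[OF pdeg_reflect[OF vs sC deg1[OF v]]] pdeg_mono[OF pdeg_mult[OF pdeg_const[OF v]]]]) simp
    moreover have "(\<lambda>k. nop B a (- k) (k + j) v) = (\<lambda>k. nop B a (0 - k) j v + ?s (of_int k) v)"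
      by (rule ext) (simp add: eq[OF v] scale_left_distrib)
    ultimately show ?thesis by (simp only:)
  qed
  show "pdeg ?s ?C (Suc R + R) (\<lambda>k. nop B a (- k) (k + j) (nop B a k j v))" if "v \<in> ?C" for v
    by (rule pdeg_apply[OF vs sC nlin deg2 deg1[OF that]])
qed

text \<open>Passing from one component to the next changes \<open>d\<^sub>-\<^sub>k d\<^sub>k\<close> by \<open>E k + E (-k)\<close> and terms of degree one.  A
  bound on the degree therefore kills all \<open>d i\<close> with \<open>i\<close> even and large, and their commutators with \<open>d 0 = d/dt\<close>
  kill the others.\<close>

lemma (in witt_rep) all_zero_if_bounded_degree:
  assumes "\<And>j w. w \<in> V \<Longrightarrow>
      (dif ^^ M) (\<lambda>k. Lop 1 a b (- k) (k + j) (Lop 1 a b k j w)) = (\<lambda>k. 0)"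
    and v: "v \<in> V"
  shows "d i v = 0"
proof (rule all_zero_if_high_zero[OF _ v])
  have even: "d i w = 0" if w: "w \<in> V" and i: "i \<ge> M + 2" "even i" for i w
  proof -
    have next_weight: "Lop 1 a b k (j + 1) u = Lop 1 a b k j u + u" for k j u
      using Aff_shift[of "a + of_int k * b + of_int j" 1 u] by (simp add: Lop_def add.assoc)
    define T where "T = (\<lambda>j k. Lop 1 a b (- k) (k + j) (Lop 1 a b k j w))"
    define G where "G = (\<lambda>k. E (- k) w + E k w)"
    define L where "L = (\<lambda>k. (Aff (a + of_int (- k) * b + of_int k) w + Aff (a + of_int k * b) w) + w)"
    have "T 1 k = T 0 k + (G k + L k)" for k
    proof -
      have "T 1 k = Lop 1 a b (- k) (k + 0 + 1) (Lop 1 a b k (0 + 1) w)" by (simp add: T_def)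
      also have "\<dots> = Lop 1 a b (- k) (k + 0) (Lop 1 a b k 0 w + w) + (Lop 1 a b k 0 w + w)"
        by (simp only: next_weight)
      also have "\<dots> = T 0 k + (G k + L k)"
        using w by (simp add: T_def G_def L_def lin_on_add[OF Lop_lin]) (simp add: Lop_def algebra_simps)
      finally show ?thesis .
    qed
    then have "T 1 = (\<lambda>k. T 0 k + (G k + L k))" by (rule ext)
    then have "(dif ^^ M) (T 1) = (\<lambda>k. (dif ^^ M) (T 0) k + (dif ^^ M) (\<lambda>k. G k + L k) k)"
      by (simp only: dif_pow_add)
    moreover have "(dif ^^ M) (T j) = (\<lambda>k. 0)" for j unfolding T_def by (rule assms(1)[OF w])
    ultimately have "(dif ^^ M) (\<lambda>k. G k + L k) = (\<lambda>k. 0)" by (simp add: fun_eq_iff)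
    then have "(dif ^^ (M + 2)) (\<lambda>k. G k + L k) = (\<lambda>k. 0)" by (rule dif_pow_mono) simp
    moreover have "(dif ^^ (M + 2)) L = (\<lambda>k. 0)"
    proof -
      have "pdeg s V (Suc 0) (\<lambda>k. Aff (a + of_int (- k) * b + of_int k) w)"
        by (intro pdeg_Aff pdeg_const w) (simp add: algebra_simps)
      moreover have "pdeg s V (Suc 0) (\<lambda>k. Aff (a + of_int k * b) w)"
        by (intro pdeg_Aff pdeg_const w) (simp add: algebra_simps)
      moreover have "pdeg s V (Suc 0) (\<lambda>k. w)" by (rule pdeg_Suc[OF pdeg_const[OF w]])
      ultimately have "pdeg s V (Suc 0) L" unfolding L_def by (intro pdeg_add)
      then have "(dif ^^ Suc (Suc 0)) L = (\<lambda>k. 0)" by (rule dif_pow_pdeg[OF vector_space_axioms])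
      then show ?thesis by (rule dif_pow_mono) simp
    qed
    ultimately have G0: "(dif ^^ (M + 2)) G = (\<lambda>k. 0)" by (simp only: dif_pow_add) simp
    obtain n where n: "\<forall>i\<ge>n. d i w = 0" using d_fin[OF w] by blast
    let ?c = "\<lambda>i. s ((1 + (- 1) ^ i) / fact i) (d i w)"
    have "G k = (\<Sum>i<n. s (of_int k ^ i) (?c i))" for k
    proof -
      have "E l w = (\<Sum>i<n. s (of_int l ^ i) (s (1 / fact i) (d i w)))" for l
        by (rule E_eq) (use n in blast)
      then show ?thesis unfolding G_def
        by (simp add: sum.distrib[symmetric] scale_left_distrib[symmetric] power_minus[of "of_int k"]
            add_divide_distrib distrib_left mult.commute add.commute)
    qed
    then have "?c i \<in> {0}" if "i < n"
      by (rule poly_coeff_in_subspace[OF vector_space_axioms subspace_single_0, where M = "M + 2"])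
        (use G0 i that in auto)
    then show ?thesis using n i(2) by (cases "i < n") auto
  qed
  fix i w assume i: "i \<ge> M + 2" and w: "w \<in> V"
  show "d i w = 0"
  proof (cases "even i")
    case True then show ?thesis using even i w by blast
  next
    case False
    then have "d (Suc i) (d 0 w) = 0" "d (Suc i) w = 0" using even i w by auto
    then have "s (of_nat (Suc i)) (d i w) = 0" using d_D[OF w, of "Suc i"] by simp
    then show ?thesis by (simp del: of_nat_Suc)
  qed
qed

text \<open>At \<open>k = 0\<close> the term with exponent \<open>-1\<close> is the multiplication by \<open>2 x (a + j - x)\<close>.\<close>

lemma verma_part_at_0:
  assumes "exp_part (- 1) (verma.two_step c (- 1) a b 0 j v) 0 = 0" shows "v = 0"
proof -
  let ?u = "[:0, 1:] * ([:a + of_int j, - 1:] * v)"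
  have "?u + ?u = 0"
    using assms by (simp only: verma.two_step_def exp_part_simps) (simp add: verma_Aff)
  then have "smult 2 ?u = 0" using smult_add_left[of 1 1 ?u] by (simp only: smult_1_left one_add_one)
  then show ?thesis by (simp only: smult_eq_0_iff mult_eq_0_iff) auto
qed

text \<open>The left-hand side has no term with exponent \<open>-1\<close>.\<close>

lemma N_mod_not_iso_refl_mod:
  assumes B: "category_O borel B" "simple_module borel B"
    and Re: "0 \<le> Re a" "Re a < 1" "0 \<le> Re a'" "Re a' < 1"
  shows "\<not> module_iso virasoro (N_mod B a) (refl_mod p a' c)"
proof
  assume iso: "module_iso virasoro (N_mod B a) (refl_mod p a' c)"
  obtain R where R: "\<forall>i\<ge>R. \<forall>v\<in>rep_carrier B. rep_act B (witt_d (int i)) v = 0"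
    using borel_uniform[OF B] by blast
  note N = nop_facts[OF B(1) R]
  interpret cvec "rep_scale B" by (rule cvec.intro, rule N(1))
  have "\<exists>w\<in>rep_carrier B. w \<noteq> 0"
    using B(2) subspace_0[OF N(2)] unfolding simple_module_def by blast
  then obtain w where w: "w \<in> rep_carrier B" "w \<noteq> 0" by blast
  let ?D' = "verma.Lop c (- 1) a' (c + 1)"
  have "\<exists>\<phi>. graded_iso (rep_scale B) (\<lambda>_. rep_carrier B) (nop B a) smult (refl_space p a') ?D' \<phi>"
    using graded_iso_if_module_iso(2)[OF iso[unfolded N_mod_eq refl_mod_def], of a a'] w Re N
    by (auto simp: poly_vs.vector_space_axioms refl_space_subspace verma.Lop_facts)
  then obtain \<phi> where bij: "bij_betw (\<phi> j) (rep_carrier B) (refl_space p a' j)"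
    and lin: "lin_on (rep_scale B) (rep_carrier B) smult (\<phi> j)"
    and inter: "w \<in> rep_carrier B \<Longrightarrow> \<phi> (k + j) (nop B a k j w) = ?D' k j (\<phi> j w)" for j k w
    unfolding graded_iso_def by blast
  let ?N = "\<lambda>k. nop B a (- k) (k + 0) (nop B a k 0 w)"
  have "\<phi> 0 (exp_part (- 1) [(1, ?N)] 0) = exp_part (- 1) (verma.two_step c (- 1) a' (c + 1) 0 0 (\<phi> 0 w)) 0"
  proof (rule exp_transfer(2)[OF N(1,2) poly_vs.vector_space_axioms lin])
    show "exp_list [(1, ?N)]"
    proof -
      have "pfun (rep_scale B) (rep_carrier B) ?N"
        unfolding pfun_def by (rule exI) (rule N(6)[OF w(1)])
      from pfun_dnil[OF N(1) this] show ?thesis by simp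
    qed
    show "exp_sum (rep_scale B) [(1, ?N)] k \<in> rep_carrier B" for k using w N(5) by simp
    show "exp_list (verma.two_step c (- 1) a' (c + 1) 0 0 (\<phi> 0 w))"
      by (rule verma.two_step_exp_list) auto
    show "\<phi> 0 (exp_sum (rep_scale B) [(1, ?N)] k) =
        exp_sum smult (verma.two_step c (- 1) a' (c + 1) 0 0 (\<phi> 0 w)) k" for k
      using inter[of "nop B a k 0 w" "- k" "k + 0"] inter[OF w(1), of k 0] w N(5)
      by (simp add: verma.two_step_sum[symmetric])
  qed
  then have "exp_part (- 1) (verma.two_step c (- 1) a' (c + 1) 0 0 (\<phi> 0 w)) 0 = 0"
    using lin_on_zero[OF lin subspace_0[OF N(2)]] by simp
  then have "\<phi> 0 w = 0" by (rule verma_part_at_0)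
  moreover have "\<phi> 0 0 = 0" by (rule lin_on_zero[OF lin subspace_0[OF N(2)]])
  ultimately show False
    using inj_onD[OF bij_betw_imp_inj_on[OF bij], of 0 w 0] w subspace_0[OF N(2)] by simp
qed

text \<open>The right-hand side has only the exponent \<open>1\<close>, with a uniform bound on the degree.\<close>

lemma L_mod_not_iso_N_mod:
  assumes W: "category_O witt W" "simple_module witt W" "\<not> trivial_module witt W" and lam: "lam \<noteq> 0"
    and B: "category_O borel B" "simple_module borel B"
    and Re: "0 \<le> Re a" "Re a < 1" "0 \<le> Re a'" "Re a' < 1"
  shows "\<not> module_iso virasoro (L_mod W lam a b) (N_mod B a')"
proof
  assume iso: "module_iso virasoro (L_mod W lam a b) (N_mod B a')"
  interpret W: simple_witt_rep "rep_scale W" "rep_carrier W" "wact W"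
    by (rule simple_witt_rep_if_simple_module[OF W])
  obtain R where R: "\<forall>i\<ge>R. \<forall>v\<in>rep_carrier B. rep_act B (witt_d (int i)) v = 0"
    using borel_uniform[OF B] by blast
  note N = nop_facts[OF B(1) R]
  interpret B: cvec "rep_scale B" by (rule cvec.intro, rule N(1))
  have "\<exists>\<phi>. graded_iso (rep_scale W) (\<lambda>_. rep_carrier W) (W.Lop lam a b)
      (rep_scale B) (\<lambda>_. rep_carrier B) (nop B a') \<phi>"
    using graded_iso_if_module_iso(2)[OF iso[unfolded N_mod_eq L_mod_eq[OF W.witt_rep_axioms]], of a a']
      W.V_nonzero Re N
    by (auto simp: W.vector_space_axioms W.sub W.Lop_facts)
  then obtain \<phi> where bij: "bij_betw (\<phi> j) (rep_carrier W) (rep_carrier B)"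
    and lin: "lin_on (rep_scale W) (rep_carrier W) (rep_scale B) (\<phi> j)"
    and inter: "w \<in> rep_carrier W \<Longrightarrow> \<phi> (k + j) (W.Lop lam a b k j w) = nop B a' k j (\<phi> j w)" for j k w
    unfolding graded_iso_def by blast
  have phi0: "\<phi> j 0 = 0" for j by (rule lin_on_zero[OF lin W.V_0])
  have phi_eq_0: "\<phi> j w = 0 \<longleftrightarrow> w = 0" if "w \<in> rep_carrier W" for j w
    using inj_on_eq_iff[OF bij_betw_imp_inj_on[OF bij] that W.V_0, of j] phi0 by simp
  have phiC: "\<phi> j w \<in> rep_carrier B" if "w \<in> rep_carrier W" for j w
    using bij_betw_apply[OF bij that] .
  let ?N = "\<lambda>j w k. nop B a' (- k) (k + j) (nop B a' k j (\<phi> j w))"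
  have step: "\<phi> j (W.Lop lam a b (- k) (k + j) (W.Lop lam a b k j w)) = ?N j w k"
    if "w \<in> rep_carrier W" for j k w
    using inter[of "W.Lop lam a b k j w" "- k" "k + j"] inter[OF that, of k j] that by simp
  show False
  proof (cases "lam = 1")
    case True
    have "(dif ^^ (Suc (Suc R + R))) (\<lambda>k. W.Lop 1 a b (- k) (k + j) (W.Lop 1 a b k j w)) = (\<lambda>k. 0)"
      if w: "w \<in> rep_carrier W" for j w
    proof
      fix k
      let ?T = "\<lambda>k. W.Lop 1 a b (- k) (k + j) (W.Lop 1 a b k j w)"
      have T: "?T k \<in> rep_carrier W" for k using w by simp
      have "\<phi> j ((dif ^^ (Suc (Suc R + R))) ?T k) = (dif ^^ (Suc (Suc R + R))) (\<lambda>k. \<phi> j (?T k)) k"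
        by (simp only: dif_pow_lin[OF W.vector_space_axioms W.sub lin T])
      also have "(\<lambda>k. \<phi> j (?T k)) = ?N j w" using step[OF w] True by auto
      also have "(dif ^^ (Suc (Suc R + R))) (?N j w) = (\<lambda>k. 0)"
        by (rule dif_pow_pdeg[OF N(1) N(6)[OF phiC[OF w]]])
      finally have "\<phi> j ((dif ^^ (Suc (Suc R + R))) ?T k) = 0" .
      then show "(dif ^^ (Suc (Suc R + R))) ?T k = 0"
        by (simp only: phi_eq_0[OF dif_pow_in[OF W.vector_space_axioms W.sub T]])
    qed
    from W.all_zero_if_bounded_degree[OF this] show False using W.nontrivial by blast
  next
    case False
    have "exp_part lam (W.two_step lam a b 0 j w) 0 = 0" if w: "w \<in> rep_carrier W" for j w
    proof -
      note tr = exp_transfer[OF W.vector_space_axioms W.sub N(1) lin W.two_step_exp_list[OF w lam]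
        W.two_step_in[OF w lam], where ys = "[(1, ?N j w)]"]
      have nil: "exp_list [(1, ?N j w)]"
      proof -
        have "pfun (rep_scale B) (rep_carrier B) (?N j w)"
          unfolding pfun_def by (rule exI) (rule N(6)[OF phiC[OF w]])
        from pfun_dnil[OF N(1) this] show ?thesis by simp
      qed
      have e: "\<phi> j (exp_sum (rep_scale W) (W.two_step lam a b 0 j w) k) =
          exp_sum (rep_scale B) [(1, ?N j w)] k" for k
        using step[OF w, of j k] W.two_step_sum[OF w lam, of a b 0 k j] by simp
      have "\<phi> j (exp_part lam (W.two_step lam a b 0 j w) 0) = 0" using tr(2)[OF nil e] False by simp
      then show ?thesis using phi_eq_0 tr(1)[OF nil e] by blast
    qed
    from W.all_zero_if_exp_part_zero[OF lam False _ this] show False using W.nontrivial by blast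
  qed
qed

section \<open>Comparison of the loop modules\<close>

lemma (in simple_witt_rep) verma_iso_if_Xop_zero:
  assumes "\<And>k n w. w \<in> V \<Longrightarrow> Xop k n w = 0"
  shows "\<exists>h f. h \<noteq> 0 \<and> witt_iso smult UNIV (vact h) s V d f"
proof -
  have "(dif ^^ 3) (\<lambda>k. E (- k) (E k w)) = (\<lambda>k. 0)" if "w \<in> V" for w
  proof
    show "(dif ^^ 3) (\<lambda>k. E (- k) (E k w)) k = 0" for k
      using assms[OF that, of k 0] by (simp add: Xop_def)
  qed
  then obtain w0 where w0: "w0 \<in> V" "w0 \<noteq> 0" "\<And>i. i \<ge> 2 \<Longrightarrow> d i w0 = 0"
    using low_level_vector_if_cubic_differences_vanish by blast
  obtain w h where w: "w \<in> V" "w \<noteq> 0" "h \<noteq> 0" "d 1 w = s h w" "\<And>i. i \<ge> 2 \<Longrightarrow> d i w = 0"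
    using highest_weight_vector_exists[OF w0] by blast
  have "U = V" if "stable U" "w \<in> U" for U using stable_eq_V that w(2) by blast
  from iso_verma[OF w(1-5) this] show ?thesis using w(3) unfolding witt_iso_def by blast
qed

text \<open>The two translations in \<open>E (n - k) (E k v)\<close> compose to the translation by \<open>n\<close>, so only the linear factors
  depend on \<open>k\<close>.\<close>

lemma verma_Xop: "verma.Xop h k n v = 0"
proof -
  let ?u = "pcompose v [:- of_int n, 1:]"
  let ?A = "[:h * of_int n, 1:] * [:- of_int n, 1:] * ?u"
    and ?B = "(smult (h + 1) [:h * of_int n, 1:] - smult h [:- of_int n, 1:]) * ?u"
    and ?C = "smult (- (h * (h + 1))) ?u"
  have "verma.E h (n - k) (verma.E h k v) = ?A + (smult (of_int k) ?B + smult (of_int k) (smult (of_int k) ?C))" for k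
  proof -
    have "pcompose (pcompose v [:- of_int k, 1:]) [:- of_int (n - k), 1:] = ?u"
      "pcompose [:h * of_int k, 1:] [:- of_int (n - k), 1:] = [:- of_int n + (h + 1) * of_int k, 1:]"
      by (simp_all add: pcompose_assoc[symmetric] pcompose_pCons algebra_simps)
    then have "verma.E h (n - k) (verma.E h k v) =
        [:h * of_int (n - k), 1:] * [:- of_int n + (h + 1) * of_int k, 1:] * ?u"
      by (simp only: verma_E pcompose_mult mult.assoc)
    also have "[:h * of_int (n - k), 1:] * [:- of_int n + (h + 1) * of_int k, 1:] =
        [:h * of_int n, 1:] * [:- of_int n, 1:] +
        (smult (of_int k) (smult (h + 1) [:h * of_int n, 1:] - smult h [:- of_int n, 1:]) +
          smult (of_int k) (smult (of_int k) [:- (h * (h + 1)):]))"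
      by (simp add: algebra_simps)
    finally show ?thesis by (simp only: distrib_right mult_smult_left) simp
  qed
  moreover have "pdeg smult UNIV (Suc (Suc 0)) (\<lambda>k. ?A + (smult (of_int k) ?B + smult (of_int k) (smult (of_int k) ?C)))"
    by (rule pdeg_add[OF pdeg_mono[OF pdeg_const] pdeg_add[OF pdeg_Suc[OF pdeg_mult[OF pdeg_const]]
            pdeg_mult[OF pdeg_mult[OF pdeg_const]]]]) simp_all
  ultimately have "pdeg smult UNIV (Suc (Suc 0)) (\<lambda>k. verma.E h (n - k) (verma.E h k v))" by (simp only:)
  then have "(dif ^^ Suc (Suc (Suc 0))) (\<lambda>k. verma.E h (n - k) (verma.E h k v)) = (\<lambda>k. 0)"
    by (rule dif_pow_pdeg[OF poly_vs.vector_space_axioms])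
  then show ?thesis unfolding verma.Xop_def numeral_3_eq_3 by (rule fun_cong)
qed

lemma loop_simple_if_simple_module:
  assumes W: "witt_rep (rep_scale W) (rep_carrier W) (wact W)"
    and simple: "simple_module virasoro (L_mod W lam a b)"
  shows "witt_rep.loop_simple (rep_scale W) (rep_carrier W) (wact W) lam a b"
proof -
  interpret W: witt_rep "rep_scale W" "rep_carrier W" "wact W" by fact
  interpret pm: vector_space "pm_scale (rep_scale W) :: complex \<Rightarrow> (int \<Rightarrow>\<^sub>0 'a) \<Rightarrow> _"
    by (rule vector_space_pm_scale) (rule W.vector_space_axioms)
  show ?thesis unfolding W.loop_simple_def
  proof (intro allI impI)
    fix U :: "int \<Rightarrow> 'a set"
    assume U: "\<forall>j. W.subspace (U j) \<and> U j \<subseteq> rep_carrier W"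
      "\<forall>k j. \<forall>w\<in>U j. W.Lop lam a b k j w \<in> U (k + j)"
    let ?S = "{f. \<forall>j. Poly_Mapping.lookup f j \<in> U j}" and ?C = "{f :: int \<Rightarrow>\<^sub>0 'a. \<forall>j. Poly_Mapping.lookup f j \<in> rep_carrier W}"
    have sU: "W.subspace (U j)" "U j \<subseteq> rep_carrier W" for j using U(1) by auto
    have zero: "0 \<in> U j" for j by (rule W.subspace_0[OF sU(1)])
    have "submodule virasoro (loop_sub W (W.Lop lam a b) (\<lambda>_. rep_carrier W)) ?S"
      unfolding submodule_def
    proof (intro conjI ballI)
      show "module.subspace (rep_scale (loop_sub W (W.Lop lam a b) (\<lambda>_. rep_carrier W))) ?S"
        unfolding loop_sub_simps
        by (rule pm.subspaceI) (auto simp: lookup_add lookup_pm_scale[OF W.vector_space_axioms] zero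
            intro: W.subspace_add[OF sU(1)] W.subspace_scale[OF sU(1)])
      show "?S \<subseteq> rep_carrier (loop_sub W (W.Lop lam a b) (\<lambda>_. rep_carrier W))" using sU(2) by auto
      fix x f assume f: "f \<in> ?S"
      have "Poly_Mapping.lookup (rep_act (loop_rep W (W.Lop lam a b)) x f) i \<in> U i" for i
      proof -
        have "W.Lop lam a b k (i - k) (Poly_Mapping.lookup f (i - k)) \<in> U i" for k
          using U(2)[rule_format, of "Poly_Mapping.lookup f (i - k)" "i - k" k] f by simp
        then show ?thesis
          by (subst lookup_loop_act[where D = "W.Lop lam a b", OF W.vector_space_axioms])
            (auto simp: W.Lop_facts intro!: W.subspace_sum[OF sU(1)] W.subspace_scale[OF sU(1)])
      qed
      then show "rep_act (loop_sub W (W.Lop lam a b) (\<lambda>_. rep_carrier W)) x f \<in> ?S" by simp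
    qed
    then have disj: "?S = {0} \<or> ?S = ?C"
      using simple unfolding simple_module_def L_mod_eq[OF W] by auto
    have zeroU: "U j = {0}" if "?S = {0}" for j
    proof -
      have "w = 0" if "w \<in> U j" for w
      proof -
        have "Poly_Mapping.single j w \<in> ?S" by (subst single_in_loop_sub) (use zero that in auto)
        then have "Poly_Mapping.single j w = 0" using \<open>?S = {0}\<close> by blast
        then show ?thesis by (metis lookup_single_eq lookup_zero)
      qed
      then show ?thesis using zero by blast
    qed
    have fullU: "U j = rep_carrier W" if "?S = ?C" for j
    proof -
      have "w \<in> U j" if w: "w \<in> rep_carrier W" for w
      proof -
        have "Poly_Mapping.single j w \<in> ?C" by (subst single_in_loop_sub) (use w in auto)
        then have "Poly_Mapping.single j w \<in> ?S" using \<open>?S = ?C\<close> by blast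
        then show ?thesis using single_in_loop_sub[where U = U and w = w] zero by blast
      qed
      then show ?thesis using sU(2) by blast
    qed
    show "(\<forall>j. U j = {0}) \<or> (\<forall>j. U j = rep_carrier W)"
    proof (rule disjE[OF disj])
      assume "?S = {0}"
      then show ?thesis by (intro disjI1 allI zeroU)
    next
      assume "?S = ?C"
      then show ?thesis by (intro disjI2 allI fullU)
    qed
  qed
qed

lemma loop_simple_transfer:
  assumes W: "witt_rep s V d" and W0: "witt_rep t V0 e"
    and \<phi>: "graded_iso s (\<lambda>_. V) (witt_rep.Lop s d lam a b) t (\<lambda>_. V0) (witt_rep.Lop t e lam0 a b0) \<phi>"
    and simple: "witt_rep.loop_simple s V d lam a b"
  shows "witt_rep.loop_simple t V0 e lam0 a b0"
proof -
  interpret W: witt_rep s V d by fact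
  interpret W0: witt_rep t V0 e by fact
  have bij: "bij_betw (\<phi> j) V V0" and lin: "lin_on s V t (\<phi> j)"
    and inter: "w \<in> V \<Longrightarrow> \<phi> (k + j) (W.Lop lam a b k j w) = W0.Lop lam0 a b0 k j (\<phi> j w)" for j k w
    using \<phi> unfolding graded_iso_def by blast+
  have phi0: "\<phi> j 0 = 0" for j by (rule lin_on_zero[OF lin W.V_0])
  have surj: "\<exists>w\<in>V. v = \<phi> j w" if "v \<in> V0" for j v
    using that bij_betw_imp_surj_on[OF bij[of j]] by blast
  show ?thesis unfolding W0.loop_simple_def
  proof (intro allI impI)
    fix U0 :: "int \<Rightarrow> _ set"
    assume U0: "\<forall>j. W0.subspace (U0 j) \<and> U0 j \<subseteq> V0"
      "\<forall>k j. \<forall>w\<in>U0 j. W0.Lop lam0 a b0 k j w \<in> U0 (k + j)"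
    have sU: "W0.subspace (U0 j)" "U0 j \<subseteq> V0" for j using U0(1) by auto
    define U where "U = (\<lambda>j. {w \<in> V. \<phi> j w \<in> U0 j})"
    have "(\<forall>j. U j = {0}) \<or> (\<forall>j. U j = V)"
    proof (rule W.loop_simpleD[OF simple])
      show "W.subspace (U j)" for j unfolding U_def
        by (rule W.subspaceI) (auto simp: phi0 lin_on_add[OF lin] lin_on_scale[OF lin]
            intro: W0.subspace_0[OF sU(1)] W0.subspace_add[OF sU(1)] W0.subspace_scale[OF sU(1)])
      show "U j \<subseteq> V" for j by (auto simp: U_def)
      show "W.Lop lam a b k j w \<in> U (k + j)" if "w \<in> U j" for k j w
        using that U0(2) by (auto simp: U_def inter)
    qed
    moreover have "U0 j = {0}" if "U j = {0}" for j
    proof -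
      have "v = 0" if v: "v \<in> U0 j" for v
      proof -
        obtain w where w: "w \<in> V" "v = \<phi> j w" using surj sU(2) v by blast
        then have "w \<in> U j" using v by (simp add: U_def)
        then show ?thesis using w phi0 \<open>U j = {0}\<close> by simp
      qed
      then show ?thesis using W0.subspace_0[OF sU(1)] by blast
    qed
    moreover have "U0 j = V0" if "U j = V" for j
    proof -
      have "v \<in> U0 j" if v: "v \<in> V0" for v
      proof -
        obtain w where w: "w \<in> V" "v = \<phi> j w" using surj v by blast
        then have "w \<in> U j" using \<open>U j = V\<close> by simp
        then show ?thesis using w by (simp add: U_def)
      qed
      then show ?thesis using sU(2) by blast
    qed
    ultimately show "(\<forall>j. U0 j = {0}) \<or> (\<forall>j. U0 j = V0)" by blast
  qed
qed

lemma graded_iso_of_witt_iso: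
  assumes "witt_rep s V d" "witt_rep t V0 e" "witt_iso s V d t V0 e f"
  shows "graded_iso s (\<lambda>_. V) (witt_rep.Lop s d lam a b) t (\<lambda>_. V0) (witt_rep.Lop t e lam a b) (\<lambda>_. f)"
  using witt_iso_Lop[OF assms] assms(3) unfolding graded_iso_def witt_iso_def by simp

text \<open>The two cases are distinguished by \<open>Xop\<close>.  For \<open>\<lambda>\<^sub>0 = \<lambda>\<inverse> \<noteq> \<lambda>\<close> the target is first reflected, so that only
  equal values of \<open>\<lambda>\<close> have to be compared.\<close>

lemma L_mod_iso_imp:
  assumes W: "category_O witt W" "simple_module witt W" "\<not> trivial_module witt W"
    and W0: "category_O witt W0" "simple_module witt W0" "\<not> trivial_module witt W0"
    and lam: "lam \<noteq> 0" "lam0 \<noteq> 0"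
    and Re: "0 \<le> Re a" "Re a < 1" "0 \<le> Re a0" "Re a0 < 1"
    and simple: "simple_module virasoro (L_mod W lam a b)"
    and iso: "module_iso virasoro (L_mod W lam a b) (L_mod W0 lam0 a0 b0)"
  shows "(module_iso witt W W0 \<and> lam = lam0 \<and> a = a0 \<and> b = b0) \<or>
    (\<exists>b' b0'. b' \<noteq> 0 \<and> b0' \<noteq> 0 \<and>
      (\<exists>w. highest_weight_module W w b') \<and> (\<exists>w0. highest_weight_module W0 w0 b0') \<and>
      lam0 = inverse lam \<and> a = a0 \<and> b = b0' + 1 \<and> b0 = b' + 1)"
proof -
  interpret W: simple_witt_rep "rep_scale W" "rep_carrier W" "wact W"
    by (rule simple_witt_rep_if_simple_module[OF W])
  interpret W0: simple_witt_rep "rep_scale W0" "rep_carrier W0" "wact W0"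
    by (rule simple_witt_rep_if_simple_module[OF W0])
  have mod: "lie_module witt W" "lie_module witt W0" using W W0 by (simp_all add: category_O_def)
  note gr = graded_iso_if_module_iso[OF iso[unfolded L_mod_eq[OF W.witt_rep_axioms] L_mod_eq[OF W0.witt_rep_axioms]], of a a0]
  have aa: "a = a0" and "\<exists>\<phi>. graded_iso (rep_scale W) (\<lambda>_. rep_carrier W) (W.Lop lam a b)
      (rep_scale W0) (\<lambda>_. rep_carrier W0) (W0.Lop lam0 a0 b0) \<phi>"
    using gr W.V_nonzero Re
    by (auto simp: W.vector_space_axioms W.sub W.Lop_facts W0.vector_space_axioms W0.sub W0.Lop_facts)
  then obtain \<phi> where \<phi>: "graded_iso (rep_scale W) (\<lambda>_. rep_carrier W) (W.Lop lam a b)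
      (rep_scale W0) (\<lambda>_. rep_carrier W0) (W0.Lop lam0 a b0) \<phi>" by blast
  have ls: "W.loop_simple lam a b"
    by (rule loop_simple_if_simple_module[OF W.witt_rep_axioms simple])
  have ls0: "W0.loop_simple lam0 a b0"
    by (rule loop_simple_transfer[OF W.witt_rep_axioms W0.witt_rep_axioms \<phi> ls])
  have lam1: "lam \<noteq> 1" and b1: "b \<noteq> 1" "b0 \<noteq> 1"
    using W.not_loop_simple_if_lam_1[OF ls] W.not_loop_simple_if_b_1[OF ls] W0.not_loop_simple_if_b_1[OF ls0] by auto
  interpret L: loop_map "rep_scale W" "rep_carrier W" "wact W" "rep_scale W0" "rep_carrier W0" "wact W0"
    lam lam0 a b b0 \<phi>
    by unfold_locales (use \<phi> lam lam1 in \<open>auto simp: graded_iso_def W.sub\<close>)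
  show ?thesis
  proof (cases "\<forall>k n. \<forall>w\<in>rep_carrier W. W.Xop k n w = 0")
    case False
    then obtain k n w where w: "w \<in> rep_carrier W" "W.Xop k n w \<noteq> 0" by blast
    note par = L.parameters_eq_if_Xop_nonzero[OF w b1]
    have "module_iso witt W W0"
      using par(3) module_iso_if_witt_iso[OF mod] unfolding witt_iso_def by blast
    then show ?thesis using par(1,2) aa by simp
  next
    case True
    then have "\<forall>k n. \<forall>w\<in>rep_carrier W0. W0.Xop k n w = 0" using L.Xop_zero_iff by blast
    then obtain h0 g where h0: "h0 \<noteq> 0"
      and g: "witt_iso smult UNIV (vact h0) (rep_scale W0) (rep_carrier W0) (wact W0) g"
      using W0.verma_iso_if_Xop_zero by blast
    obtain h f where h: "h \<noteq> 0"
      and f: "witt_iso smult UNIV (vact h) (rep_scale W) (rep_carrier W) (wact W) f"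
      using W.verma_iso_if_Xop_zero True by blast
    have g': "witt_iso (rep_scale W0) (rep_carrier W0) (wact W0) smult UNIV (vact h0) (inv_into UNIV g)"
      by (rule witt_iso_inv[OF poly_vs.vector_space_axioms _ _ g]) auto
    have f': "witt_iso (rep_scale W) (rep_carrier W) (wact W) smult UNIV (vact h) (inv_into UNIV f)"
      by (rule witt_iso_inv[OF poly_vs.vector_space_axioms _ _ f]) auto
    have hw: "\<exists>w. highest_weight_module W w h" "\<exists>w. highest_weight_module W0 w h0"
      using highest_weight_module_if_verma_iso[OF W(1,2) f] highest_weight_module_if_verma_iso[OF W0(1,2) g] by blast+
    have wiso: "module_iso witt W W0" if "h = h0"
      using module_iso_if_witt_iso[OF mod witt_iso_comp[OF f' g[folded that]]] .
    obtain \<psi> where \<psi>: "graded_iso smult (\<lambda>_. UNIV) (verma.Lop h lam a b) smult (\<lambda>_. UNIV) (verma.Lop h0 lam0 a b0) \<psi>"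
      using graded_iso_comp[OF graded_iso_of_witt_iso[OF verma.witt_rep_axioms W.witt_rep_axioms f]
        graded_iso_comp[OF \<phi> graded_iso_of_witt_iso[OF W0.witt_rep_axioms verma.witt_rep_axioms g']]] by blast
    show ?thesis
    proof (cases "lam0 = lam")
      case True
      interpret m: verma_map h h0 lam a b b0 \<psi> "\<lambda>_. UNIV" "\<lambda>_. UNIV"
        by unfold_locales (use \<psi> lam lam1 True in \<open>auto simp: graded_iso_def\<close>)
      have "(h = h0 \<and> b = b0) \<or> (lam = - 1 \<and> h = b0 - 1 \<and> b = h0 + 1)"
        by (rule m.parameters_eq) (use h0 b1 in auto)
      then show ?thesis
      proof
        assume "h = h0 \<and> b = b0"
        then show ?thesis using wiso True aa by simp
      next
        assume *: "lam = - 1 \<and> h = b0 - 1 \<and> b = h0 + 1"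
        then have "lam0 = inverse lam" "b0 = h + 1" using True by simp_all
        then show ?thesis using * h h0 hw aa by blast
      qed
    next
      case False
      then have inv: "lam0 = inverse lam" using L.lam0_cases by simp
      have "graded_iso smult (\<lambda>_. UNIV) (verma.Lop h0 lam0 a b0) smult (\<lambda>_. UNIV)
          (verma.Lop (b0 - 1) lam a (h0 + 1)) (flip lam0 a)"
        using flip_bij[OF lam(2), of a] flip_lin[of lam0 a] flip_Lop[OF lam(2), of a _ _ h0 "b0 - 1"] inv
        unfolding graded_iso_def by simp
      from graded_iso_comp[OF \<psi> this]
      obtain \<chi> where \<chi>: "graded_iso smult (\<lambda>_. UNIV) (verma.Lop h lam a b) smult (\<lambda>_. UNIV)
          (verma.Lop (b0 - 1) lam a (h0 + 1)) \<chi>" by blast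
      interpret m: verma_map h "b0 - 1" lam a b "h0 + 1" \<chi> "\<lambda>_. UNIV" "\<lambda>_. UNIV"
        by unfold_locales (use \<chi> lam lam1 in \<open>auto simp: graded_iso_def\<close>)
      have "(h = b0 - 1 \<and> b = h0 + 1) \<or> (lam = - 1 \<and> h = h0 + 1 - 1 \<and> b = b0 - 1 + 1)"
        by (rule m.parameters_eq) (use h0 b1 in auto)
      moreover have "lam \<noteq> - 1" using False inv by auto
      ultimately have "b = h0 + 1" "b0 = h + 1" by auto
      then show ?thesis using h h0 hw aa inv by blast
    qed
  qed
qed

text \<open>The exponents force \<open>\<lambda> = -1\<close>, and the vanishing of \<open>Xop\<close> on the right makes \<open>W\<close> a Verma module.
  Now \<open>1\<close> lies in every component on the left and its images are constants, but every other component on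
  the right contains no constants.\<close>

lemma L_mod_not_iso_refl_mod:
  assumes W: "category_O witt W" "simple_module witt W" "\<not> trivial_module witt W"
    and lam: "lam \<noteq> 0" and c: "c \<noteq> 0"
    and Re: "0 \<le> Re a" "Re a < 1" "0 \<le> Re a'" "Re a' < 1"
  shows "\<not> module_iso virasoro (L_mod W lam a b) (refl_mod p a' c)"
proof
  assume iso: "module_iso virasoro (L_mod W lam a b) (refl_mod p a' c)"
  interpret W: simple_witt_rep "rep_scale W" "rep_carrier W" "wact W"
    by (rule simple_witt_rep_if_simple_module[OF W])
  let ?D' = "verma.Lop c (- 1) a' (c + 1)"
  note gr = graded_iso_if_module_iso[OF iso[unfolded L_mod_eq[OF W.witt_rep_axioms] refl_mod_def], of a a']
  have aa: "a = a'" and "\<exists>\<phi>. graded_iso (rep_scale W) (\<lambda>_. rep_carrier W) (W.Lop lam a b)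
      smult (refl_space p a') ?D' \<phi>"
    using gr W.V_nonzero Re
    by (auto simp: W.vector_space_axioms W.sub W.Lop_facts poly_vs.vector_space_axioms refl_space_subspace verma.Lop_facts)
  then obtain \<phi> where \<phi>: "graded_iso (rep_scale W) (\<lambda>_. rep_carrier W) (W.Lop lam a b)
      smult (refl_space p a) (verma.Lop c (- 1) a (c + 1)) \<phi>" by blast
  interpret G: graded_map "rep_scale W" "rep_carrier W" "wact W" smult UNIV "vact c" lam "- 1" a b "c + 1" \<phi>
    "\<lambda>_. rep_carrier W" "refl_space p a"
    by unfold_locales (use \<phi> lam in \<open>auto simp: graded_iso_def W.sub\<close>)
  show False
  proof (cases "lam = 1")
    case True
    obtain w where w: "w \<in> rep_carrier W" "w \<noteq> 0" using W.V_nonzero by blast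
    have "exp_part (- 1) (W.two_step lam a b 0 0 w) 0 = 0" using True by (simp add: W.two_step_def)
    then have "exp_part (- 1) (verma.two_step c (- 1) a (c + 1) 0 0 (\<phi> 0 w)) 0 = 0"
      using G.two_step_part(2)[OF w(1), of 0 0 "- 1" 0] lin_on_zero[OF G.lin W.V_0] by simp
    then have "\<phi> 0 w = 0" by (rule verma_part_at_0)
    then show False using G.phi_eq_0 w by blast
  next
    case False
    interpret F: full_source_map "rep_scale W" "rep_carrier W" "wact W" smult UNIV "vact c" lam "- 1" a b "c + 1" \<phi>
      "refl_space p a"
      by unfold_locales (rule False)
    have "lam = - 1" using F.lam0_cases by (metis inverse_inverse_eq inverse_minus_eq inverse_1)
    have "W.Xop k n w = 0" if w: "w \<in> rep_carrier W" for k n w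
    proof -
      have "\<phi> (n + 0) (rep_scale W (lam powi n) (W.Xop k n w)) = 0"
        unfolding F.Xop_rel[OF w] verma_Xop by simp
      then have "rep_scale W (lam powi n) (W.Xop k n w) = 0" using G.phi_eq_0 w by simp
      then show ?thesis using lam by simp
    qed
    then obtain h f where h: "h \<noteq> 0"
      and f: "witt_iso smult UNIV (vact h) (rep_scale W) (rep_carrier W) (wact W) f"
      using W.verma_iso_if_Xop_zero by blast
    obtain \<psi> where \<psi>: "graded_iso smult (\<lambda>_. UNIV) (verma.Lop h lam a b) smult (refl_space p a)
        (verma.Lop c (- 1) a (c + 1)) \<psi>"
      using graded_iso_comp[OF graded_iso_of_witt_iso[OF verma.witt_rep_axioms W.witt_rep_axioms f] \<phi>] by blast
    interpret m: verma_map h c "- 1" a b "c + 1" \<psi> "\<lambda>_. UNIV" "refl_space p a"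
      by unfold_locales (use \<psi> \<open>lam = - 1\<close> in \<open>auto simp: graded_iso_def\<close>)
    obtain \<gamma> where \<gamma>: "\<gamma> \<noteq> 0" "\<psi> (1 - p) 1 = [:\<gamma>:]" using m.phi_one(1)[of "1 - p"] c by auto
    have "[:\<gamma>:] \<in> refl_space p a (1 - p)" using m.phi_in_U0[of 1 "1 - p"] \<gamma> by simp
    then show False using const_in_refl_space[OF \<gamma>(1), of p a "1 - p"] by simp
  qed
qed

text \<open>Conversely, the reflections identify the loop modules of two highest weight modules.\<close>

lemma L_mod_iso_highest_weight:
  assumes W: "highest_weight_module W w c" "c \<noteq> 0" and W0: "highest_weight_module W0 w0 c0" "c0 \<noteq> 0"
    and lam: "lam \<noteq> 0"
  shows "module_iso virasoro (L_mod W lam a (c0 + 1)) (L_mod W0 (inverse lam) a (c + 1))"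
proof -
  obtain f where f: "witt_iso smult UNIV (vact c) (rep_scale W) (rep_carrier W) (wact W) f"
    using verma_iso_if_highest_weight_module(1)[OF W] by blast
  obtain g where g: "witt_iso smult UNIV (vact c0) (rep_scale W0) (rep_carrier W0) (wact W0) g"
    using verma_iso_if_highest_weight_module(1)[OF W0] by blast
  have f': "witt_iso (rep_scale W) (rep_carrier W) (wact W) smult UNIV (vact c) (inv_into UNIV f)"
    by (rule witt_iso_inv[OF poly_vs.vector_space_axioms _ _ f]) auto
  have wr: "witt_rep (rep_scale W) (rep_carrier W) (wact W)" "witt_rep (rep_scale W0) (rep_carrier W0) (wact W0)"
    by (rule verma_iso_if_highest_weight_module(2)[OF W] verma_iso_if_highest_weight_module(2)[OF W0])+
  have 1: "module_iso virasoro (L_mod W lam a (c0 + 1)) (L_mod (verma c) lam a (c0 + 1))"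
    by (rule L_mod_iso_if_witt_iso[OF wr(1) verma_witt_rep]) (use f' in simp)
  have 2: "module_iso virasoro (L_mod (verma c) lam a (c0 + 1)) (L_mod (verma c0) (inverse lam) a (c + 1))"
    by (rule L_mod_verma_flip[OF lam])
  have 3: "module_iso virasoro (L_mod (verma c0) (inverse lam) a (c + 1)) (L_mod W0 (inverse lam) a (c + 1))"
    by (rule L_mod_iso_if_witt_iso[OF verma_witt_rep wr(2)]) (use g in simp)
  show ?thesis by (rule module_iso_trans[OF 1 module_iso_trans[OF 2 3]])
qed


theorem theorem15:
  fixes lam lam0 a b a0 a1 a2 b0 b1 b2 :: complex
    and B :: "(complex poly, 'b::ab_group_add) rep"
    and W :: "(complex poly, 'w::ab_group_add) rep"
    and W0 :: "(complex poly, 'w0::ab_group_add) rep"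
    and W1 :: "(complex poly, 'w1::ab_group_add) rep" and w1 :: 'w1
    and W2 :: "(complex poly, 'w2::ab_group_add) rep" and w2 :: 'w2
  assumes "lam \<noteq> 0" "lam0 \<noteq> 0"
    and "0 \<le> Re a" "Re a < 1" "0 \<le> Re a0" "Re a0 < 1"
    and "0 \<le> Re a1" "Re a1 < 1" "0 \<le> Re a2" "Re a2 < 1"
    and "b1 \<noteq> 0" "b2 \<noteq> 0"
    and "category_O borel B" "simple_module borel B" "\<not> trivial_module borel B"
    and "category_O witt W" "simple_module witt W" "\<not> trivial_module witt W"
    and "category_O witt W0" "simple_module witt W0" "\<not> trivial_module witt W0"
    and "highest_weight_module W1 w1 b1" "highest_weight_module W2 w2 b2"
  shows
    "(simple_module virasoro (L_mod W lam a b) \<longrightarrow>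
       (module_iso virasoro (L_mod W lam a b) (L_mod W0 lam0 a0 b0) \<longleftrightarrow>
         (module_iso witt W W0 \<and> lam = lam0 \<and> a = a0 \<and> b = b0) \<or>
         (\<exists>b' b0'. b' \<noteq> 0 \<and> b0' \<noteq> 0 \<and>
            (\<exists>w. highest_weight_module W w b') \<and> (\<exists>w0. highest_weight_module W0 w0 b0') \<and>
            lam0 = inverse lam \<and> a = a0 \<and> b = b0' + 1 \<and> b0 = b' + 1))) \<and>
     (\<forall>i\<in>{0, 1}.
       module_iso virasoro (L_parity_mod i W1 w1 a1 b1) (L_parity_mod i W2 w2 a2 b2) \<longleftrightarrow>
         a1 = a2 \<and> b1 = b2) \<and>
     (\<not> module_iso virasoro (L_mod W lam a b) (N_mod B a0) \<and>
      \<not> module_iso virasoro (L_mod W lam a b) (L_parity_mod 0 W1 w1 a1 b1) \<and>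
      \<not> module_iso virasoro (L_mod W lam a b) (L_parity_mod 1 W2 w2 a2 b2) \<and>
      \<not> module_iso virasoro (N_mod B a0) (L_parity_mod 0 W1 w1 a1 b1) \<and>
      \<not> module_iso virasoro (N_mod B a0) (L_parity_mod 1 W2 w2 a2 b2) \<and>
      \<not> module_iso virasoro (L_parity_mod 0 W1 w1 a1 b1) (L_parity_mod 1 W2 w2 a2 b2))"
proof (intro conjI)
  note W = \<open>category_O witt W\<close> \<open>simple_module witt W\<close> \<open>\<not> trivial_module witt W\<close>
  note W0 = \<open>category_O witt W0\<close> \<open>simple_module witt W0\<close> \<open>\<not> trivial_module witt W0\<close>
  note B = \<open>category_O borel B\<close> \<open>simple_module borel B\<close>
  note Re = \<open>0 \<le> Re a\<close> \<open>Re a < 1\<close> and Re0 = \<open>0 \<le> Re a0\<close> \<open>Re a0 < 1\<close>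
    and Re1 = \<open>0 \<le> Re a1\<close> \<open>Re a1 < 1\<close> and Re2 = \<open>0 \<le> Re a2\<close> \<open>Re a2 < 1\<close>
  note P1 = L_parity_iso[OF \<open>highest_weight_module W1 w1 b1\<close> \<open>b1 \<noteq> 0\<close>]
    and P2 = L_parity_iso[OF \<open>highest_weight_module W2 w2 b2\<close> \<open>b2 \<noteq> 0\<close>]
  have wr: "witt_rep (rep_scale W) (rep_carrier W) (wact W)" "witt_rep (rep_scale W0) (rep_carrier W0) (wact W0)"
    using witt_rep_if_category_O W(1) W0(1) by blast+
  show "simple_module virasoro (L_mod W lam a b) \<longrightarrow>
       (module_iso virasoro (L_mod W lam a b) (L_mod W0 lam0 a0 b0) \<longleftrightarrow>
         (module_iso witt W W0 \<and> lam = lam0 \<and> a = a0 \<and> b = b0) \<or>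
         (\<exists>b' b0'. b' \<noteq> 0 \<and> b0' \<noteq> 0 \<and>
            (\<exists>w. highest_weight_module W w b') \<and> (\<exists>w0. highest_weight_module W0 w0 b0') \<and>
            lam0 = inverse lam \<and> a = a0 \<and> b = b0' + 1 \<and> b0 = b' + 1))"
    (is "?simple \<longrightarrow> (?iso \<longleftrightarrow> ?i \<or> ?ii)")
  proof (intro impI iffI)
    assume ?simple ?iso
    then show "?i \<or> ?ii"
      by (rule L_mod_iso_imp[OF W W0 \<open>lam \<noteq> 0\<close> \<open>lam0 \<noteq> 0\<close> Re Re0])
  next
    assume "?i \<or> ?ii"
    then show ?iso
    proof
      assume ?i
      then obtain f where "witt_iso (rep_scale W) (rep_carrier W) (wact W)
          (rep_scale W0) (rep_carrier W0) (wact W0) f"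
        using witt_iso_if_module_iso by blast
      from L_mod_iso_if_witt_iso[OF wr this] show ?iso using \<open>?i\<close> by simp
    next
      assume ?ii
      then show ?iso using L_mod_iso_highest_weight[OF _ _ _ _ \<open>lam \<noteq> 0\<close>] by blast
    qed
  qed
  show "\<forall>i\<in>{0, 1}.
       module_iso virasoro (L_parity_mod i W1 w1 a1 b1) (L_parity_mod i W2 w2 a2 b2) \<longleftrightarrow>
         a1 = a2 \<and> b1 = b2"
  proof (intro ballI iffI)
    fix i :: int
    assume "module_iso virasoro (L_parity_mod i W1 w1 a1 b1) (L_parity_mod i W2 w2 a2 b2)"
    then have "module_iso virasoro (refl_mod i a1 b1) (refl_mod i a2 b2)"
      by (intro module_iso_trans[OF P1(2) module_iso_trans[OF _ P2(1)]])
    then show "a1 = a2 \<and> b1 = b2"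
      using refl_mod_iso_imp[OF _ \<open>b1 \<noteq> 0\<close> \<open>b2 \<noteq> 0\<close> Re1 Re2] by blast
  next
    fix i :: int
    assume "a1 = a2 \<and> b1 = b2"
    then show "module_iso virasoro (L_parity_mod i W1 w1 a1 b1) (L_parity_mod i W2 w2 a2 b2)"
      using module_iso_trans[OF P1(1)[of i a1]] P2(2)[of i a2] by simp
  qed
  show "\<not> module_iso virasoro (L_mod W lam a b) (N_mod B a0)"
    by (rule L_mod_not_iso_N_mod[OF W \<open>lam \<noteq> 0\<close> B Re Re0])
  show "\<not> module_iso virasoro (L_mod W lam a b) (L_parity_mod 0 W1 w1 a1 b1)"
    using module_iso_trans[OF _ P1(1)] L_mod_not_iso_refl_mod[OF W \<open>lam \<noteq> 0\<close> \<open>b1 \<noteq> 0\<close> Re Re1] by blast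
  show "\<not> module_iso virasoro (L_mod W lam a b) (L_parity_mod 1 W2 w2 a2 b2)"
    using module_iso_trans[OF _ P2(1)] L_mod_not_iso_refl_mod[OF W \<open>lam \<noteq> 0\<close> \<open>b2 \<noteq> 0\<close> Re Re2] by blast
  show "\<not> module_iso virasoro (N_mod B a0) (L_parity_mod 0 W1 w1 a1 b1)"
    using module_iso_trans[OF _ P1(1)] N_mod_not_iso_refl_mod[OF B Re0 Re1] by blast
  show "\<not> module_iso virasoro (N_mod B a0) (L_parity_mod 1 W2 w2 a2 b2)"
    using module_iso_trans[OF _ P2(1)] N_mod_not_iso_refl_mod[OF B Re0 Re2] by blast
  show "\<not> module_iso virasoro (L_parity_mod 0 W1 w1 a1 b1) (L_parity_mod 1 W2 w2 a2 b2)"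
  proof
    assume "module_iso virasoro (L_parity_mod 0 W1 w1 a1 b1) (L_parity_mod 1 W2 w2 a2 b2)"
    then have "module_iso virasoro (refl_mod 0 a1 b1) (refl_mod 1 a2 b2)"
      by (intro module_iso_trans[OF P1(2) module_iso_trans[OF _ P2(1)]])
    from refl_mod_iso_imp(3)[OF this \<open>b1 \<noteq> 0\<close> \<open>b2 \<noteq> 0\<close> Re1 Re2] show False by simp
  qed
qed

end
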